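(* Let $\mathcal{A}$ be an area functional and $X$ a metric space. If $X$ admits a contracting barycenter map, then $X$ satisfies a $\frac{1}{2\pi}$-quadratic isoperimetric inequality with respect to $\mathcal{A}$; that is, every Lipschitz curve $\eta:S^1\to X$ of length $L_\eta$ satisfies $$\mathrm{Fill}_{\mathcal{A}}(\eta)\le \frac{1}{2\pi}L_\eta^2 .$$
   Context: Contracting barycenter maps. For a metric space $(X,d)$ let $\mathcal{P}(X)$ be the set of Borel probability measures on $X$ with separable support. For $\mu,\nu\in\mathcal{P}(X)$ the Wasserstein $1$-distance is $d_W(\mu,\nu)=\inf_{K}\int_{X\times X}d(x,y)\,dK(x,y)$, the infimum over all couplings $K\in\mathcal{P}(X\times X)$ with marginals $\mu,\nu$. $\mathcal{P}_1(X)$ is the set of $\mu\in\mathcal{P}(X)$ at finite $d_W$-distance from the Dirac measures, with metric $d_W$. A contracting barycenter map on $X$ is a $1$-Lipschitz map $b:(\mathcal{P}_1(X),d_W)\to X$ with $b(\delta_x)=x$ for all $x\in X$. Area functionals. For a Lipschitz map $f:E\to X$, with $E\subseteq\mathbb{R}^2$ Borel and $X$ a metric space, let $\mathcal{A}^b(f)=\int_X\mathrm{card}(f^{-1}(y))\,d\mathcal{H}^2_X(y)$ (Busemann area; $\mathcal{H}^2_X$ is the $2$-dimensional Hausdorff measure, normalized to agree with Lebesgue measure on $\mathbb{R}^2$). An area functional $\mathcal{A}$ assigns to every such Lipschitz map $f:E\to X$ a number $\mathcal{A}(f)\in[0,\infty]$ such that: (1) (Normalization) if $X$ is a Riemannian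 manifold then $\mathcal{A}(f)=\mathcal{A}^b(f)$; (2) (Monotonicity) if $g:X\to Y$ is $L$-Lipschitz then $\mathcal{A}(g\circ f)\le L^2\mathcal{A}(f)$; (3) (Coordinate invariance) if $E'\subseteq\mathbb{R}^2$ is Borel and $\phi:E'\to E$ is a bi-Lipschitz homeomorphism onto $E$ then $\mathcal{A}(f\circ\phi)=\mathcal{A}(f)$; (4) ($\sigma$-additivity) if $E=\bigsqcup_{i=1}^\infty E_i$ with $E_i\subseteq\mathbb{R}^2$ Borel then $\mathcal{A}(f)=\sum_{i=1}^\infty\mathcal{A}(f|_{E_i})$. Filling area. $D^2\subset\mathbb{R}^2$ is the closed unit disc, $S^1=\partial D^2$. A filling of a Lipschitz curve $\eta:S^1\to X$ is a Lipschitz map $f:D^2\to X$ with $f|_{S^1}=\eta$. $\mathrm{Fill}_{\mathcal{A}}(\eta)$ is the infimum of $\mathcal{A}(f)$ over all fillings $f$ of $\eta$. *)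

theory Defs
  imports "HOL-Analysis.Analysis"
    "HOL-Probability.Giry_Monad"
begin

text \<open>
  Metric spaces are values of the library type \<open>'a metric\<close>, i.e. a carrier \<open>mspace M\<close> with a distance
  \<open>mdist M\<close>.  An area functional has to be defined on all metric spaces at once; as HOL cannot
  quantify over types inside a formula, the metric spaces considered are those whose points are
  taken from an arbitrary type \<open>'a\<close>, which plays the role of the universe.
\<close>

section \<open>Contracting barycenter maps\<close>

definition metric_borel :: "'a metric \<Rightarrow> 'a measure" where
  "metric_borel M = sigma (mspace M) {U. openin (mtopology_of M) U}"

definition measure_support :: "'a metric \<Rightarrow> 'a measure \<Rightarrow> 'a set" where
  "measure_support M \<mu> =
     {x \<in> mspace M. \<forall>U. openin (mtopology_of M) U \<and> x \<in> U \<longrightarrow> 0 < emeasure \<mu> U}"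

definition prob_measures :: "'a metric \<Rightarrow> 'a measure set" where
  "prob_measures M =
     {\<mu>. space \<mu> = mspace M \<and> sets \<mu> = sets (metric_borel M) \<and> prob_space \<mu> \<and>
         separable_space (subtopology (mtopology_of M) (measure_support M \<mu>))}"

text \<open>Couplings are Borel measures of the product metric space; in the nonseparable case its Borel
  algebra may be larger than the product of the Borel algebras.\<close>

definition couplings :: "'a metric \<Rightarrow> 'a measure \<Rightarrow> 'a measure \<Rightarrow> ('a \<times> 'a) measure set" where
  "couplings M \<mu> \<nu> =
     {K \<in> prob_measures (prod_metric M M).
        distr K (metric_borel M) fst = \<mu> \<and> distr K (metric_borel M) snd = \<nu>}"

definition wasserstein_dist :: "'a metric \<Rightarrow> 'a measure \<Rightarrow> 'a measure \<Rightarrow> ennreal" where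
  "wasserstein_dist M \<mu> \<nu> =
     (INF K \<in> couplings M \<mu> \<nu>. \<integral>\<^sup>+ z. ennreal (mdist M (fst z) (snd z)) \<partial>K)"

definition dirac :: "'a metric \<Rightarrow> 'a \<Rightarrow> 'a measure" where
  "dirac M x = return (metric_borel M) x"

definition wasserstein_space :: "'a metric \<Rightarrow> 'a measure set" where
  "wasserstein_space M =
     {\<mu> \<in> prob_measures M. \<forall>x \<in> mspace M. wasserstein_dist M \<mu> (dirac M x) < \<infinity>}"

definition contracting_barycenter_map :: "'a metric \<Rightarrow> ('a measure \<Rightarrow> 'a) \<Rightarrow> bool" where
  "contracting_barycenter_map M b \<longleftrightarrow>
     b \<in> wasserstein_space M \<rightarrow> mspace M \<and>
     (\<forall>\<mu> \<in> wasserstein_space M. \<forall>\<nu> \<in> wasserstein_space M.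
        ennreal (mdist M (b \<mu>) (b \<nu>)) \<le> wasserstein_dist M \<mu> \<nu>) \<and>
     (\<forall>x \<in> mspace M. b (dirac M x) = x)"


section \<open>The two-dimensional Hausdorff measure and the Busemann area\<close>

definition set_diameter :: "'a metric \<Rightarrow> 'a set \<Rightarrow> ennreal" where
  "set_diameter M S = (SUP x\<in>S. SUP y\<in>S. ennreal (mdist M x y))"

definition hausdorff2_unnormalized :: "'a metric \<Rightarrow> 'a set \<Rightarrow> ennreal" where
  "hausdorff2_unnormalized M S =
     (SUP \<delta>\<in>{0::real<..}.
        INF C \<in> {C :: nat \<Rightarrow> 'a set. S \<subseteq> (\<Union>i. C i) \<and>
                   (\<forall>i. C i \<subseteq> mspace M \<and> set_diameter M (C i) \<le> ennreal \<delta>)}.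
          \<Sum>i. (set_diameter M (C i))\<^sup>2)"

text \<open>Normalized so that the unit square of the Euclidean plane gets measure 1, that is, so as to
  agree with Lebesgue measure there.\<close>

definition hausdorff2_outer :: "'a metric \<Rightarrow> 'a set \<Rightarrow> ennreal" where
  "hausdorff2_outer M S =
     hausdorff2_unnormalized M S /
     hausdorff2_unnormalized euclidean_metric (cbox 0 1 :: (real^2) set)"

text \<open>On the Caratheodory measurable sets, which include the Borel sets.\<close>

definition hausdorff2 :: "'a metric \<Rightarrow> 'a measure" where
  "hausdorff2 M =
     measure_of (mspace M)
       (lambda_system (mspace M) (Pow (mspace M)) (hausdorff2_outer M))
       (hausdorff2_outer M)"

definition busemann_area :: "'a metric \<Rightarrow> (real^2) set \<Rightarrow> (real^2 \<Rightarrow> 'a) \<Rightarrow> ennreal" where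
  "busemann_area M E f =
     (\<integral>\<^sup>+ y. emeasure (count_space UNIV) {x \<in> E. f x = y} \<partial>hausdorff2 M)"


section \<open>Riemannian manifolds\<close>

text \<open>Since the dimension \<open>n\<close> of a manifold is existentially quantified, \<open>\<real>\<^sup>n\<close> is the library's
  \<open>Euclidean_space n\<close>: functions \<open>nat \<Rightarrow> real\<close> that vanish at all indices \<open>\<ge> n\<close>.\<close>

definition partial_deriv :: "nat \<Rightarrow> ((nat \<Rightarrow> real) \<Rightarrow> real) \<Rightarrow> (nat \<Rightarrow> real) \<Rightarrow> real" where
  "partial_deriv i f x = deriv (\<lambda>t. f (x(i := t))) (x i)"

primrec C_k_on :: "nat \<Rightarrow> nat \<Rightarrow> (nat \<Rightarrow> real) set \<Rightarrow> ((nat \<Rightarrow> real) \<Rightarrow> real) \<Rightarrow> bool" where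
  "C_k_on 0 n U f \<longleftrightarrow>
     continuous_map (subtopology (Euclidean_space n) U) euclideanreal f"
| "C_k_on (Suc k) n U f \<longleftrightarrow>
     continuous_map (subtopology (Euclidean_space n) U) euclideanreal f \<and>
     (\<forall>i<n. (\<forall>x\<in>U. (\<lambda>t. f (x(i := t))) differentiable (at (x i))) \<and>
            C_k_on k n U (partial_deriv i f))"

definition smooth_fun_on :: "nat \<Rightarrow> (nat \<Rightarrow> real) set \<Rightarrow> ((nat \<Rightarrow> real) \<Rightarrow> real) \<Rightarrow> bool" where
  "smooth_fun_on n U f \<longleftrightarrow> (\<forall>k. C_k_on k n U f)"

text \<open>A chart \<open>(V, \<psi>, g)\<close> is a local parametrization \<open>\<psi>\<close> defined on \<open>V \<subseteq> \<real>\<^sup>n\<close> (the inverse of a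
  coordinate map), together with the coefficients \<open>g x i j\<close> of the metric tensor in the
  corresponding coordinates.\<close>

type_synonym 'a riem_chart =
  "(nat \<Rightarrow> real) set \<times> ((nat \<Rightarrow> real) \<Rightarrow> 'a) \<times> ((nat \<Rightarrow> real) \<Rightarrow> nat \<Rightarrow> nat \<Rightarrow> real)"

definition riem_chart :: "nat \<Rightarrow> 'a topology \<Rightarrow> 'a riem_chart \<Rightarrow> bool" where
  "riem_chart n T c \<longleftrightarrow> (case c of (V, \<psi>, g) \<Rightarrow>
     openin (Euclidean_space n) V \<and> openin T (\<psi> ` V) \<and>
     homeomorphic_map (subtopology (Euclidean_space n) V) (subtopology T (\<psi> ` V)) \<psi> \<and>
     (\<forall>i<n. \<forall>j<n. smooth_fun_on n V (\<lambda>x. g x i j)) \<and>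
     (\<forall>x\<in>V. \<forall>i<n. \<forall>j<n. g x i j = g x j i) \<and>
     (\<forall>x\<in>V. \<forall>v :: nat \<Rightarrow> real. (\<exists>i<n. v i \<noteq> 0) \<longrightarrow>
         0 < (\<Sum>i<n. \<Sum>j<n. g x i j * v i * v j)))"

text \<open>Smooth change of coordinates \<open>\<tau>\<close>, under which the metric tensor transforms as a tensor.\<close>

definition riem_compatible :: "nat \<Rightarrow> 'a riem_chart \<Rightarrow> 'a riem_chart \<Rightarrow> bool" where
  "riem_compatible n c c' \<longleftrightarrow> (case c of (V, \<psi>, g) \<Rightarrow> case c' of (W, \<theta>, h) \<Rightarrow>
     (let U = {x \<in> V. \<psi> x \<in> \<theta> ` W}; \<tau> = (\<lambda>x. inv_into W \<theta> (\<psi> x)) in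
       (\<forall>k<n. smooth_fun_on n U (\<lambda>x. \<tau> x k)) \<and>
       (\<forall>x\<in>U. \<forall>i<n. \<forall>j<n.
          g x i j = (\<Sum>k<n. \<Sum>l<n. h (\<tau> x) k l *
                       partial_deriv i (\<lambda>y. \<tau> y k) x * partial_deriv j (\<lambda>y. \<tau> y l) x))))"

definition riem_atlas :: "nat \<Rightarrow> 'a topology \<Rightarrow> 'a riem_chart set \<Rightarrow> bool" where
  "riem_atlas n T \<A> \<longleftrightarrow>
     (\<forall>c\<in>\<A>. riem_chart n T c) \<and>
     (\<Union>(V, \<psi>, g)\<in>\<A>. \<psi> ` V) = topspace T \<and>
     (\<forall>c\<in>\<A>. \<forall>c'\<in>\<A>. riem_compatible n c c')"

text \<open>There is a \<open>C\<^sup>1\<close> curve of length \<open>l\<close> from \<open>p\<close> to \<open>q\<close> inside the given chart.\<close>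

definition riem_arc :: "nat \<Rightarrow> 'a riem_chart \<Rightarrow> 'a \<Rightarrow> real \<Rightarrow> 'a \<Rightarrow> bool" where
  "riem_arc n c p l q \<longleftrightarrow> (case c of (V, \<psi>, g) \<Rightarrow>
     \<exists>(x :: real \<Rightarrow> nat \<Rightarrow> real) (v :: real \<Rightarrow> nat \<Rightarrow> real).
       x ` {0..1} \<subseteq> V \<and> \<psi> (x 0) = p \<and> \<psi> (x 1) = q \<and>
       (\<forall>i<n. continuous_on {0..1} (\<lambda>t. v t i) \<and>
          (\<forall>t\<in>{0..1}. ((\<lambda>s. x s i) has_real_derivative v t i) (at t within {0..1}))) \<and>
       l = integral {0..1} (\<lambda>t. sqrt (\<Sum>i<n. \<Sum>j<n. g (x t) i j * v t i * v t j)))"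

text \<open>Piecewise \<open>C\<^sup>1\<close> curves, as finite concatenations of \<open>C\<^sup>1\<close> arcs each of which stays in one chart;
  \<open>l\<close> is the total length.\<close>

inductive riem_path :: "nat \<Rightarrow> 'a riem_chart set \<Rightarrow> 'a \<Rightarrow> real \<Rightarrow> 'a \<Rightarrow> bool"
  for n :: nat and \<A> :: "'a riem_chart set" where
  refl: "riem_path n \<A> p 0 p"
| step: "\<lbrakk>riem_path n \<A> p l q; c \<in> \<A>; riem_arc n c q m r\<rbrakk> \<Longrightarrow> riem_path n \<A> p (l + m) r"

text \<open>A metric space is a (connected) Riemannian manifold if its distance is the one induced by a
  smooth Riemannian metric on it.\<close>

definition riemannian_manifold :: "'a metric \<Rightarrow> bool" where
  "riemannian_manifold M \<longleftrightarrow>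
     (\<exists>n \<A>. riem_atlas n (mtopology_of M) \<A> \<and>
        (\<forall>p \<in> mspace M. \<forall>q \<in> mspace M.
           (\<exists>l. riem_path n \<A> p l q) \<and> mdist M p q = Inf {l. riem_path n \<A> p l q}))"


section \<open>Area functionals\<close>

definition lipschitz_from :: "(real^2) set \<Rightarrow> 'a metric \<Rightarrow> (real^2 \<Rightarrow> 'a) \<Rightarrow> bool" where
  "lipschitz_from E M f \<longleftrightarrow> Lipschitz_continuous_map (submetric euclidean_metric E) M f"

text \<open>\<open>Area M E f\<close> is the area of the Lipschitz map \<open>f : E \<rightarrow> M\<close>.  As HOL functions are total,
  \<open>well_defined\<close> expresses that it depends only on the values of \<open>f\<close> on \<open>E\<close>; in particular the same
  \<open>f\<close> on a smaller set stands for the restriction.\<close>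

locale area_functional =
  fixes Area :: "'a metric \<Rightarrow> (real^2) set \<Rightarrow> (real^2 \<Rightarrow> 'a) \<Rightarrow> ennreal"
  assumes well_defined:
    "\<And>M E f g. \<lbrakk>E \<in> sets borel; lipschitz_from E M f; \<And>x. x \<in> E \<Longrightarrow> f x = g x\<rbrakk>
       \<Longrightarrow> Area M E f = Area M E g"
  and normalization:
    "\<And>M E f. \<lbrakk>E \<in> sets borel; lipschitz_from E M f; riemannian_manifold M\<rbrakk>
       \<Longrightarrow> Area M E f = busemann_area M E f"
  and monotonicity:
    "\<And>M N E f g L. \<lbrakk>E \<in> sets borel; lipschitz_from E M f; 0 \<le> L;
        g \<in> mspace M \<rightarrow> mspace N;
        \<And>x y. \<lbrakk>x \<in> mspace M; y \<in> mspace M\<rbrakk> \<Longrightarrow> mdist N (g x) (g y) \<le> L * mdist M x y\<rbrakk>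
       \<Longrightarrow> Area N E (g \<circ> f) \<le> ennreal (L\<^sup>2) * Area M E f"
  and coordinate_invariance:
    "\<And>M E E' f \<phi> K K'. \<lbrakk>E \<in> sets borel; E' \<in> sets borel; lipschitz_from E M f;
        bij_betw \<phi> E' E; K-lipschitz_on E' \<phi>; K'-lipschitz_on E (inv_into E' \<phi>)\<rbrakk>
       \<Longrightarrow> Area M E' (f \<circ> \<phi>) = Area M E f"
  and sigma_additivity:
    "\<And>M E F f. \<lbrakk>E \<in> sets borel; lipschitz_from E M f;
        \<And>i::nat. F i \<in> sets borel; disjoint_family F; E = (\<Union>i. F i)\<rbrakk>
       \<Longrightarrow> Area M E f = (\<Sum>i. Area M (F i) f)"


section \<open>Length and filling area of closed curves\<close>

definition curve_length :: "'a metric \<Rightarrow> real \<Rightarrow> real \<Rightarrow> (real \<Rightarrow> 'a) \<Rightarrow> ennreal" where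
  "curve_length M a b c =
     (SUP (k, t) \<in> {(k :: nat, t :: nat \<Rightarrow> real). mono_on {..k} t \<and> t ` {..k} \<subseteq> {a..b}}.
        \<Sum>i<k. ennreal (mdist M (c (t i)) (c (t (Suc i)))))"

definition closed_curve_length :: "'a metric \<Rightarrow> (real^2 \<Rightarrow> 'a) \<Rightarrow> ennreal" where
  "closed_curve_length M \<eta> = curve_length M 0 (2 * pi) (\<lambda>t. \<eta> (vector [cos t, sin t]))"

definition fillings :: "'a metric \<Rightarrow> (real^2 \<Rightarrow> 'a) \<Rightarrow> (real^2 \<Rightarrow> 'a) set" where
  "fillings M \<eta> = {f. lipschitz_from (cball 0 1) M f \<and> (\<forall>x \<in> sphere 0 1. f x = \<eta> x)}"

definition filling_area ::
  "('a metric \<Rightarrow> (real^2) set \<Rightarrow> (real^2 \<Rightarrow> 'a) \<Rightarrow> ennreal) \<Rightarrow> 'a metric \<Rightarrow> (real^2 \<Rightarrow> 'a) \<Rightarrow> ennreal"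
  where "filling_area Area M \<eta> = (INF f \<in> fillings M \<eta>. Area M (cball 0 1) f)"

end

theory Submission
  imports Defs
begin

text \<open>
  Let \<open>l = L / (2 * pi)\<close>.  The curve, parametrized proportionally to arc length, is extended to an
  \<open>l\<close>-Lipschitz map on the round unit hemisphere, which has area \<open>2 * pi\<close>; this gives
  \<open>2 * pi * l\<^sup>2 = L\<^sup>2 / (2 * pi)\<close>.  The extension sends a point \<open>p\<close> of the hemisphere to the
  barycenter of the push-forward under the curve of the probability measure \<open>\<mu>\<^sub>p\<close> on the equator with density
  \<open>(1 - (1/2) * (\<partial>/\<partial>y)\<^sup>2 (pi - d(p,y))\<^sup>2) / (2 * pi)\<close>, where \<open>d\<close> is the spherical distance.
  For \<open>p\<close> on the equator \<open>\<mu>\<^sub>p\<close> is the Dirac measure, and \<open>p \<mapsto> \<mu>\<^sub>p\<close> is \<open>1\<close>-Lipschitz for the Wasserstein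
  distance: when \<open>p\<close> moves with unit velocity, the flux of mass through \<open>y\<close> is, up to a constant, a
  function of \<open>y\<close> that decreases on one half of the equator and increases on the other, and its
  total variation is \<open>1\<close>.

  To have finitely many atoms, \<open>\<mu>\<^sub>p\<close> is replaced by its averages over \<open>N\<close> arcs.  Averaging preserves the
  Lipschitz constant but spoils the boundary values, which a collar of small area restores.

  Areas are estimated without any measure theory of the Hausdorff measure: the disc is cut into
  coordinate cells, each reparametrized over a square in a copy of the Euclidean plane, and the
  normalization only enters through the scaling of the Hausdorff outer measure of squares.
\<close>

section \<open>Euclidean spaces as Riemannian manifolds on a prescribed set of points\<close>

text \<open>The density interpolates between two extremes. At the pole the distance is constant and
  the measure is uniform. On the equator \<open>(pi - d)\<^sup>2\<close> is a parabola with second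
  derivative 2, so the density vanishes except at \<open>y = p\<close>, where the corner contributes
  mass 1. Moving mass on a circle costs the integral of the absolute flux, and a change of mass
  determines the flux only up to a constant circulation. Up to sign the flux is the derivative of
  the function \<open>U\<close> in \<open>hemi_flow_variation\<close>, whose linear term fixes that
  constant. The cost is therefore the total variation of \<open>U\<close>, which can be computed
  because \<open>U\<close> has only two turning points. Averaging over arcs replaces it by a sum of
  increments of \<open>U\<close>, which is no larger. The other obstacle is the universe
  \<open>'a\<close>: normalization speaks only of manifolds with points in \<open>'a\<close>, so a
  copy of the plane has to be found there. A nonconstant Lipschitz curve provides room for it, as
  its image has the cardinality of the continuum.\<close>

lemma mdist_self: "x \<in> mspace M \<Longrightarrow> mdist M x x = 0"
  by simp

section \<open>Smoothness on the Euclidean coordinate space\<close>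

lemma C_k_on_const: "C_k_on k n U (\<lambda>x. c)"
proof (induction k arbitrary: c)
  case (Suc k)
  have "partial_deriv i (\<lambda>x. c) = (\<lambda>x. 0)" for i
    by (simp add: partial_deriv_def fun_eq_iff)
  with Suc show ?case by simp
qed simp

lemma C_k_on_proj: "C_k_on k n U (\<lambda>x. x i)"
proof (cases k)
  case 0
  show ?thesis
    unfolding 0 by (auto simp: Euclidean_space_def subtopology_subtopology
        intro!: continuous_map_from_subtopology continuous_map_product_projection)
next
  case (Suc k')
  have cont: "continuous_map (subtopology (Euclidean_space n) U) euclideanreal (\<lambda>x. x i)"
    by (auto simp: Euclidean_space_def subtopology_subtopology
        intro!: continuous_map_from_subtopology continuous_map_product_projection)
  have eq: "(\<lambda>t. (x(l := t)) i) = (if l = i then (\<lambda>t. t) else (\<lambda>t. x i))" for x :: "nat \<Rightarrow> real" and l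
    by (auto simp: fun_eq_iff)
  have pd: "partial_deriv l (\<lambda>x. x i) = (\<lambda>x. if l = i then 1 else 0)" for l
    unfolding partial_deriv_def eq by (auto simp: fun_eq_iff)
  have "(\<lambda>t. (x(l := t)) i) differentiable at (x l)" for x :: "nat \<Rightarrow> real" and l
    unfolding eq by auto
  with cont show ?thesis
    unfolding Suc C_k_on.simps pd by (auto intro: C_k_on_const)
qed

lemma upd_in_Euclidean_space:
  "x \<in> topspace (Euclidean_space n) \<Longrightarrow> i < n \<Longrightarrow> x(i := t) \<in> topspace (Euclidean_space n)"
  by (auto simp: topspace_Euclidean_space)

text \<open>Coordinate lines never leave the whole space, so functions that agree there have the
  same partial derivatives there. Applied to the transition map of a single chart with itself, which
  is the identity only on \<open>topspace (Euclidean_space n)\<close>.\<close>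

lemma C_k_on_cong:
  assumes "\<And>x. x \<in> topspace (Euclidean_space n) \<Longrightarrow> f x = g x"
  shows "C_k_on k n (topspace (Euclidean_space n)) f \<longleftrightarrow> C_k_on k n (topspace (Euclidean_space n)) g"
  using assms
proof (induction k arbitrary: f g)
  case 0
  then show ?case
    by (auto intro: continuous_map_eq)
next
  case (Suc k)
  have upd: "(\<lambda>t. f (x(i := t))) = (\<lambda>t. g (x(i := t)))" if "x \<in> topspace (Euclidean_space n)" "i < n" for x i
    using upd_in_Euclidean_space[OF that] Suc.prems by (auto simp: fun_eq_iff)
  have "partial_deriv i f x = partial_deriv i g x" if "x \<in> topspace (Euclidean_space n)" "i < n" for x i
    using upd[OF that] by (simp add: partial_deriv_def)
  then have "C_k_on k n (topspace (Euclidean_space n)) (partial_deriv i f) \<longleftrightarrow>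
        C_k_on k n (topspace (Euclidean_space n)) (partial_deriv i g)" if "i < n" for i
    using Suc.IH that by blast
  moreover have "continuous_map (subtopology (Euclidean_space n) (topspace (Euclidean_space n))) euclideanreal f \<longleftrightarrow>
        continuous_map (subtopology (Euclidean_space n) (topspace (Euclidean_space n))) euclideanreal g"
    using Suc.prems by (auto intro: continuous_map_eq)
  ultimately show ?case
    using upd by auto
qed

text \<open>An area functional only sees metric spaces with points in \<open>'a\<close>, so Euclidean spaces have to be
  transported to \<open>'a\<close> along an injection.\<close>

definition euclidean_copy :: "nat \<Rightarrow> ((nat \<Rightarrow> real) \<Rightarrow> 'a) \<Rightarrow> 'a metric" where
  "euclidean_copy n j =
     (let E = topspace (Euclidean_space n) in
      metric (j ` E, \<lambda>a b. sqrt (\<Sum>i<n. (inv_into E j a i - inv_into E j b i)\<^sup>2)))"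

lemma
  assumes j: "inj_on j (topspace (Euclidean_space n))"
  shows mspace_euclidean_copy: "mspace (euclidean_copy n j) = j ` topspace (Euclidean_space n)"
    and mdist_euclidean_copy: "x \<in> topspace (Euclidean_space n) \<Longrightarrow> y \<in> topspace (Euclidean_space n) \<Longrightarrow>
      mdist (euclidean_copy n j) (j x) (j y) = sqrt (\<Sum>i<n. (x i - y i)\<^sup>2)"
proof -
  define E where "E = topspace (Euclidean_space n)"
  define J where "J = inv_into E j"
  define d where "d = (\<lambda>a b. sqrt (\<Sum>i<n. (J a i - J b i)\<^sup>2))"
  have J: "J (j x) = x" if "x \<in> E" for x
    using j that by (simp add: J_def E_def)
  have "Metric_space (j ` E) d"
  proof
    show "0 \<le> d a b" for a b by (simp add: d_def sum_nonneg)
    show "d a b = d b a" for a b by (simp add: d_def power2_commute)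
    show "(d a b = 0) = (a = b)" if ab: "a \<in> j ` E" "b \<in> j ` E" for a b
    proof
      obtain x y where xy: "a = j x" "b = j y" "x \<in> E" "y \<in> E" using ab by auto
      assume "d a b = 0"
      then have "\<forall>i<n. x i = y i"
        using xy by (auto simp: d_def J sum_nonneg_eq_0_iff)
      moreover have "\<forall>i\<ge>n. x i = y i"
        using xy by (auto simp: E_def topspace_Euclidean_space)
      ultimately have "x = y" by (metis ext linorder_not_less)
      then show "a = b" by (simp add: xy)
    qed (simp add: d_def)
    show "d a c \<le> d a b + d b c" for a b c
      using L2_set_triangle_ineq[of "\<lambda>i. J a i - J b i" "\<lambda>i. J b i - J c i" "{..<n}"]
      by (simp add: d_def L2_set_def)
  qed
  then have "mspace (euclidean_copy n j) = j ` E" "mdist (euclidean_copy n j) = d"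
    unfolding euclidean_copy_def Let_def E_def[symmetric] J_def[symmetric] d_def[symmetric]
    by (auto simp: Metric_space.mspace_metric Metric_space.mdist_metric)
  then show "mspace (euclidean_copy n j) = j ` topspace (Euclidean_space n)"
    and "x \<in> topspace (Euclidean_space n) \<Longrightarrow> y \<in> topspace (Euclidean_space n) \<Longrightarrow>
      mdist (euclidean_copy n j) (j x) (j y) = sqrt (\<Sum>i<n. (x i - y i)\<^sup>2)"
    by (auto simp: E_def[symmetric] d_def J)
qed

text \<open>One side is a subspace of a product, the other a metric space. Continuity of
  \<open>j\<close> holds because the squared distance is a polynomial in the coordinates, that of
  the inverse because each coordinate is 1-Lipschitz.\<close>

lemma homeomorphic_map_euclidean_copy:
  assumes j: "inj_on j (topspace (Euclidean_space n))"
  shows "homeomorphic_map (Euclidean_space n) (mtopology_of (euclidean_copy n j)) j"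
proof -
  define E where "E = topspace (Euclidean_space n)"
  define M where "M = euclidean_copy n j"
  define J where "J = inv_into E j"
  have J: "J (j x) = x" if "x \<in> E" for x
    using j that by (simp add: J_def E_def)
  have sp: "mspace M = j ` E"
    using mspace_euclidean_copy[OF j] by (simp add: M_def E_def)
  have dist: "mdist M (j x) (j y) = sqrt (\<Sum>i<n. (x i - y i)\<^sup>2)" if "x \<in> E" "y \<in> E" for x y
    using mdist_euclidean_copy[OF j] that by (simp add: M_def E_def)
  have cj: "continuous_map (Euclidean_space n) (mtopology_of M) j"
    unfolding mtopology_of_def Metric_space.continuous_map_to_metric[OF Metric_space_mspace_mdist]
  proof (intro ballI allI impI)
    fix x and \<epsilon> :: real assume x: "x \<in> topspace (Euclidean_space n)" and e: "0 < \<epsilon>"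
    define U where "U = {y \<in> topspace (Euclidean_space n). (\<Sum>i<n. (x i - y i)\<^sup>2) \<in> {..<\<epsilon>\<^sup>2}}"
    have pr: "continuous_map (Euclidean_space n) euclideanreal (\<lambda>y. y i)" for i
      unfolding Euclidean_space_def
      by (auto intro!: continuous_map_from_subtopology continuous_map_product_projection)
    have "continuous_map (Euclidean_space n) euclideanreal (\<lambda>y. \<Sum>i<n. (x i - y i)\<^sup>2)"
      by (intro continuous_map_sum continuous_map_real_pow continuous_map_diff pr) auto
    then have "openin (Euclidean_space n) U"
      unfolding U_def by (rule openin_continuous_map_preimage) auto
    moreover have "x \<in> U" using x e by (simp add: U_def)
    moreover have "\<forall>y\<in>U. j y \<in> Metric_space.mball (mspace M) (mdist M) (j x) \<epsilon>"
    proof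
      fix y assume y: "y \<in> U"
      then have "j x \<in> mspace M" "j y \<in> mspace M" "mdist M (j x) (j y) < \<epsilon>"
        using x dist[of x y] e sp by (auto simp: U_def E_def intro!: real_less_lsqrt sum_nonneg)
      then show "j y \<in> Metric_space.mball (mspace M) (mdist M) (j x) \<epsilon>"
        by (simp add: Metric_space.in_mball[OF Metric_space_mspace_mdist])
    qed
    ultimately show "\<exists>U. openin (Euclidean_space n) U \<and> x \<in> U \<and> (\<forall>y\<in>U. j y \<in> Metric_space.mball (mspace M) (mdist M) (j x) \<epsilon>)"
      by blast
  qed
  have cJ: "continuous_map (mtopology_of M) (Euclidean_space n) J"
    unfolding Euclidean_space_def continuous_map_in_subtopology continuous_map_componentwise_UNIV
  proof (intro conjI allI)
    fix k
    have "continuous_map (mtopology_of M) (mtopology_of (euclidean_metric :: real metric)) (\<lambda>a. J a k)"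
    proof (rule Lipschitz_continuous_imp_continuous_map)
      show "Lipschitz_continuous_map M euclidean_metric (\<lambda>a. J a k)"
        unfolding Lipschitz_continuous_map_def
      proof (intro conjI exI ballI)
        fix a b assume ab: "a \<in> mspace M" "b \<in> mspace M"
        obtain x y where xy: "a = j x" "b = j y" "x \<in> E" "y \<in> E" using ab sp by auto
        have "\<bar>x k - y k\<bar> \<le> sqrt (\<Sum>i<n. (x i - y i)\<^sup>2)"
        proof (cases "k < n")
          case True
          have "\<bar>x k - y k\<bar> = L2_set (\<lambda>i. x i - y i) {k}"
            by (simp add: L2_set_def)
          also have "\<dots> \<le> L2_set (\<lambda>i. x i - y i) {..<n}"
            unfolding L2_set_def using True by (intro real_sqrt_le_mono sum_mono2) auto
          finally show ?thesis by (simp add: L2_set_def)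
        next
          case False
          then show ?thesis using xy by (simp add: E_def topspace_Euclidean_space sum_nonneg)
        qed
        then show "mdist euclidean_metric (J a k) (J b k) \<le> 1 * mdist M a b"
          using xy by (simp add: J dist dist_real_def)
      qed auto
    qed
    then show "continuous_map (mtopology_of M) euclideanreal (\<lambda>a. J a k)" by simp
  qed (auto simp: sp J E_def topspace_Euclidean_space)
  show ?thesis
    unfolding homeomorphic_map_maps M_def[symmetric]
  proof (intro exI)
    show "homeomorphic_maps (Euclidean_space n) (mtopology_of M) j J"
      using cj cJ J by (auto simp: homeomorphic_maps_def E_def sp)
  qed
qed


text \<open>Integrating the inner product of the velocity with the chord \<open>e\<close> gives the
  squared chord length, while Cauchy-Schwarz bounds the integrand by chord length times speed; one
  factor \<open>D\<close> cancels.\<close>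

lemma riem_arc_ge:
  assumes j: "inj_on j (topspace (Euclidean_space n))"
    and arc: "riem_arc n (topspace (Euclidean_space n), j, \<lambda>x i k. if i = k then 1 else 0) p l q"
  shows "p \<in> mspace (euclidean_copy n j) \<and> q \<in> mspace (euclidean_copy n j) \<and> mdist (euclidean_copy n j) p q \<le> l"
proof -
  define E where "E = topspace (Euclidean_space n)"
  obtain x v :: "real \<Rightarrow> nat \<Rightarrow> real" where xE: "x ` {0..1} \<subseteq> E" and p: "j (x 0) = p" and q: "j (x 1) = q"
    and vc: "\<And>i. i < n \<Longrightarrow> continuous_on {0..1} (\<lambda>t. v t i)"
    and dv: "\<And>i t. i < n \<Longrightarrow> t \<in> {0..1} \<Longrightarrow> ((\<lambda>s. x s i) has_real_derivative v t i) (at t within {0..1})"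
    and l: "l = integral {0..1} (\<lambda>t. sqrt (\<Sum>i<n. \<Sum>k<n. (if i = k then 1 else 0) * v t i * v t k))"
    using arc unfolding riem_arc_def prod.case E_def by blast
  have in_E: "x 0 \<in> E" "x 1 \<in> E" using xE by auto
  define e where "e = (\<lambda>i. x 1 i - x 0 i)"
  define D where "D = sqrt (\<Sum>i<n. (e i)\<^sup>2)"
  define N where "N = (\<lambda>t. sqrt (\<Sum>i<n. (v t i)\<^sup>2))"
  have lN: "l = integral {0..1} N"
    unfolding l N_def by (simp add: if_distrib[of "\<lambda>x. x * _"] power2_eq_square cong: if_cong)
  have "(\<lambda>t. \<Sum>i<n. e i * v t i) integrable_on {0..1}" "N integrable_on {0..1}"
    by (auto intro!: integrable_continuous_real continuous_intros vc simp: N_def)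
  moreover have "((\<lambda>t. \<Sum>i<n. e i * v t i) has_integral (\<Sum>i<n. e i * e i)) {0..1}"
  proof (intro has_integral_sum has_integral_mult_right)
    fix i assume "i \<in> {..<n}"
    then show "((\<lambda>t. v t i) has_integral e i) {0..1}"
      unfolding e_def using dv
      by (intro fundamental_theorem_of_calculus) (auto simp: has_real_derivative_iff_has_vector_derivative)
  qed auto
  moreover have "(\<Sum>i<n. e i * v t i) \<le> D * N t" for t
    unfolding D_def N_def using L2_set_mult_ineq[of e "v t" "{..<n}"]
    by (auto simp: L2_set_def intro: order_trans[OF sum_mono] abs_ge_self simp flip: abs_mult)
  ultimately have "(\<Sum>i<n. e i * e i) \<le> integral {0..1} (\<lambda>t. D * N t)"
    by (intro has_integral_le[OF _ integrable_integral]) (auto intro: integrable_on_mult_right)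
  then have "D * D \<le> D * l"
    by (simp add: lN D_def sum_nonneg power2_eq_square)
  moreover have "D \<ge> 0" by (simp add: D_def sum_nonneg)
  moreover have "0 \<le> l" unfolding lN by (intro integral_nonneg \<open>N integrable_on {0..1}\<close>) (auto simp: N_def sum_nonneg)
  ultimately have "D \<le> l" by (cases "D = 0") auto
  then show ?thesis
    using in_E mdist_euclidean_copy[OF j, of "x 0" "x 1"] mspace_euclidean_copy[OF j]
    by (auto simp: p[symmetric] q[symmetric] D_def e_def E_def power2_commute)
qed

text \<open>A single chart with the identity as metric tensor covers everything. Curves in it are no
  shorter than chords, and straight segments attain the chord length, so the infimum is a
  minimum.\<close>

lemma riemannian_manifold_euclidean_copy:
  assumes j: "inj_on j (topspace (Euclidean_space n))"
  shows "riemannian_manifold (euclidean_copy n j)"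
proof -
  define E where "E = topspace (Euclidean_space n)"
  define M where "M = euclidean_copy n j"
  define c where "c = (E, j, \<lambda>(x :: nat \<Rightarrow> real) (i :: nat) k. if i = k then 1 else 0 :: real)"
  have sp: "mspace M = j ` E"
    using mspace_euclidean_copy[OF j] by (simp add: M_def E_def)
  have topM: "topspace (mtopology_of M) = j ` E" by (simp add: sp)
  have st: "subtopology (Euclidean_space n) E = Euclidean_space n" by (simp add: E_def)
  have pos: "0 < (\<Sum>i<n. \<Sum>k<n. (if i = k then 1 else 0) * v i * v k)" if "\<exists>i<n. v i \<noteq> 0" for v :: "nat \<Rightarrow> real"
  proof -
    have "(\<Sum>i<n. \<Sum>k<n. (if i = k then 1 else 0) * v i * v k) = (\<Sum>i<n. (v i)\<^sup>2)"
      by (simp add: if_distrib[of "\<lambda>x. x * _"] power2_eq_square cong: if_cong)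
    also have "\<dots> > 0" using that by (auto intro: sum_pos2)
    finally show ?thesis .
  qed
  have "subtopology (mtopology_of M) (j ` E) = mtopology_of M" "openin (mtopology_of M) (j ` E)"
    by (metis subtopology_topspace topM, metis openin_topspace topM)
  then have chart: "riem_chart n (mtopology_of M) c"
    using homeomorphic_map_euclidean_copy[OF j] pos
    by (auto simp: riem_chart_def c_def st M_def[symmetric] smooth_fun_on_def C_k_on_const) (auto simp: E_def)
  define \<tau> where "\<tau> = (\<lambda>x. inv_into E j (j x))"
  have tau: "\<tau> x = x" if "x \<in> E" for x
    using j that by (simp add: \<tau>_def E_def)
  have U: "{x \<in> E. j x \<in> j ` E} = E" by auto
  have pdt: "partial_deriv i (\<lambda>y. \<tau> y k) x = (if i = k then 1 else 0)" if "x \<in> E" "i < n" for i k x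
  proof -
    have "(\<lambda>t. \<tau> (x(i := t)) k) = (if i = k then (\<lambda>t. t) else (\<lambda>t. x k))"
      using tau upd_in_Euclidean_space[of x n i] that by (auto simp: E_def fun_eq_iff)
    then show ?thesis by (simp add: partial_deriv_def)
  qed
  have "smooth_fun_on n E (\<lambda>x. \<tau> x k)" for k
    unfolding smooth_fun_on_def
    using C_k_on_cong[of n "\<lambda>x. \<tau> x k" "\<lambda>x. x k"] tau C_k_on_proj[of _ n E k] by (simp add: E_def)
  moreover have "(if i = k then 1 else 0) = (\<Sum>a<n. \<Sum>b<n. (if a = b then 1 else 0) *
      partial_deriv i (\<lambda>y. \<tau> y a) x * partial_deriv k (\<lambda>y. \<tau> y b) x)" if "x \<in> E" "i < n" "k < n" for x i k
    using that by (simp add: pdt if_distrib[of "\<lambda>x. x * _"] if_distrib[of "\<lambda>x. _ * x"] cong: if_cong) 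
  ultimately have compat: "riem_compatible n c c"
    unfolding riem_compatible_def c_def prod.case Let_def U \<tau>_def by blast
  have atlas: "riem_atlas n (mtopology_of M) {c}"
    using chart compat topM by (simp add: riem_atlas_def) (simp add: c_def)
  \<comment> \<open>\<open>riem_path.refl\<close> holds at every point of the type
    \<open>'a\<close>, so membership of \<open>p\<close> has to be assumed; the endpoint inherits
    it.\<close>
  have ge: "p \<in> mspace M \<longrightarrow> q \<in> mspace M \<and> mdist M p q \<le> l" if "riem_path n {c} p l q" for p l q
    using that
  proof induction
    case (step p l q c' m r)
    then have "riem_arc n c q m r" by auto
    from riem_arc_ge[OF j this[unfolded c_def E_def]]
    have "q \<in> mspace M" "r \<in> mspace M" "mdist M q r \<le> m" by (auto simp: M_def)
    with step show ?case using mdist_triangle[of p M q r] by auto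
  next
    case (refl p)
    show ?case by (simp add: mdist_self)
  qed
  have path: "riem_path n {c} p (mdist M p q) q" if pq: "p \<in> mspace M" "q \<in> mspace M" for p q
  proof -
    obtain x y where xy: "p = j x" "q = j y" "x \<in> E" "y \<in> E" using pq sp by auto
    define X where "X = (\<lambda>t i. x i + t * (y i - x i))"
    have "riem_arc n c p (mdist M p q) q"
      unfolding c_def riem_arc_def prod.case
    proof (intro exI conjI allI impI ballI)
      show "X ` {0..1} \<subseteq> E" using xy by (auto simp: X_def E_def topspace_Euclidean_space)
      show "j (X 0) = p" "j (X 1) = q" by (auto simp: X_def xy)
      show "continuous_on {0..1} (\<lambda>t. (\<lambda>t i. y i - x i) t i)" for i by simp
      show "((\<lambda>s. X s i) has_real_derivative (\<lambda>t i. y i - x i) t i) (at t within {0..1})" for i t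
        unfolding X_def by (auto intro!: derivative_eq_intros)
      show "mdist M p q = integral {0..1} (\<lambda>t::real. sqrt (\<Sum>i<n. \<Sum>k<n. (if i = k then 1 else 0) *
          (\<lambda>t i. y i - x i) t i * (\<lambda>t i. y i - x i) t k))"
        using mdist_euclidean_copy[OF j, of x y] xy
        by (simp add: if_distrib[of "\<lambda>x. x * _"] power2_commute[of "x _"] M_def E_def cong: if_cong)
          (simp add: power2_eq_square)
    qed
    from riem_path.step[OF riem_path.refl _ this] show ?thesis by simp
  qed
  have "mdist M p q = Inf {l. riem_path n {c} p l q}" if "p \<in> mspace M" "q \<in> mspace M" for p q
    using path ge that by (intro cInf_eq_minimum[symmetric]) auto
  then show ?thesis
    unfolding riemannian_manifold_def M_def[symmetric] using atlas path by blast
qed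

section \<open>Hausdorff measure and area of maps on squares\<close>

lemma plane_copy:
  fixes j :: "real^2 \<Rightarrow> 'a"
  assumes j: "inj j"
  obtains M where "riemannian_manifold M" "mspace M = range j" "\<And>u v. mdist M (j u) (j v) = dist u v"
proof -
  define J where "J = (\<lambda>x :: nat \<Rightarrow> real. j (vector [x 0, x 1]))"
  define V where "V = (\<lambda>(u :: real^2) (i :: nat). if i = 0 then u $ 1 else if i = 1 then u $ 2 else 0)"
  have V: "V u \<in> topspace (Euclidean_space 2)" for u
    by (auto simp: V_def topspace_Euclidean_space)
  have JV: "J (V u) = j u" for u
  proof -
    have "vector [u $ 1, u $ 2] = u" by (simp add: vec_eq_iff forall_2)
    then show ?thesis by (simp add: V_def J_def)
  qed
  have injJ: "inj_on J (topspace (Euclidean_space 2))"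
  proof (rule inj_onI)
    fix x y assume xy: "x \<in> topspace (Euclidean_space 2)" "y \<in> topspace (Euclidean_space 2)" "J x = J y"
    then have "(vector [x 0, x 1] :: real^2) = vector [y 0, y 1]"
      unfolding J_def using j by (meson injD)
    then have "x 0 = y 0" "x 1 = y 1" by (simp_all add: vec_eq_iff forall_2)
    moreover have "x i = y i" if "i \<ge> 2" for i using that xy by (simp add: topspace_Euclidean_space)
    ultimately have "x i = y i" for i
      by (cases "i = 0"; cases "i = 1") auto
    then show "x = y" by blast
  qed
  have sp: "mspace (euclidean_copy 2 J) = range j"
  proof -
    have "J ` topspace (Euclidean_space 2) = range j"
    proof (intro subset_antisym subsetI)
      show "a \<in> J ` topspace (Euclidean_space 2)" if "a \<in> range j" for a
        using that JV V by (metis imageE imageI)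
    qed (auto simp: J_def)
    then show ?thesis using mspace_euclidean_copy[OF injJ] by simp
  qed
  have s2: "(\<Sum>i<2. f i) = f 0 + f 1" for f :: "nat \<Rightarrow> real" by (simp add: numeral_2_eq_2)
  have "mdist (euclidean_copy 2 J) (j u) (j v) = dist u v" for u v
    using mdist_euclidean_copy[OF injJ V V, of u v]
    by (simp add: JV s2) (simp add: V_def dist_vec_def L2_set_def sum_2 dist_real_def)
  from that[OF riemannian_manifold_euclidean_copy[OF injJ] sp this] show ?thesis .
qed

section \<open>Hausdorff outer measure and Busemann area\<close>

lemma ennreal_le_mult_INF:
  fixes x c :: ennreal
  assumes "c \<noteq> 0" "c \<noteq> top" "\<And>i. i \<in> A \<Longrightarrow> x \<le> c * f i"
  shows "x \<le> c * (INF i\<in>A. f i)"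
proof -
  have "x / c \<le> f i" if "i \<in> A" for i
    using divide_right_mono_ennreal[OF assms(3)[OF that], of c] assms(1,2)
    by (simp add: ennreal_mult_divide_eq mult.commute[of c])
  then have "x / c \<le> (INF i\<in>A. f i)" by (rule INF_greatest)
  then have "c * (x / c) \<le> c * (INF i\<in>A. f i)" by (rule mult_left_mono) simp
  moreover have "c * (x / c) = x"
    using assms(1,2) by (simp add: ennreal_times_divide ennreal_mult_divide_eq mult.commute[of c])
  ultimately show ?thesis by simp
qed

lemma set_diameter_image_le:
  assumes "C \<subseteq> mspace M" "0 \<le> L"
    and "\<And>x y. x \<in> mspace M \<Longrightarrow> y \<in> mspace M \<Longrightarrow> mdist N (h x) (h y) \<le> L * mdist M x y"
  shows "set_diameter N (h ` C) \<le> ennreal L * set_diameter M C"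
  unfolding set_diameter_def image_image
proof (intro SUP_least)
  fix x y assume xy: "x \<in> C" "y \<in> C"
  then have "ennreal (mdist N (h x) (h y)) \<le> ennreal (L * mdist M x y)"
    using assms by (intro ennreal_leI) auto
  also have "\<dots> = ennreal L * ennreal (mdist M x y)" using assms(2) by (simp add: ennreal_mult)
  also have "\<dots> \<le> ennreal L * (SUP x\<in>C. SUP y\<in>C. ennreal (mdist M x y))"
    using xy by (intro mult_left_mono SUP_upper2[of x] SUP_upper2[of y]) auto
  finally show "ennreal (mdist N (h x) (h y)) \<le> \<dots>" .
qed

lemma hausdorff2_unnormalized_mono:
  "S \<subseteq> T \<Longrightarrow> hausdorff2_unnormalized M S \<le> hausdorff2_unnormalized M T"
  unfolding hausdorff2_unnormalized_def
  by (intro SUP_mono' INF_superset_mono) auto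

text \<open>The image of a cover by sets of diameter at most \<open>\<delta> / L\<close> is a cover
  by sets of diameter at most \<open>\<delta>\<close>. The covering sets may stick out of
  \<open>S\<close>, which is why \<open>h\<close> is Lipschitz on all of
  \<open>mspace M\<close>.\<close>

lemma hausdorff2_unnormalized_image_le:
  assumes L: "0 < L" and h: "h \<in> mspace M \<rightarrow> mspace N"
    and Lip: "\<And>x y. x \<in> mspace M \<Longrightarrow> y \<in> mspace M \<Longrightarrow> mdist N (h x) (h y) \<le> L * mdist M x y"
  shows "hausdorff2_unnormalized N (h ` S) \<le> ennreal (L\<^sup>2) * hausdorff2_unnormalized M S"
proof -
  let ?F = "\<lambda>M S \<delta>. {C :: nat \<Rightarrow> _ set. S \<subseteq> (\<Union>i. C i) \<and>
                   (\<forall>i. C i \<subseteq> mspace M \<and> set_diameter M (C i) \<le> ennreal \<delta>)}"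
  have "(INF C \<in> ?F N (h ` S) \<delta>. \<Sum>i. (set_diameter N (C i))\<^sup>2) \<le> ennreal (L\<^sup>2) * hausdorff2_unnormalized M S"
    if d: "0 < \<delta>" for \<delta> :: real
  proof -
    have "(INF C \<in> ?F N (h ` S) \<delta>. \<Sum>i. (set_diameter N (C i))\<^sup>2) \<le>
      ennreal (L\<^sup>2) * (INF C \<in> ?F M S (\<delta> / L). \<Sum>i. (set_diameter M (C i))\<^sup>2)"
    proof (intro ennreal_le_mult_INF)
      fix C assume C: "C \<in> ?F M S (\<delta> / L)"
      have diam: "set_diameter N (h ` C i) \<le> ennreal L * set_diameter M (C i)" for i
        using C L Lip by (intro set_diameter_image_le) auto
      have "ennreal L * set_diameter M (C i) \<le> ennreal L * ennreal (\<delta> / L)" for i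
        using C by (intro mult_left_mono) auto
      also have "ennreal L * ennreal (\<delta> / L) = ennreal \<delta>"
        using L d by (simp flip: ennreal_mult)
      finally have "(\<lambda>i. h ` C i) \<in> ?F N (h ` S) \<delta>"
        using C h diam order_trans[OF diam]
        by (intro CollectI conjI allI) (blast | force)+
      then have "(INF C \<in> ?F N (h ` S) \<delta>. \<Sum>i. (set_diameter N (C i))\<^sup>2) \<le> (\<Sum>i. (set_diameter N (h ` C i))\<^sup>2)"
        by (rule INF_lower)
      also have "\<dots> \<le> (\<Sum>i. (ennreal L * set_diameter M (C i))\<^sup>2)"
        by (intro suminf_le power_mono diam) auto
      also have "\<dots> = ennreal (L\<^sup>2) * (\<Sum>i. (set_diameter M (C i))\<^sup>2)"
        using L by (simp add: power_mult_distrib ennreal_power)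
      finally show "(INF C \<in> ?F N (h ` S) \<delta>. \<Sum>i. (set_diameter N (C i))\<^sup>2) \<le>
        ennreal (L\<^sup>2) * (\<Sum>i. (set_diameter M (C i))\<^sup>2)" .
    qed (use L in auto)
    also have "\<dots> \<le> ennreal (L\<^sup>2) * hausdorff2_unnormalized M S"
      unfolding hausdorff2_unnormalized_def
      using d L by (intro mult_left_mono SUP_upper) auto
    finally show ?thesis .
  qed
  then show ?thesis
    unfolding hausdorff2_unnormalized_def[of N] by (intro SUP_least) auto
qed

lemma hausdorff2_outer_mono: "S \<subseteq> T \<Longrightarrow> hausdorff2_outer M S \<le> hausdorff2_outer M T"
  unfolding hausdorff2_outer_def by (intro divide_right_mono_ennreal hausdorff2_unnormalized_mono)

text \<open>Whatever the unnormalized measure of the unit square is, dividing it by itself gives at most \<open>1\<close>: in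
  \<open>ennreal\<close> both \<open>0 / 0\<close> and \<open>top / top\<close> are \<open>0\<close>.\<close>

lemma hausdorff2_outer_square_le:
  assumes L: "0 < L" and h: "range h \<subseteq> mspace N"
    and Lip: "\<And>x y. mdist N (h x) (h y) \<le> L * dist x y"
  shows "hausdorff2_outer N (h ` (cbox 0 1 :: (real^2) set)) \<le> ennreal (L\<^sup>2)"
proof -
  let ?c = "hausdorff2_unnormalized euclidean_metric (cbox 0 1 :: (real^2) set)"
  have "hausdorff2_unnormalized N (h ` (cbox 0 1 :: (real^2) set)) \<le> ennreal (L\<^sup>2) * ?c"
    using assms by (intro hausdorff2_unnormalized_image_le) auto
  then have "hausdorff2_outer N (h ` (cbox 0 1 :: (real^2) set)) \<le> ennreal (L\<^sup>2) * ?c / ?c"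
    unfolding hausdorff2_outer_def by (rule divide_right_mono_ennreal)
  also have "\<dots> = ennreal (L\<^sup>2) * (?c / ?c)" by (simp add: ennreal_times_divide)
  also have "\<dots> \<le> ennreal (L\<^sup>2) * 1"
  proof (intro mult_left_mono)
    show "?c / ?c \<le> 1"
      by (cases "?c = 0"; cases "?c = top") (auto simp: less_top)
  qed auto
  finally show ?thesis by simp
qed

lemma space_hausdorff2: "space (hausdorff2 M) = mspace M"
  unfolding hausdorff2_def by (simp add: space_measure_of_conv)

text \<open>\<open>measure_of\<close> returns either the value of the given set function or the
  default \<open>0\<close>; both are below the outer measure.\<close>

lemma emeasure_hausdorff2_le: "emeasure (hausdorff2 M) A \<le> hausdorff2_outer M A"
  unfolding hausdorff2_def emeasure_measure_of_conv by simp

text \<open>The set \<open>S\<close> is arbitrary. The integral is a supremum over simple functions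
  below the indicator, and each of these lives on a measurable subset of \<open>S\<close>.\<close>

lemma nn_integral_hausdorff2_indicator_le:
  "(\<integral>\<^sup>+ y. indicator S y \<partial>hausdorff2 M) \<le> hausdorff2_outer M S"
  unfolding nn_integral_def
proof (intro SUP_least)
  fix g :: "'a \<Rightarrow> ennreal" assume g: "g \<in> {g. simple_function (hausdorff2 M) g \<and> g \<le> indicator S}"
  define A where "A = {x \<in> space (hausdorff2 M). g x \<noteq> 0}"
  have gA: "A \<in> sets (hausdorff2 M)"
    using borel_measurable_simple_function[of "hausdorff2 M" g] g by (auto simp: A_def)
  have gS: "g x \<le> indicator S x" for x using g by (auto dest: le_funD)
  have "x \<in> S" if "x \<in> A" for x using gS[of x] that by (cases "x \<in> S") (auto simp: A_def)
  then have "A \<subseteq> S" by blast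
  have "simple_integral (hausdorff2 M) g = (\<integral>\<^sup>+ x. g x \<partial>hausdorff2 M)"
    using g by (simp add: nn_integral_eq_simple_integral)
  also have "\<dots> \<le> (\<integral>\<^sup>+ x. indicator A x \<partial>hausdorff2 M)"
  proof (intro nn_integral_mono)
    fix x assume "x \<in> space (hausdorff2 M)"
    then show "g x \<le> indicator A x"
      using gS[of x] by (cases "g x = 0"; cases "x \<in> S") (auto simp: A_def)
  qed
  also have "\<dots> = emeasure (hausdorff2 M) A" using gA by simp
  also have "\<dots> \<le> hausdorff2_outer M S"
    using emeasure_hausdorff2_le hausdorff2_outer_mono[OF \<open>A \<subseteq> S\<close>] order_trans by blast
  finally show "simple_integral (hausdorff2 M) g \<le> hausdorff2_outer M S" .
qed

lemma busemann_area_inj_le: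
  assumes "inj_on f E"
  shows "busemann_area M E f \<le> hausdorff2_outer M (f ` E)"
proof -
  have "emeasure (count_space UNIV) {x \<in> E. f x = y} = indicator (f ` E) y" for y
  proof (cases "y \<in> f ` E")
    case True
    then obtain x where "x \<in> E" "y = f x" by auto
    then have "{x \<in> E. f x = y} = {x}" using assms by (auto dest: inj_onD)
    then show ?thesis using True by simp
  next
    case False
    then have e: "{x \<in> E. f x = y} = {}" by auto
    show ?thesis unfolding e using False by simp
  qed
  then show ?thesis
    unfolding busemann_area_def using nn_integral_hausdorff2_indicator_le by simp
qed

lemma busemann_area_eq_0:
  assumes "hausdorff2_outer M (mspace M) = 0"
  shows "busemann_area M E f = 0"
proof -
  have "emeasure (hausdorff2 M) (space (hausdorff2 M)) = 0"
    using emeasure_hausdorff2_le[of M "mspace M"] assms by (simp add: space_hausdorff2)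
  then have "AE y in hausdorff2 M. False"
    by (simp add: AE_iff_measurable[of "space (hausdorff2 M)"])
  then show ?thesis unfolding busemann_area_def
    by (subst nn_integral_cong_AE[where v = "\<lambda>_. 0"]) auto
qed

lemma hausdorff2_outer_singleton:
  assumes "x \<in> mspace M"
  shows "hausdorff2_outer M {x} = 0"
proof -
  have x: "mdist M x x = 0" using assms by simp
  have "(INF C \<in> {C :: nat \<Rightarrow> 'a set. {x} \<subseteq> (\<Union>i. C i) \<and> (\<forall>i. C i \<subseteq> mspace M \<and> set_diameter M (C i) \<le> ennreal \<delta>)}.
          \<Sum>i. (set_diameter M (C i))\<^sup>2) \<le> 0" for \<delta>
    by (rule INF_lower2[of "\<lambda>_. {x}"]) (auto simp: set_diameter_def x assms)
  then have "hausdorff2_unnormalized M {x} = 0"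
    unfolding hausdorff2_unnormalized_def by (auto simp: SUP_eq_iff intro!: SUP_eqI)
  then show ?thesis by (simp add: hausdorff2_outer_def)
qed

section \<open>Area of constant maps and of Lipschitz maps on squares\<close>

context area_functional begin

text \<open>A constant map factors through the one-point manifold, a copy of 0-dimensional Euclidean
  space, whose Hausdorff measure is zero. The argument works in every type \<open>'a\<close>,
  however small.\<close>

lemma Area_const_eq_0:
  assumes E: "E \<in> sets borel" and c: "c \<in> mspace X"
  shows "Area X E (\<lambda>_. c) = 0"
proof -
  define M where "M = euclidean_copy 0 (\<lambda>_. c)"
  have j: "inj_on (\<lambda>_. c) (topspace (Euclidean_space 0))"
    by (auto simp: inj_on_def topspace_Euclidean_space)
  have "topspace (Euclidean_space 0) = {\<lambda>_. 0}" by (auto simp: topspace_Euclidean_space)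
  then have sp: "mspace M = {c}" using mspace_euclidean_copy[OF j] by (simp add: M_def)
  have "riemannian_manifold M" unfolding M_def by (rule riemannian_manifold_euclidean_copy[OF j])
  moreover have lip: "lipschitz_from E M (\<lambda>_. c)"
    by (auto simp: lipschitz_from_def Lipschitz_continuous_map_def sp mdist_self intro!: exI[of _ 1])
  ultimately have "Area M E (\<lambda>_. c) = busemann_area M E (\<lambda>_. c)"
    using E by (intro normalization)
  also have "\<dots> = 0"
    using hausdorff2_outer_singleton[of c M] sp by (intro busemann_area_eq_0) auto
  finally have "Area M E (\<lambda>_. c) = 0" .
  moreover have "Area X E (id \<circ> (\<lambda>_. c)) \<le> ennreal (1\<^sup>2) * Area M E (\<lambda>_. c)"
    using E lip c sp by (intro monotonicity) (auto simp: sp mdist_self)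
  ultimately show ?thesis by (simp add: o_def)
qed

text \<open>\<open>\<Phi>\<close> is factored through a copy of the plane as
  \<open>g \<circ> j\<close>. Clamping to \<open>cbox p q\<close>, where \<open>\<Phi>\<close> is
  controlled, makes \<open>g\<close> Lipschitz on the entire copy, as \<open>monotonicity\<close>
  demands. The square with corner \<open>a\<close> bounds the Hausdorff measure of
  \<open>E\<close>.\<close>

lemma Area_square_le:
  fixes j :: "real^2 \<Rightarrow> 'a" and p q a :: "real^2"
  assumes j: "inj j" and E: "E \<in> sets borel" "E \<subseteq> cbox p q" "E \<subseteq> cbox a (a + \<delta> *\<^sub>R 1)" and \<delta>: "0 < \<delta>"
    and ne: "cbox p q \<noteq> {}"
    and \<Phi>: "\<Phi> \<in> cbox p q \<rightarrow> mspace X" "0 \<le> \<Lambda>"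
      "\<And>u v. u \<in> cbox p q \<Longrightarrow> v \<in> cbox p q \<Longrightarrow> mdist X (\<Phi> u) (\<Phi> v) \<le> \<Lambda> * dist u v"
  shows "Area X E \<Phi> \<le> ennreal (\<Lambda>\<^sup>2 * \<delta>\<^sup>2)"
proof -
  obtain M where M: "riemannian_manifold M" "mspace M = range j" "\<And>u v. mdist M (j u) (j v) = dist u v"
    using plane_copy[OF j] by blast
  have pq: "\<And>i. i \<in> Basis \<Longrightarrow> p \<bullet> i \<le> q \<bullet> i" using ne by (simp add: box_ne_empty)
  define g where "g = (\<lambda>y. \<Phi> (clamp p q (inv j y)))"
  have gj: "g (j u) = \<Phi> (clamp p q u)" for u using j by (simp add: g_def)
  have cl: "clamp p q u \<in> cbox p q" for u using pq by (rule clamp_in_interval)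
  have lipj: "lipschitz_from E M j"
    using M by (auto simp: lipschitz_from_def Lipschitz_continuous_map_def intro!: exI[of _ 1])
  have "lipschitz_from E X \<Phi>"
    using \<Phi>(1,3) subsetD[OF E(2)]
    by (auto simp: lipschitz_from_def Lipschitz_continuous_map_def intro!: exI[of _ \<Lambda>])
  then have "Area X E \<Phi> = Area X E (g \<circ> j)"
    using E by (intro well_defined) (auto simp: gj)
  also have "\<dots> \<le> ennreal (\<Lambda>\<^sup>2) * Area M E j"
  proof (rule monotonicity[OF E(1) lipj \<Phi>(2)])
    show "g \<in> mspace M \<rightarrow> mspace X" using \<Phi>(1) cl M gj by auto
    show "mdist X (g x) (g y) \<le> \<Lambda> * mdist M x y" if xy: "x \<in> mspace M" "y \<in> mspace M" for x y
    proof -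
      obtain u v where uv: "x = j u" "y = j v" using xy M by auto
      have "mdist X (g x) (g y) \<le> \<Lambda> * dist (clamp p q u) (clamp p q v)"
        unfolding uv gj by (intro \<Phi> cl)
      also have "\<dots> \<le> \<Lambda> * dist u v"
        by (intro mult_left_mono dist_clamps_le_dist_args \<Phi>(2))
      finally show ?thesis using uv M by simp
    qed
  qed
  finally have le: "Area X E \<Phi> \<le> ennreal (\<Lambda>\<^sup>2) * Area M E j" .
  have "Area M E j = busemann_area M E j" using E lipj M by (intro normalization)
  also have "\<dots> \<le> hausdorff2_outer M (j ` E)"
    using j by (intro busemann_area_inj_le) (auto intro: inj_on_subset)
  also have "\<dots> \<le> hausdorff2_outer M ((\<lambda>u. j (a + \<delta> *\<^sub>R u)) ` cbox 0 1)"
  proof (rule hausdorff2_outer_mono, rule subsetI)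
    fix y assume "y \<in> j ` E"
    then obtain u where u: "y = j u" "u \<in> cbox a (a + \<delta> *\<^sub>R 1)" using E by auto
    define v where "v = (1 / \<delta>) *\<^sub>R (u - a)"
    have "v \<in> cbox 0 1" using u(2) \<delta> by (auto simp: v_def mem_box_cart field_simps)
    moreover have "y = j (a + \<delta> *\<^sub>R v)" using \<delta> u by (simp add: v_def)
    ultimately show "y \<in> (\<lambda>u. j (a + \<delta> *\<^sub>R u)) ` cbox 0 1" by blast
  qed
  also have "\<dots> \<le> ennreal (\<delta>\<^sup>2)"
    using \<delta> M by (intro hausdorff2_outer_square_le) (auto simp: dist_norm simp flip: scaleR_diff_right)
  finally have "ennreal (\<Lambda>\<^sup>2) * Area M E j \<le> ennreal (\<Lambda>\<^sup>2) * ennreal (\<delta>\<^sup>2)"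
    by (rule mult_left_mono) simp
  with le show ?thesis by (simp add: ennreal_mult)
qed

end

section \<open>Barycenters of finitely supported measures\<close>

lemma metric_borel_opens: "{U. openin (mtopology_of M) U} \<subseteq> Pow (mspace M)"
  using openin_subset by fastforce

lemma space_metric_borel: "space (metric_borel M) = mspace M"
  by (simp add: metric_borel_def space_measure_of[OF metric_borel_opens])

lemma openin_metric_borel: "openin (mtopology_of M) U \<Longrightarrow> U \<in> sets (metric_borel M)"
  by (simp add: metric_borel_def sets_measure_of[OF metric_borel_opens] sigma_sets.Basic)

lemma continuous_map_measurable_metric_borel:
  assumes "continuous_map (mtopology_of M) (mtopology_of N) f"
  shows "f \<in> metric_borel M \<rightarrow>\<^sub>M metric_borel N"
  unfolding metric_borel_def[of N]
proof (rule measurable_measure_of[OF metric_borel_opens])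
  show "f \<in> space (metric_borel M) \<rightarrow> mspace N"
    using continuous_map_funspace[OF assms] by (simp add: space_metric_borel)
  show "f -` U \<inter> space (metric_borel M) \<in> sets (metric_borel M)" if "U \<in> {U. openin (mtopology_of N) U}" for U
  proof -
    have "f -` U \<inter> space (metric_borel M) = {x \<in> topspace (mtopology_of M). f x \<in> U}"
      by (auto simp: space_metric_borel)
    then show ?thesis
      using openin_continuous_map_preimage[OF assms] that by (auto intro: openin_metric_borel)
  qed
qed

lemma continuous_map_borel_measurable:
  assumes "continuous_map (mtopology_of M) euclideanreal f"
  shows "f \<in> borel_measurable (metric_borel M)"
proof (rule borel_measurableI)
  fix S :: "real set" assume S: "open S"
  have "f -` S \<inter> space (metric_borel M) = {x \<in> topspace (mtopology_of M). f x \<in> S}"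
    by (auto simp: space_metric_borel)
  then show "f -` S \<inter> space (metric_borel M) \<in> sets (metric_borel M)"
    using openin_continuous_map_preimage[OF assms] S by (auto intro: openin_metric_borel)
qed

text \<open>The atoms are indexed, and several indices may carry the same point. Two measures can
  thus be written over one index set and coupled index by index.\<close>

definition atomic_measure :: "'a metric \<Rightarrow> 'i set \<Rightarrow> ('i \<Rightarrow> real) \<Rightarrow> ('i \<Rightarrow> 'a) \<Rightarrow> 'a measure" where
  "atomic_measure M I w x = distr (density (count_space I) (\<lambda>i. ennreal (w i))) (metric_borel M) x"

lemma nn_integral_atomic_measure:
  assumes "finite I" "x \<in> I \<rightarrow> mspace M" "g \<in> borel_measurable (metric_borel M)"
  shows "(\<integral>\<^sup>+ z. g z \<partial>atomic_measure M I w x) = (\<Sum>i\<in>I. ennreal (w i) * g (x i))"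
proof -
  have x: "x \<in> density (count_space I) (\<lambda>i. ennreal (w i)) \<rightarrow>\<^sub>M metric_borel M"
    using assms by (simp add: space_metric_borel)
  show ?thesis
    unfolding atomic_measure_def using assms x
    by (simp add: nn_integral_distr nn_integral_density nn_integral_count_space_finite)
qed

lemma sets_atomic_measure [simp]: "sets (atomic_measure M I w x) = sets (metric_borel M)"
  and space_atomic_measure: "space (atomic_measure M I w x) = mspace M"
  by (simp_all add: atomic_measure_def space_metric_borel)

lemma emeasure_atomic_measure:
  assumes "finite I" "x \<in> I \<rightarrow> mspace M" "\<And>i. i \<in> I \<Longrightarrow> 0 \<le> w i" "A \<in> sets (metric_borel M)"
  shows "emeasure (atomic_measure M I w x) A = ennreal (\<Sum>i\<in>I. w i * indicat_real A (x i))"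
proof -
  have "emeasure (atomic_measure M I w x) A = (\<integral>\<^sup>+ z. indicator A z \<partial>atomic_measure M I w x)"
    using assms by simp
  also have "\<dots> = (\<Sum>i\<in>I. ennreal (w i) * indicator A (x i))"
    using assms by (intro nn_integral_atomic_measure) auto
  also have "\<dots> = (\<Sum>i\<in>I. ennreal (w i * indicat_real A (x i)))"
    using assms by (intro sum.cong) (auto simp: indicator_def)
  also have "\<dots> = ennreal (\<Sum>i\<in>I. w i * indicat_real A (x i))"
    using assms by (intro sum_ennreal) auto
  finally show ?thesis .
qed

text \<open>Taking \<open>f\<close> to be an indicator gives the masses of Borel sets. In this form,
  splitting and regrouping atoms is checked by rearranging finite sums.\<close>

lemma atomic_measure_eqI:
  assumes "finite I" "x \<in> I \<rightarrow> mspace M" "\<And>i. i \<in> I \<Longrightarrow> 0 \<le> w i"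
    and "finite K" "y \<in> K \<rightarrow> mspace M" "\<And>k. k \<in> K \<Longrightarrow> 0 \<le> v k"
    and "\<And>f :: 'a \<Rightarrow> real. (\<Sum>i\<in>I. w i * f (x i)) = (\<Sum>k\<in>K. v k * f (y k))"
  shows "atomic_measure M I w x = atomic_measure M K v y"
  using assms by (intro measure_eqI) (auto simp: emeasure_atomic_measure)

lemma dirac_eq_atomic_measure:
  assumes "finite I" "\<And>i. i \<in> I \<Longrightarrow> 0 \<le> w i" "(\<Sum>i\<in>I. w i) = 1" "y \<in> mspace M"
  shows "dirac M y = atomic_measure M I w (\<lambda>_. y)"
proof (rule measure_eqI)
  show "sets (dirac M y) = sets (atomic_measure M I w (\<lambda>_. y))" by (simp add: dirac_def)
  fix A assume "A \<in> sets (dirac M y)"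
  then have "A \<in> sets (metric_borel M)" by (simp add: dirac_def)
  then show "emeasure (dirac M y) A = emeasure (atomic_measure M I w (\<lambda>_. y)) A"
    using assms by (simp add: dirac_def emeasure_atomic_measure flip: sum_distrib_right) (simp add: indicator_def)
qed

lemma separable_space_finite_subtopology:
  assumes "finite S"
  shows "separable_space (subtopology T S)"
  unfolding separable_space_def
proof (intro exI conjI)
  show "countable (topspace (subtopology T S))" using assms by (simp add: countable_finite)
  show "subtopology T S closure_of topspace (subtopology T S) = topspace (subtopology T S)"
    by (rule closure_of_topspace)
qed simp

text \<open>The support is contained in the finite set of atoms: the complement of that set is open,
  since points are closed, and has mass zero.\<close>

lemma atomic_measure_in_prob_measures:
  assumes I: "finite I" and x: "x \<in> I \<rightarrow> mspace M" and w: "\<And>i. i \<in> I \<Longrightarrow> 0 \<le> w i" "(\<Sum>i\<in>I. w i) = 1"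
  shows "atomic_measure M I w x \<in> prob_measures M"
proof -
  let ?\<mu> = "atomic_measure M I w x"
  have top: "mspace M \<in> sets (metric_borel M)"
    by (metis openin_metric_borel openin_topspace topspace_mtopology_of)
  have "emeasure ?\<mu> (space ?\<mu>) = ennreal (\<Sum>i\<in>I. w i * indicat_real (mspace M) (x i))"
    unfolding space_atomic_measure using assms top by (intro emeasure_atomic_measure) auto
  also have "(\<Sum>i\<in>I. w i * indicat_real (mspace M) (x i)) = (\<Sum>i\<in>I. w i)"
    using x by (intro sum.cong) (auto simp: indicator_def)
  finally have "prob_space ?\<mu>" using w by (intro prob_spaceI) simp
  moreover have "measure_support M ?\<mu> \<subseteq> x ` I"
  proof
    fix p assume p: "p \<in> measure_support M ?\<mu>"
    show "p \<in> x ` I"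
    proof (rule ccontr)
      assume np: "p \<notin> x ` I"
      have "t1_space (mtopology_of M)"
        by (simp add: mtopology_of_def Hausdorff_imp_t1_space Metric_space.Hausdorff_space_mtopology)
      then have "closedin (mtopology_of M) (x ` I)"
        using I x by (auto simp: t1_space_closedin_finite)
      then have op: "openin (mtopology_of M) (mspace M - x ` I)"
        by (metis closedin_def topspace_mtopology_of)
      then have "0 < emeasure ?\<mu> (mspace M - x ` I)"
        using p np by (auto simp: measure_support_def)
      moreover have "emeasure ?\<mu> (mspace M - x ` I) = ennreal (\<Sum>i\<in>I. w i * indicat_real (mspace M - x ` I) (x i))"
        using assms op by (intro emeasure_atomic_measure openin_metric_borel) auto
      moreover have "(\<Sum>i\<in>I. w i * indicat_real (mspace M - x ` I) (x i)) = 0"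
        by (intro sum.neutral) auto
      ultimately show False by simp
    qed
  qed
  then have "separable_space (subtopology (mtopology_of M) (measure_support M ?\<mu>))"
    using I by (intro separable_space_finite_subtopology) (auto intro: finite_subset)
  ultimately show ?thesis
    by (simp add: prob_measures_def space_atomic_measure)
qed

text \<open>The coupling is carried by the pairs \<open>(x i, y i)\<close>: the mass of index
  \<open>i\<close> travels from \<open>x i\<close> to \<open>y i\<close>.\<close>

lemma wasserstein_dist_atomic_measure_le:
  assumes I: "finite I" and x: "x \<in> I \<rightarrow> mspace M" and y: "y \<in> I \<rightarrow> mspace M"
    and w: "\<And>i. i \<in> I \<Longrightarrow> 0 \<le> w i" "(\<Sum>i\<in>I. w i) = 1"
  shows "wasserstein_dist M (atomic_measure M I w x) (atomic_measure M I w y)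
    \<le> ennreal (\<Sum>i\<in>I. w i * mdist M (x i) (y i))"
proof -
  define K where "K = atomic_measure (prod_metric M M) I w (\<lambda>i. (x i, y i))"
  have xy: "(\<lambda>i. (x i, y i)) \<in> I \<rightarrow> mspace (prod_metric M M)" using x y by auto
  have meas: "(\<lambda>i. (x i, y i)) \<in> density (count_space I) (\<lambda>i. ennreal (w i)) \<rightarrow>\<^sub>M metric_borel (prod_metric M M)"
    using xy by (simp add: space_metric_borel)
  have fs: "fst \<in> metric_borel (prod_metric M M) \<rightarrow>\<^sub>M metric_borel M"
    "snd \<in> metric_borel (prod_metric M M) \<rightarrow>\<^sub>M metric_borel M"
    by (intro continuous_map_measurable_metric_borel; simp add: continuous_map_fst continuous_map_snd)+
  have "K \<in> couplings M (atomic_measure M I w x) (atomic_measure M I w y)"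
    unfolding couplings_def
    using atomic_measure_in_prob_measures[OF I xy w] distr_distr[OF fs(1) meas] distr_distr[OF fs(2) meas]
    by (simp add: K_def atomic_measure_def o_def)
  then have "wasserstein_dist M (atomic_measure M I w x) (atomic_measure M I w y)
      \<le> (\<integral>\<^sup>+ z. ennreal (mdist M (fst z) (snd z)) \<partial>K)"
    unfolding wasserstein_dist_def by (rule INF_lower)
  also have "\<dots> = (\<Sum>i\<in>I. ennreal (w i) * ennreal (mdist M (x i) (y i)))"
  proof -
    have "continuous_map (mtopology_of (prod_metric M M)) euclideanreal (\<lambda>z. mdist M (fst z) (snd z))"
      unfolding mtopology_of_prod_metric
      by (rule continuous_map_mdist[OF continuous_map_fst continuous_map_snd])
    then have "(\<lambda>z. ennreal (mdist M (fst z) (snd z))) \<in> borel_measurable (metric_borel (prod_metric M M))"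
      using continuous_map_borel_measurable measurable_compose[OF _ measurable_ennreal] by blast
    from nn_integral_atomic_measure[OF I xy this] show ?thesis by (simp add: K_def)
  qed
  also have "\<dots> = (\<Sum>i\<in>I. ennreal (w i * mdist M (x i) (y i)))"
    using w by (intro sum.cong) (auto simp: ennreal_mult)
  also have "\<dots> = ennreal (\<Sum>i\<in>I. w i * mdist M (x i) (y i))"
    using w by (intro sum_ennreal) auto
  finally show ?thesis .
qed

lemma atomic_measure_in_wasserstein_space:
  assumes "finite I" "x \<in> I \<rightarrow> mspace M" "\<And>i. i \<in> I \<Longrightarrow> 0 \<le> w i" "(\<Sum>i\<in>I. w i) = 1"
  shows "atomic_measure M I w x \<in> wasserstein_space M"
  unfolding wasserstein_space_def
proof (intro CollectI conjI ballI)
  fix y assume y: "y \<in> mspace M"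
  have "wasserstein_dist M (atomic_measure M I w x) (dirac M y) \<le> ennreal (\<Sum>i\<in>I. w i * mdist M (x i) y)"
    using wasserstein_dist_atomic_measure_le[of I x M "\<lambda>_. y" w] assms y
    by (simp add: dirac_eq_atomic_measure[of I w])
  also have "\<dots> < \<infinity>" by simp
  finally show "wasserstein_dist M (atomic_measure M I w x) (dirac M y) < \<infinity>" .
qed (use assms in \<open>auto intro: atomic_measure_in_prob_measures\<close>)

section \<open>Barycenters and flows of mass between atoms\<close>

locale barycenter_space =
  fixes X :: "'a metric" and b :: "'a measure \<Rightarrow> 'a"
  assumes barycenter: "contracting_barycenter_map X b"
begin

definition bary :: "'i set \<Rightarrow> ('i \<Rightarrow> real) \<Rightarrow> ('i \<Rightarrow> 'a) \<Rightarrow> 'a" where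
  "bary I w x = b (atomic_measure X I w x)"

lemma bary_in_mspace:
  assumes "finite I" "x \<in> I \<rightarrow> mspace X" "\<And>i. i \<in> I \<Longrightarrow> 0 \<le> w i" "(\<Sum>i\<in>I. w i) = 1"
  shows "bary I w x \<in> mspace X"
  using barycenter atomic_measure_in_wasserstein_space[of I x X w] assms
  by (auto simp: contracting_barycenter_map_def bary_def)

text \<open>Indices of weight zero may sit elsewhere. They occur at the rim of the collar, where the
  atom on the curve carries all the mass.\<close>

lemma bary_const:
  assumes "finite I" "y \<in> mspace X" "\<And>i. i \<in> I \<Longrightarrow> 0 \<le> w i" "(\<Sum>i\<in>I. w i) = 1"
    and "\<And>i. i \<in> I \<Longrightarrow> w i \<noteq> 0 \<Longrightarrow> x i = y" "x \<in> I \<rightarrow> mspace X"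
  shows "bary I w x = y"
proof -
  have "w i * f (x i) = w i * f y" if "i \<in> I" for i and f :: "'a \<Rightarrow> real"
    using assms(5)[OF that] by (cases "w i = 0") auto
  then have "atomic_measure X I w x = dirac X y"
    using assms by (subst dirac_eq_atomic_measure[of I w]) (auto intro!: atomic_measure_eqI sum.cong)
  then show ?thesis
    using barycenter assms(2) by (simp add: contracting_barycenter_map_def bary_def)
qed

lemma mdist_bary_le:
  assumes "finite I" "x \<in> I \<rightarrow> mspace X" "y \<in> I \<rightarrow> mspace X"
    and "\<And>i. i \<in> I \<Longrightarrow> 0 \<le> w i" "(\<Sum>i\<in>I. w i) = 1"
  shows "mdist X (bary I w x) (bary I w y) \<le> (\<Sum>i\<in>I. w i * mdist X (x i) (y i))"
proof -
  have "ennreal (mdist X (bary I w x) (bary I w y)) \<le> wasserstein_dist X (atomic_measure X I w x) (atomic_measure X I w y)"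
    using barycenter atomic_measure_in_wasserstein_space[of I x X w] atomic_measure_in_wasserstein_space[of I y X w] assms
    by (auto simp: contracting_barycenter_map_def bary_def)
  also have "\<dots> \<le> ennreal (\<Sum>i\<in>I. w i * mdist X (x i) (y i))"
    using assms by (intro wasserstein_dist_atomic_measure_le)
  finally show ?thesis using assms by (subst (asm) ennreal_le_iff) (auto intro!: sum_nonneg)
qed

text \<open>\<open>\<phi> i\<close> is the (signed) mass that flows from the atom \<open>x i\<close> to the atom \<open>x (\<sigma> i)\<close>.\<close>

lemma bary_flow_step:
  assumes I: "finite I" and \<sigma>: "bij_betw \<sigma> I I" and x: "x \<in> I \<rightarrow> mspace X"
    and w: "(\<Sum>i\<in>I. w i) = 1"
    and w': "\<And>i. i \<in> I \<Longrightarrow> w' (\<sigma> i) = w (\<sigma> i) + \<phi> i - \<phi> (\<sigma> i)"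
    and small: "\<And>i. i \<in> I \<Longrightarrow> \<bar>\<phi> i\<bar> + \<bar>\<phi> (\<sigma> i)\<bar> \<le> w (\<sigma> i)"
  shows "mdist X (bary I w x) (bary I w' x) \<le> (\<Sum>i\<in>I. \<bar>\<phi> i\<bar> * mdist X (x i) (x (\<sigma> i)))"
proof -
  define P where "P = (\<lambda>i. max (\<phi> i) 0)"
  define N where "N = (\<lambda>i. max (- \<phi> i) 0)"
  have phi: "\<phi> i = P i - N i" and aphi: "\<bar>\<phi> i\<bar> = P i + N i" and PN: "0 \<le> P i" "0 \<le> N i" for i
    by (auto simp: P_def N_def)
  have \<sigma>I: "\<sigma> i \<in> I" if "i \<in> I" for i using \<sigma> that by (auto dest: bij_betw_apply)
  have re: "(\<Sum>i\<in>I. g (\<sigma> i)) = (\<Sum>i\<in>I. g i)" for g :: "_ \<Rightarrow> real"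
    using sum.reindex_bij_betw[OF \<sigma>] .
  have surj: "\<exists>k\<in>I. i = \<sigma> k" if "i \<in> I" for i using \<sigma> that by (auto simp: bij_betw_def)
  have w0: "0 \<le> w i" if i: "i \<in> I" for i
  proof -
    obtain k where k: "k \<in> I" "i = \<sigma> k" using surj[OF i] by auto
    show ?thesis unfolding k(2) using small[OF k(1)] by linarith
  qed
  have w'0: "0 \<le> w' i" if i: "i \<in> I" for i
  proof -
    obtain k where k: "k \<in> I" "i = \<sigma> k" using surj[OF i] by auto
    show ?thesis unfolding k(2) using small[OF k(1)] w'[OF k(1)] by linarith
  qed
  \<comment> \<open>For each \<open>i\<close>, the copy \<open>s = 0\<close> is the mass that stays
    at \<open>x (\<sigma> i)\<close>, \<open>s = 1\<close> the mass that moves from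
    \<open>x i\<close> to \<open>x (\<sigma> i)\<close>, and \<open>s = 2\<close> the mass that
    moves back. \<open>small\<close> keeps the first of these nonnegative.\<close>
  define \<Omega> where "\<Omega> = I \<times> {0, 1, 2 :: nat}"
  define p where "p = (\<lambda>(i, s :: nat). if s = 0 then w (\<sigma> i) - P (\<sigma> i) - N i else if s = 1 then P i else N i)"
  define y where "y = (\<lambda>(i, s :: nat). if s = 1 then x i else x (\<sigma> i))"
  define z where "z = (\<lambda>(i, s :: nat). if s = 2 then x i else x (\<sigma> i))"
  have fin: "finite \<Omega>" using I by (simp add: \<Omega>_def)
  have sum\<Omega>: "(\<Sum>k\<in>\<Omega>. g k) = (\<Sum>i\<in>I. g (i, 0) + g (i, 1) + g (i, 2))" for g :: "_ \<Rightarrow> real"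
  proof -
    have "(\<Sum>k\<in>\<Omega>. g k) = (\<Sum>i\<in>I. \<Sum>s\<in>{0, 1, 2}. g (i, s))"
      by (subst sum.cartesian_product) (simp add: \<Omega>_def)
    then show ?thesis by (simp add: add.assoc)
  qed
  have p0: "0 \<le> p k" if k\<Omega>: "k \<in> \<Omega>" for k
  proof -
    obtain i t where k: "k = (i, t)" "i \<in> I" using k\<Omega> by (auto simp: \<Omega>_def)
    have "P i + N i + (P (\<sigma> i) + N (\<sigma> i)) \<le> w (\<sigma> i)" using small[OF k(2)] by (simp add: aphi)
    then show ?thesis
      using PN[of i] PN[of "\<sigma> i"] unfolding k(1) p_def prod.case by auto
  qed
  have left: "(\<Sum>i\<in>I. w i * f (x i)) = (\<Sum>k\<in>\<Omega>. p k * f (y k))" for f :: "'a \<Rightarrow> real"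
  proof -
    have "(\<Sum>k\<in>\<Omega>. p k * f (y k)) = (\<Sum>i\<in>I. (w (\<sigma> i) * f (x (\<sigma> i)) - P (\<sigma> i) * f (x (\<sigma> i))) + P i * f (x i))"
      unfolding sum\<Omega> by (intro sum.cong) (auto simp: p_def y_def algebra_simps)
    also have "\<dots> = (\<Sum>i\<in>I. w i * f (x i))"
      using re[of "\<lambda>i. w i * f (x i)"] re[of "\<lambda>i. P i * f (x i)"] by (simp add: sum.distrib sum_subtractf)
    finally show ?thesis ..
  qed
  have right: "(\<Sum>i\<in>I. w' i * f (x i)) = (\<Sum>k\<in>\<Omega>. p k * f (z k))" for f :: "'a \<Rightarrow> real"
  proof -
    have "(\<Sum>k\<in>\<Omega>. p k * f (z k)) = (\<Sum>i\<in>I. (w' (\<sigma> i) * f (x (\<sigma> i)) - N (\<sigma> i) * f (x (\<sigma> i))) + N i * f (x i))"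
      unfolding sum\<Omega> by (intro sum.cong) (auto simp: p_def z_def w' phi algebra_simps)
    also have "\<dots> = (\<Sum>i\<in>I. w' i * f (x i))"
      using re[of "\<lambda>i. w' i * f (x i)"] re[of "\<lambda>i. N i * f (x i)"] by (simp add: sum.distrib sum_subtractf)
    finally show ?thesis ..
  qed
  have yz: "y \<in> \<Omega> \<rightarrow> mspace X" "z \<in> \<Omega> \<rightarrow> mspace X"
    using x \<sigma>I by (auto simp: y_def z_def \<Omega>_def)
  have "bary I w x = bary \<Omega> p y"
    unfolding bary_def using I x w0 fin yz p0 left by (intro arg_cong[of _ _ b] atomic_measure_eqI) auto
  moreover have "bary I w' x = bary \<Omega> p z"
    unfolding bary_def using I x w'0 fin yz p0 right by (intro arg_cong[of _ _ b] atomic_measure_eqI) auto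
  moreover have "(\<Sum>k\<in>\<Omega>. p k) = 1" using left[of "\<lambda>_. 1"] w by simp
  ultimately have "mdist X (bary I w x) (bary I w' x) \<le> (\<Sum>k\<in>\<Omega>. p k * mdist X (y k) (z k))"
    using mdist_bary_le[OF fin yz p0] by simp
  also have "\<dots> = (\<Sum>i\<in>I. \<bar>\<phi> i\<bar> * mdist X (x i) (x (\<sigma> i)))"
  proof -
    have "mdist X (x (\<sigma> i)) (x (\<sigma> i)) = 0" if "i \<in> I" for i using x \<sigma>I that by (intro mdist_self) auto
    then show ?thesis
      unfolding sum\<Omega> by (intro sum.cong) (auto simp: p_def y_def z_def aphi distrib_right mdist_commute)
  qed
  finally show ?thesis .
qed

text \<open>A large flow is performed in many small steps, each of which moves mass only between neighbours.\<close>

lemma bary_flow_le: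
  assumes I: "finite I" and \<sigma>: "bij_betw \<sigma> I I" and x: "x \<in> I \<rightarrow> mspace X"
    and w: "(\<Sum>i\<in>I. w i) = 1"
    and w': "\<And>i. i \<in> I \<Longrightarrow> w' (\<sigma> i) = w (\<sigma> i) + \<phi> i - \<phi> (\<sigma> i)"
    and \<omega>: "0 < \<omega>"
    and small: "\<And>i. i \<in> I \<Longrightarrow> \<omega> * (\<bar>\<phi> i\<bar> + \<bar>\<phi> (\<sigma> i)\<bar>) \<le> w (\<sigma> i)"
      "\<And>i. i \<in> I \<Longrightarrow> \<omega> * (\<bar>\<phi> i\<bar> + \<bar>\<phi> (\<sigma> i)\<bar>) \<le> w' (\<sigma> i)"
  shows "mdist X (bary I w x) (bary I w' x) \<le> (\<Sum>i\<in>I. \<bar>\<phi> i\<bar> * mdist X (x i) (x (\<sigma> i)))"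
    (is "_ \<le> ?C")
proof -
  obtain K0 :: nat where K0: "1 / \<omega> < real K0" using reals_Archimedean2 by blast
  define K where "K = Suc K0"
  have K: "0 < real K" "1 / real K \<le> \<omega>"
    using K0 \<omega> by (auto simp: K_def field_simps add_strict_increasing)
  \<comment> \<open>The weights move along the straight segment from \<open>w\<close> to
    \<open>w'\<close> in \<open>K\<close> equal steps, each carrying the flow
    \<open>\<phi> / K\<close>. The lower bounds in \<open>small\<close> pass to convex combinations,
    so every intermediate weight can afford such a step.\<close>
  define W where "W = (\<lambda>(k :: nat) i. w i + real k / real K * (w' i - w i))"
  have re: "(\<Sum>i\<in>I. g (\<sigma> i)) = (\<Sum>i\<in>I. g i)" for g :: "_ \<Rightarrow> real"
    using sum.reindex_bij_betw[OF \<sigma>] .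
  have surj: "\<exists>k\<in>I. i = \<sigma> k" if "i \<in> I" for i using \<sigma> that by (auto simp: bij_betw_def)
  have sum0: "(\<Sum>i\<in>I. w' i - w i) = 0"
  proof -
    have "(\<Sum>i\<in>I. w' i - w i) = (\<Sum>i\<in>I. w' (\<sigma> i) - w (\<sigma> i))" using re[of "\<lambda>i. w' i - w i"] by simp
    also have "\<dots> = (\<Sum>i\<in>I. \<phi> i - \<phi> (\<sigma> i))" by (intro sum.cong) (auto simp: w')
    also have "\<dots> = 0" using re[of \<phi>] by (simp add: sum_subtractf)
    finally show ?thesis .
  qed
  have sumW: "(\<Sum>i\<in>I. W k i) = 1" for k
    unfolding W_def sum.distrib sum_distrib_left[symmetric] using sum0 w by simp
  have low: "(\<bar>\<phi> i\<bar> + \<bar>\<phi> (\<sigma> i)\<bar>) / K \<le> W k (\<sigma> i)" if i: "i \<in> I" and k: "k \<le> K" for i k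
  proof -
    define t where "t = real k / real K"
    have t: "0 \<le> t" "t \<le> 1" using k K by (auto simp: t_def)
    have "(\<bar>\<phi> i\<bar> + \<bar>\<phi> (\<sigma> i)\<bar>) / K \<le> \<omega> * (\<bar>\<phi> i\<bar> + \<bar>\<phi> (\<sigma> i)\<bar>)" (is "_ \<le> ?m")
      using mult_right_mono[OF K(2), of "\<bar>\<phi> i\<bar> + \<bar>\<phi> (\<sigma> i)\<bar>"] by simp
    also have "?m = (1 - t) * ?m + t * ?m" by (simp add: algebra_simps)
    also have "\<dots> \<le> (1 - t) * w (\<sigma> i) + t * w' (\<sigma> i)"
      using t small[OF i] by (intro add_mono mult_left_mono) auto
    also have "\<dots> = W k (\<sigma> i)" by (simp add: W_def t_def algebra_simps diff_divide_distrib)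
    finally show ?thesis .
  qed
  have W0: "0 \<le> W k i" if "i \<in> I" "k \<le> K" for k i
    using surj[OF that(1)] low that(2) K(1) by (metis abs_ge_zero add_nonneg_nonneg divide_nonneg_pos order_trans)
  have inX: "bary I (W k) x \<in> mspace X" if "k \<le> K" for k
    using I x W0 that sumW by (intro bary_in_mspace) auto
  have "mdist X (bary I (W 0) x) (bary I (W k) x) \<le> real k / real K * ?C" if "k \<le> K" for k
    using that
  proof (induction k)
    case 0
    show ?case using inX[of 0] by (simp add: mdist_self)
  next
    case (Suc k)
    have "mdist X (bary I (W k) x) (bary I (W (Suc k)) x) \<le> (\<Sum>i\<in>I. \<bar>\<phi> i / K\<bar> * mdist X (x i) (x (\<sigma> i)))"
    proof (rule bary_flow_step[OF I \<sigma> x sumW])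
      fix i assume i: "i \<in> I"
      show "W (Suc k) (\<sigma> i) = W k (\<sigma> i) + \<phi> i / K - \<phi> (\<sigma> i) / K"
      proof -
        have "W (Suc k) (\<sigma> i) = W k (\<sigma> i) + (w' (\<sigma> i) - w (\<sigma> i)) / K"
          by (simp add: W_def add_divide_distrib distrib_right)
        then show ?thesis by (simp add: w'[OF i] diff_divide_distrib)
      qed
      show "\<bar>\<phi> i / K\<bar> + \<bar>\<phi> (\<sigma> i) / K\<bar> \<le> W k (\<sigma> i)"
        using low[OF i, of k] Suc.prems by (simp add: add_divide_distrib)
    qed
    also have "\<dots> = 1 / real K * ?C" by (simp add: sum_distrib_left)
    finally have "mdist X (bary I (W k) x) (bary I (W (Suc k)) x) \<le> 1 / real K * ?C" .
    moreover have "mdist X (bary I (W 0) x) (bary I (W (Suc k)) x) \<le>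
       mdist X (bary I (W 0) x) (bary I (W k) x) + mdist X (bary I (W k) x) (bary I (W (Suc k)) x)"
      using Suc.prems by (intro mdist_triangle inX) auto
    ultimately show ?case using Suc by (simp add: add_divide_distrib distrib_right)
  qed
  from this[of K] show ?thesis
    using K by (simp add: W_def)
qed

end

section \<open>The kernel on the hemisphere\<close>

text \<open>\<open>hemi_dist r u\<close> is the spherical distance from a point at height \<open>r\<close> above the equator to the point
  of the equator whose longitude differs from that of the first point by \<open>u\<close>.\<close>

definition hemi_dist :: "real \<Rightarrow> real \<Rightarrow> real" where
  "hemi_dist r u = arccos (cos r * cos u)"

definition hemi_pot :: "real \<Rightarrow> real \<Rightarrow> real" where
  "hemi_pot r u = (pi - hemi_dist r u)\<^sup>2"

lemma abs_cos_mult_cos_le: "\<bar>cos r * cos u\<bar> \<le> (1 :: real)"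
  using mult_mono[OF abs_cos_le_one abs_cos_le_one, of r u] by (simp add: abs_mult mult.commute)

lemma hemi_dist_bounds: "0 \<le> hemi_dist r u" "hemi_dist r u \<le> pi"
  using abs_cos_mult_cos_le[of r u] by (auto simp: hemi_dist_def intro!: arccos_lbound arccos_ubound)

lemma cos_hemi_dist: "cos (hemi_dist r u) = cos r * cos u"
  using abs_cos_mult_cos_le[of r u] by (auto simp: hemi_dist_def intro!: cos_arccos)

lemma hemi_dist_periodic: "hemi_dist r (u + 2 * pi) = hemi_dist r u"
  by (simp add: hemi_dist_def)

lemma hemi_pot_periodic: "hemi_pot r (u + 2 * pi) = hemi_pot r u"
  by (simp add: hemi_pot_def hemi_dist_periodic)

lemma hemi_dist_antipodal: "hemi_dist r (u + pi) = pi - hemi_dist r u"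
  using abs_cos_mult_cos_le[of r u] by (simp add: hemi_dist_def arccos_minus)

lemma continuous_on_hemi_pot:
  fixes A :: "real set"
  shows "continuous_on A f \<Longrightarrow> continuous_on A g \<Longrightarrow> continuous_on A (\<lambda>t. hemi_pot (f t) (g t))"
  unfolding hemi_pot_def hemi_dist_def
  using abs_cos_mult_cos_le by (intro continuous_intros) (auto simp: abs_le_iff minus_le_iff)

text \<open>Both branches are parabolas with leading coefficient 1, so a second difference taken
  within one branch is exactly \<open>2 * h\<^sup>2\<close> and the averaged density vanishes there.
  On the equator the mass therefore sits near \<open>u = 0\<close>, where the branches meet in a
  corner.\<close>

lemma hemi_pot_0:
  "0 \<le> u \<Longrightarrow> u \<le> 2 * pi \<Longrightarrow> hemi_pot 0 u = (u - pi)\<^sup>2"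
  "- (2 * pi) \<le> u \<Longrightarrow> u \<le> 0 \<Longrightarrow> hemi_pot 0 u = (u + pi)\<^sup>2"
proof -
  have A: "hemi_pot 0 u = (u - pi)\<^sup>2" if u: "0 \<le> u" "u \<le> 2 * pi" for u
  proof (cases "u \<le> pi")
    case True
    then show ?thesis using u by (simp add: hemi_pot_def hemi_dist_def arccos_cos power2_commute)
  next
    case False
    have "cos u = cos (2 * pi - u)" by simp
    then have "hemi_dist 0 u = 2 * pi - u"
      using False u unfolding hemi_dist_def by (simp only: cos_zero mult_1 arccos_cos)
    then show ?thesis by (simp add: hemi_pot_def)
  qed
  then show "0 \<le> u \<Longrightarrow> u \<le> 2 * pi \<Longrightarrow> hemi_pot 0 u = (u - pi)\<^sup>2" by blast
  show "- (2 * pi) \<le> u \<Longrightarrow> u \<le> 0 \<Longrightarrow> hemi_pot 0 u = (u + pi)\<^sup>2"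
    using A[of "u + 2 * pi"] by (simp add: hemi_pot_periodic add.commute)
qed

section \<open>Derivatives of the kernel and nonnegativity of the density\<close>

lemma sin_mult_cos_le: "0 \<le> e \<Longrightarrow> sin e * cos e \<le> (e :: real)"
proof -
  assume e: "0 \<le> e"
  have "sin e * cos e = sin (2 * e) / 2" by (simp add: sin_double)
  also have "\<dots> \<le> e" using sin_x_le_x[of "2 * e"] e by simp
  finally show ?thesis .
qed

lemma mult_cos_le_sin:
  assumes "0 \<le> e" "e \<le> pi"
  shows "e * cos e \<le> sin e"
proof -
  have "(\<lambda>e. sin e - e * cos e) 0 \<le> (\<lambda>e. sin e - e * cos e) e"
  proof (rule DERIV_nonneg_imp_nondecreasing[OF assms(1)])
    fix x assume x: "0 \<le> x" "x \<le> e"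
    have "((\<lambda>e. sin e - e * cos e) has_real_derivative x * sin x) (at x)"
      by (auto intro!: derivative_eq_intros)
    moreover have "0 \<le> x * sin x" using x assms by (intro mult_nonneg_nonneg sin_ge_zero) auto
    ultimately show "\<exists>y. ((\<lambda>e. sin e - e * cos e) has_real_derivative y) (at x) \<and> 0 \<le> y" by blast
  qed
  then show ?thesis by simp
qed

definition hemi_sin :: "real \<Rightarrow> real \<Rightarrow> real" where
  "hemi_sin r u = sqrt (1 - (cos r * cos u)\<^sup>2)"

lemma hemi_sin_eq: "hemi_sin r u = sin (hemi_dist r u)"
  using abs_cos_mult_cos_le[of r u] by (simp add: hemi_sin_def hemi_dist_def sin_arccos_abs)

lemma abs_cos_mult_cos_less:
  assumes "0 < r" "r \<le> pi / 2"
  shows "\<bar>cos r * cos u\<bar> < 1"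
proof -
  have "0 \<le> cos r" "cos r < 1"
    using assms cos_monotone_0_pi[of 0 r] by (auto intro!: cos_ge_zero)
  then have "\<bar>cos r\<bar> * \<bar>cos u\<bar> \<le> cos r * 1" by (intro mult_mono) auto
  then show ?thesis using \<open>cos r < 1\<close> by (simp add: abs_mult)
qed

lemma hemi_sin_pos:
  assumes "0 < r" "r \<le> pi / 2"
  shows "0 < hemi_sin r u"
  using abs_cos_mult_cos_less[OF assms, of u] by (simp add: hemi_sin_def abs_square_less_1)

lemma hemi_sin_sq: "(hemi_sin r u)\<^sup>2 = 1 - (cos r)\<^sup>2 * (cos u)\<^sup>2"
proof -
  have "(cos r * cos u)\<^sup>2 \<le> 1" using abs_cos_mult_cos_le[of r u] by (simp only: abs_square_le_1)
  then show ?thesis by (simp add: hemi_sin_def power_mult_distrib)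
qed

text \<open>Positive height keeps the distance off \<open>0\<close> and \<open>pi\<close>, where
  \<open>arccos (cos d)\<close> has its corners.\<close>

lemma has_real_derivative_hemi_dist:
  assumes f: "(f has_real_derivative f') (at t)" and g: "(g has_real_derivative g') (at t)"
    and r: "0 < f t" "f t \<le> pi / 2"
  shows "((\<lambda>t. hemi_dist (f t) (g t)) has_real_derivative
    (sin (f t) * cos (g t) * f' + cos (f t) * sin (g t) * g') / hemi_sin (f t) (g t)) (at t)"
proof -
  have lt: "- 1 < cos (f t) * cos (g t)" "cos (f t) * cos (g t) < 1"
    using abs_cos_mult_cos_less[OF r, of "g t"] by auto
  have "((\<lambda>t. cos (f t) * cos (g t)) has_real_derivative
     - (sin (f t) * cos (g t) * f' + cos (f t) * sin (g t) * g')) (at t)"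
    by (auto intro!: derivative_eq_intros f g simp: algebra_simps)
  from DERIV_chain2[OF DERIV_arccos[OF lt] this] show ?thesis
    unfolding hemi_dist_def hemi_sin_def by (rule DERIV_cong) (simp only: inverse_minus_eq minus_mult_minus divide_inverse mult.commute)
qed

lemma has_real_derivative_hemi_sin:
  assumes r: "0 < r" "r \<le> pi / 2"
  shows "(hemi_sin r has_real_derivative (cos r)\<^sup>2 * cos u * sin u / hemi_sin r u) (at u)"
proof -
  have pos: "0 < 1 - (cos r * cos u)\<^sup>2"
    using hemi_sin_pos[OF r, of u] by (simp add: hemi_sin_def)
  have "((\<lambda>u. 1 - (cos r * cos u)\<^sup>2) has_real_derivative 2 * ((cos r)\<^sup>2 * cos u * sin u)) (at u)"
    using DERIV_diff[OF DERIV_const[of 1] DERIV_power[OF DERIV_cmult[OF DERIV_cos[of u], of "cos r"], of 2]]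
    by (rule DERIV_cong) (simp add: power2_eq_square)
  from DERIV_chain2[OF DERIV_real_sqrt[OF pos] this] show ?thesis
    unfolding hemi_sin_def by (rule DERIV_cong) (simp add: inverse_eq_divide)
qed

text \<open>This is nonnegativity of the averaged density: \<open>u\<^sup>2 - hemi_pot r u\<close>
  is convex, because its second derivative is a nonnegative multiple of
  \<open>sin e - e * cos e\<close> with \<open>e = pi - hemi_dist r u\<close>. The equator, where
  the derivatives break down, is a limit of positive heights.\<close>

lemma hemi_pot_second_difference_le:
  assumes "0 \<le> r" "r \<le> pi / 2"
  shows "hemi_pot r (u + h) - 2 * hemi_pot r u + hemi_pot r (u - h) \<le> 2 * h\<^sup>2"
proof -
  have pos: "hemi_pot r (u + h) - 2 * hemi_pot r u + hemi_pot r (u - h) \<le> 2 * h\<^sup>2"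
    if r: "0 < r" "r \<le> pi / 2" for r
  proof -
    let ?q = "hemi_sin r" and ?d = "hemi_dist r"
    define g where "g = (\<lambda>u. cos r * sin u / ?q u)"
    define f1 where "f1 = (\<lambda>u. 2 * u + 2 * ((pi - ?d u) * g u))"
    define f2 where "f2 = (\<lambda>u. 2 * (sin r)\<^sup>2 / (?q u)^3 * (?q u + (pi - ?d u) * (cos r * cos u)))"
    have dd: "(?d has_real_derivative g u) (at u)" for u
      using has_real_derivative_hemi_dist[of "\<lambda>_. r" 0 u "\<lambda>u. u" 1] r by (simp add: g_def)
    note dq = has_real_derivative_hemi_sin[OF r]
    have q: "0 < ?q u" for u by (rule hemi_sin_pos[OF r])
    have sq: "(?q u)\<^sup>2 - (cos r)\<^sup>2 * (sin u)\<^sup>2 = (sin r)\<^sup>2" for u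
      unfolding hemi_sin_sq by (simp add: sin_squared_eq algebra_simps)
    have dg: "(g has_real_derivative cos r * cos u * (sin r)\<^sup>2 / (?q u)^3) (at u)" for u
    proof -
      have "(g has_real_derivative (cos r * cos u * ?q u - cos r * sin u * ((cos r)\<^sup>2 * cos u * sin u / ?q u)) / (?q u * ?q u)) (at u)"
        unfolding g_def using q[of u] by (intro DERIV_divide dq) (auto intro!: derivative_eq_intros)
      also have "(cos r * cos u * ?q u - cos r * sin u * ((cos r)\<^sup>2 * cos u * sin u / ?q u)) / (?q u * ?q u)
            = cos r * cos u * ((?q u)\<^sup>2 - (cos r)\<^sup>2 * (sin u)\<^sup>2) / (?q u)^3"
        using q[of u] by (simp add: field_simps power2_eq_square power3_eq_cube)
      finally show ?thesis unfolding sq .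
    qed
    have "((\<lambda>u. u\<^sup>2 - hemi_pot r u) has_real_derivative f1 u) (at u)" for u
      unfolding hemi_pot_def f1_def
      using DERIV_diff[OF DERIV_power[OF DERIV_ident[of "at u"], of 2] DERIV_power[OF DERIV_diff[OF DERIV_const[of pi] dd[of u]], of 2]]
      by (rule DERIV_cong) (simp add: mult.commute)
    moreover have "(f1 has_real_derivative f2 u) (at u)" for u
    proof -
      have "(f1 has_real_derivative 2 + 2 * (- g u * g u + (pi - ?d u) * (cos r * cos u * (sin r)\<^sup>2 / (?q u)^3))) (at u)"
        using DERIV_add[OF DERIV_cmult[OF DERIV_ident[of "at u"], of 2]
            DERIV_cmult[OF DERIV_mult[OF DERIV_diff[OF DERIV_const[of pi] dd[of u]] dg[of u]], of 2]]
        unfolding f1_def by (rule DERIV_cong) (simp add: mult.commute)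
      also have "2 + 2 * (- g u * g u + (pi - ?d u) * (cos r * cos u * (sin r)\<^sup>2 / (?q u)^3)) =
        (2 - 2 * (g u)\<^sup>2) + 2 * (pi - ?d u) * (cos r * cos u * (sin r)\<^sup>2 / (?q u)^3)"
        by (simp only: power2_eq_square) argo
      also have "\<dots> = f2 u"
      proof -
        have "2 - 2 * (g u)\<^sup>2 = 2 * ((?q u)\<^sup>2 - (cos r)\<^sup>2 * (sin u)\<^sup>2) / (?q u)\<^sup>2"
          using q[of u] by (simp add: g_def field_simps)
        moreover have "2 * (sin r)\<^sup>2 / (?q u)\<^sup>2 = 2 * (sin r)\<^sup>2 / (?q u)^3 * ?q u"
          using q[of u] by (simp add: power2_eq_square power3_eq_cube)
        ultimately show ?thesis unfolding sq f2_def by (simp add: algebra_simps add_divide_distrib diff_divide_distrib)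
      qed
      finally show ?thesis .
    qed
    moreover have "0 \<le> f2 u" for u
    proof -
      define e where "e = pi - ?d u"
      have e: "0 \<le> e" "e \<le> pi" using hemi_dist_bounds[of r u] by (auto simp: e_def)
      have "?q u + (pi - ?d u) * (cos r * cos u) = sin e - e * cos e"
        by (simp add: e_def hemi_sin_eq cos_diff sin_diff cos_hemi_dist)
      also have "\<dots> \<ge> 0" using mult_cos_le_sin[OF e] by simp
      finally show ?thesis using q[of u] by (simp add: f2_def)
    qed
    ultimately have "convex_on UNIV (\<lambda>u. u\<^sup>2 - hemi_pot r u)"
      by (intro f''_ge0_imp_convex) auto
    from convex_onD[OF this, of "1/2" "u - h" "u + h"]
    have "u\<^sup>2 - hemi_pot r u \<le> ((u - h)\<^sup>2 - hemi_pot r (u - h) + ((u + h)\<^sup>2 - hemi_pot r (u + h))) / 2"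
      by (simp add: field_simps)
    then show ?thesis by (simp add: power2_eq_square algebra_simps)
  qed
  show ?thesis
  proof (cases "r = 0")
    case True
    let ?f = "\<lambda>r. hemi_pot r (u + h) - 2 * hemi_pot r u + hemi_pot r (u - h)"
    have "continuous_on UNIV ?f"
      by (intro continuous_intros continuous_on_hemi_pot)
    then have "(?f \<longlongrightarrow> ?f 0) (at_right 0)"
      by (simp add: continuous_on_def tendsto_within_subset[of _ _ 0 UNIV])
    moreover have "\<forall>\<^sub>F r in at_right 0. ?f r \<le> 2 * h\<^sup>2"
      using eventually_at_right_less[of 0] pos pi_half_gt_zero
      by (auto simp: eventually_at_right_field intro!: exI[of _ "pi / 2"])
    ultimately show ?thesis
      using True tendsto_upperbound trivial_limit_at_right_real by blast
  qed (use pos assms in auto)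
qed

text \<open>\<open>U\<close> is the flux through the point \<open>u\<close> of the equator when the point of the hemisphere moves with
  velocity \<open>a\<close> along the parallel and \<open>b\<close> along the meridian.  Since \<open>U' = \<lambda> * S'\<close> with \<open>\<lambda> \<ge> 0\<close>, it is
  monotone on the two half circles between the critical points of \<open>S\<close>.\<close>

lemma hemi_flow_variation:
  fixes r a b x :: real and N :: nat
  assumes r: "0 < r" "r \<le> pi / 2" and N: "0 < N"
  defines "h \<equiv> 2 * pi / N"
  defines "S \<equiv> \<lambda>u. (b * sin r * cos u - a * sin u) / (2 * hemi_sin r u)"
  defines "U \<equiv> \<lambda>u. (pi - hemi_dist r u) * S u / pi - cos r * a * u / (2 * pi)"
  shows "(\<Sum>j<N. \<bar>U (h * Suc j - x) - U (h * j - x)\<bar>) \<le> sqrt (a\<^sup>2 + b\<^sup>2)"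
proof -
  let ?q = "hemi_sin r" and ?d = "hemi_dist r"
  have s: "0 < sin r" using r by (intro sin_gt_zero) auto
  have q: "0 < ?q u" for u by (rule hemi_sin_pos[OF r])
  note dq = has_real_derivative_hemi_sin[OF r]
  have dd: "(?d has_real_derivative cos r * sin u / ?q u) (at u)" for u
    using has_real_derivative_hemi_dist[of "\<lambda>_. r" 0 u "\<lambda>u. u" 1] r by simp
  define S1 where "S1 = (\<lambda>u. - (sin r * (a * sin r * cos u + b * sin u)) / (2 * (?q u)^3))"
  \<comment> \<open>The factor in front of \<open>S1\<close> is
    \<open>(e - sin e * cos e) / pi\<close>, where \<open>e\<close> is the distance to the antipode
    of \<open>u\<close>; hence it is nonnegative.\<close>
  define U1 where "U1 = (\<lambda>u. (pi - ?d u + ?q u * (cos r * cos u)) / pi * S1 u)"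
  have dS: "(S has_real_derivative S1 u) (at u)" for u
  proof -
    define n where "n = b * sin r * cos u - a * sin u"
    define n1 where "n1 = - (b * sin r * sin u) - a * cos u"
    define m where "m = (cos r)\<^sup>2 * cos u * sin u"
    have "((\<lambda>u. b * sin r * cos u - a * sin u) has_real_derivative n1) (at u)"
      unfolding n1_def by (auto intro!: derivative_eq_intros)
    from DERIV_divide[OF this DERIV_cmult[OF dq[of u], of 2]] q[of u]
    have "(S has_real_derivative (n1 * (2 * ?q u) - n * (2 * (m / ?q u))) / (2 * ?q u * (2 * ?q u))) (at u)"
      unfolding S_def n_def m_def by simp
    also have "(n1 * (2 * ?q u) - n * (2 * (m / ?q u))) / (2 * ?q u * (2 * ?q u)) = (n1 * (?q u)\<^sup>2 - n * m) / (2 * (?q u)^3)"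
      using q[of u] by (simp add: field_simps power2_eq_square power3_eq_cube)
    also have "n1 * (?q u)\<^sup>2 - n * m = - (sin r * (a * sin r * cos u + b * sin u))"
      unfolding hemi_sin_sq n1_def n_def m_def
      using sin_cos_squared_add[of r] sin_cos_squared_add[of u] by algebra
    finally show ?thesis by (simp add: S1_def)
  qed
  have dU: "(U has_real_derivative U1 u) (at u)" for u
  proof -
    define n where "n = b * sin r * cos u - a * sin u"
    define p where "p = sin r * (a * sin r * cos u + b * sin u)"
    have S: "S u = n / (2 * ?q u)" by (simp add: S_def n_def)
    have S1: "S1 u = - p / (2 * (?q u)^3)" by (simp add: S1_def p_def)
    have "(U has_real_derivative ((- (cos r * sin u / ?q u)) * S u + S1 u * (pi - ?d u)) / pi - cos r * a / (2 * pi)) (at u)"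
    proof -
      have 1: "((\<lambda>u. (pi - ?d u) * S u) has_real_derivative (- (cos r * sin u / ?q u)) * S u + S1 u * (pi - ?d u)) (at u)"
        using DERIV_mult[OF DERIV_diff[OF DERIV_const[of pi] dd[of u]] dS[of u]] by simp
      have 2: "((\<lambda>u. cos r * a * u / (2 * pi)) has_real_derivative cos r * a / (2 * pi)) (at u)"
        using DERIV_cdivide[OF DERIV_cmult[OF DERIV_ident[of "at u"], of "cos r * a"], of "2 * pi"] by simp
      show ?thesis unfolding U_def using DERIV_diff[OF DERIV_cdivide[OF 1, of pi] 2] .
    qed
    moreover have "((- (cos r * sin u / ?q u)) * S u + S1 u * (pi - ?d u)) / pi - cos r * a / (2 * pi) = U1 u"
    proof -
      \<comment> \<open>The linear term of \<open>U\<close>, a constant circulation of mass around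
        the equator, is chosen to make this identity hold. It is what turns the derivative of
        \<open>U\<close> into a multiple of \<open>S1\<close>.\<close>
      have "- (cos r * sin u * n) - cos r * a * (?q u)\<^sup>2 = - (cos r * cos u * p)"
        unfolding hemi_sin_sq n_def p_def
        using sin_cos_squared_add[of r] sin_cos_squared_add[of u] by algebra
      then have "(- (cos r * sin u * n) - cos r * a * (?q u)\<^sup>2) / (2 * (?q u)\<^sup>2) = - (cos r * cos u * p) / (2 * (?q u)\<^sup>2)"
        by simp
      then have "- (cos r * sin u / ?q u) * S u - cos r * a / 2 = ?q u * (cos r * cos u) * S1 u"
        using q[of u] unfolding S S1 by (simp add: diff_divide_distrib power2_eq_square power3_eq_cube)
      moreover have "(X + Y) / pi - c / (2 * pi) = (K + Y) / pi" if "X - c / 2 = K" for X Y c K :: real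
        unfolding that[symmetric] by (simp add: add_divide_distrib diff_divide_distrib)
      ultimately have "((- (cos r * sin u / ?q u)) * S u + S1 u * (pi - ?d u)) / pi - cos r * a / (2 * pi) =
          (?q u * (cos r * cos u) * S1 u + S1 u * (pi - ?d u)) / pi"
        by blast
      also have "?q u * (cos r * cos u) * S1 u + S1 u * (pi - ?d u) = (pi - ?d u + ?q u * (cos r * cos u)) * S1 u"
        by algebra
      finally show ?thesis by (simp add: U1_def)
    qed
    ultimately show ?thesis by simp
  qed
  have kappa: "0 \<le> (pi - ?d u + ?q u * (cos r * cos u)) / pi" for u
  proof -
    have "sin (pi - ?d u) * cos (pi - ?d u) \<le> pi - ?d u"
      using hemi_dist_bounds[of r u] by (intro sin_mult_cos_le) simp
    then have "0 \<le> pi - ?d u + ?q u * (cos r * cos u)"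
      by (simp add: hemi_sin_eq cos_diff sin_diff cos_hemi_dist)
    then show ?thesis by simp
  qed
  have cont: "isCont (\<lambda>u. \<bar>U1 u\<bar>) u" for u
  proof -
    have "isCont ?d u" "isCont ?q u" using DERIV_isCont[OF dd] DERIV_isCont[OF dq] by auto
    then show ?thesis unfolding U1_def S1_def using q[of u] by (intro continuous_intros) auto
  qed
  \<comment> \<open>\<open>W\<close> is the variation function of \<open>U\<close>: its increments
    bound those of \<open>U\<close> and telescope over the partition.\<close>
  obtain W where dW: "\<And>u. (W has_real_derivative \<bar>U1 u\<bar>) (at u)"
    using einterval_antiderivative[of "- \<infinity>" \<infinity> "\<lambda>u. \<bar>U1 u\<bar>"] cont
    by (auto simp: has_real_derivative_iff_has_vector_derivative)
  have le: "\<bar>U v - U u\<bar> \<le> W v - W u" if "u \<le> v" for u v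
  proof -
    have "(\<lambda>u. W u - U u) u \<le> (\<lambda>u. W u - U u) v"
      by (rule DERIV_nonneg_imp_nondecreasing[OF that]) (use DERIV_diff[OF dW dU] in \<open>fastforce\<close>)
    moreover have "(\<lambda>u. W u + U u) u \<le> (\<lambda>u. W u + U u) v"
    proof (rule DERIV_nonneg_imp_nondecreasing[OF that])
      fix u show "\<exists>y. ((\<lambda>u. W u + U u) has_real_derivative y) (at u) \<and> 0 \<le> y"
        by (intro exI conjI, rule DERIV_add[OF dW dU]) auto
    qed
    ultimately show ?thesis by auto
  qed
  \<comment> \<open>In polar form the numerator of \<open>S1\<close> is
    \<open>- sin r * R * cos (u - x0)\<close>. Hence \<open>U\<close> falls on
    \<open>{m..m + pi}\<close> and rises on \<open>{m + pi..m + 2 * pi}\<close>.\<close>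
  obtain R x0 where R: "0 \<le> R" "a * sin r = R * cos x0" "b = R * sin x0"
    using rcis_cmod_Arg[of "Complex (a * sin r) b"]
    by (metis Re_rcis Im_rcis complex.sel norm_ge_zero)
  have S1R: "S1 u = - (sin r * (R * cos (u - x0))) / (2 * (?q u)^3)" for u
    by (simp add: S1_def R cos_diff algebra_simps)
  have sgnU: "U1 u \<le> 0" if "0 \<le> cos (u - x0)" for u
    unfolding U1_def S1R using q[of u] s R(1) that
    by (intro mult_nonneg_nonpos[OF kappa] divide_nonpos_pos) auto
  have sgnU': "0 \<le> U1 u" if "cos (u - x0) \<le> 0" for u
    unfolding U1_def S1R using q[of u] s R(1) that
    by (intro mult_nonneg_nonneg[OF kappa] divide_nonneg_pos) (auto simp: mult_nonneg_nonpos)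
  define m where "m = x0 - pi / 2"
  have cosm: "0 \<le> cos (u - x0)" if "m \<le> u" "u \<le> m + pi" for u
    using that by (intro cos_ge_zero) (auto simp: m_def)
  have cosm': "cos (u - x0) \<le> 0" if "m + pi \<le> u" "u \<le> m + 2 * pi" for u
  proof -
    have "0 \<le> cos (u - pi - x0)" using cosm[of "u - pi"] that by simp
    moreover have "cos (u - pi - x0) = - cos (u - x0)"
      using cos_minus_pi[of "u - x0"] by (simp add: algebra_simps)
    ultimately show ?thesis by simp
  qed
  have half1: "W (m + pi) - W m = U m - U (m + pi)"
  proof -
    have "(\<lambda>u. W u + U u) (m + pi) = (\<lambda>u. W u + U u) m"
    proof (rule DERIV_isconst_end[where f = "\<lambda>u. W u + U u"])
      show "continuous_on {m..m + pi} (\<lambda>u. W u + U u)"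
        by (intro continuous_at_imp_continuous_on ballI isCont_add isCont_diff DERIV_isCont[OF dW] DERIV_isCont[OF dU])
      show "((\<lambda>u. W u + U u) has_real_derivative 0) (at u)" if "m < u" "u < m + pi" for u
        using DERIV_add[OF dW[of u] dU[of u]] sgnU[OF cosm[of u]] that by simp
    qed simp
    then show ?thesis by simp
  qed
  have half2: "W (m + 2 * pi) - W (m + pi) = U (m + 2 * pi) - U (m + pi)"
  proof -
    have "(\<lambda>u. W u - U u) (m + 2 * pi) = (\<lambda>u. W u - U u) (m + pi)"
    proof (rule DERIV_isconst_end[where f = "\<lambda>u. W u - U u"])
      show "continuous_on {m + pi..m + 2 * pi} (\<lambda>u. W u - U u)"
        by (intro continuous_at_imp_continuous_on ballI isCont_add isCont_diff DERIV_isCont[OF dW] DERIV_isCont[OF dU])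
      show "((\<lambda>u. W u - U u) has_real_derivative 0) (at u)" if "m + pi < u" "u < m + 2 * pi" for u
        using DERIV_diff[OF dW[of u] dU[of u]] sgnU'[OF cosm'[of u]] that by simp
    qed simp
    then show ?thesis by simp
  qed
  have U1per: "U1 (u + 2 * pi) = U1 u" for u
    by (simp add: U1_def S1_def hemi_dist_periodic hemi_sin_def)
  have Wper: "W (u + 2 * pi) - W u = W (m + 2 * pi) - W m" for u
  proof -
    have "((\<lambda>u. W (u + 2 * pi) - W u) has_real_derivative 0) (at u)" for u
    proof -
      have "((\<lambda>u. W (u + 2 * pi)) has_real_derivative \<bar>U1 (u + 2 * pi)\<bar>) (at u)"
        using dW[of "u + 2 * pi"] by (simp only: DERIV_shift)
      from DERIV_diff[OF this dW[of u]] show ?thesis unfolding U1per diff_self .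
    qed
    then show ?thesis using DERIV_isconst_all[of "\<lambda>u. W (u + 2 * pi) - W u" u m] by blast
  qed
  have "(\<Sum>j<N. \<bar>U (h * Suc j - x) - U (h * j - x)\<bar>) \<le> (\<Sum>j<N. W (h * Suc j - x) - W (h * j - x))"
    by (intro sum_mono le) (auto simp: h_def divide_right_mono mult_left_mono)
  also have "\<dots> = W (h * N - x) - W (h * 0 - x)"
    using sum_lessThan_telescope[of "\<lambda>j. W (h * real j - x)" N] by simp
  also have "\<dots> = W (- x + 2 * pi) - W (- x)" using N by (simp add: h_def)
  also have "\<dots> = (W (m + 2 * pi) - W (m + pi)) + (W (m + pi) - W m)"
    using Wper[of "- x"] by simp
  also have "\<dots> = U m + U (m + 2 * pi) - 2 * U (m + pi)"
    unfolding half1 half2 by simp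
  \<comment> \<open>Opposite points have opposite values of \<open>S\<close> and complementary
    distances, so the distances drop out; the linear terms cancel.\<close>
  also have "\<dots> = 2 * S m"
  proof -
    have S: "S (m + pi) = - S m" "S (m + 2 * pi) = S m"
      by (simp_all add: S_def hemi_sin_def diff_divide_distrib)
    define K where "K = cos r * a / (2 * pi)"
    have U: "U u = (pi - ?d u) * S u / pi - K * u" for u by (simp add: U_def K_def)
    have "(pi - ?d m) * S m / pi = S m - ?d m * S m / pi"
      by (simp add: left_diff_distrib diff_divide_distrib)
    then show ?thesis
      unfolding U S hemi_dist_antipodal hemi_dist_periodic by (simp add: distrib_left)
  qed
  \<comment> \<open>\<open>2 * S u\<close> is the rate of change of the distance to
    \<open>u\<close>. At a critical point the motion is straight towards or away from
    \<open>u\<close>, and the rate is the full speed up to sign.\<close>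
  also have "\<dots> = sqrt (a\<^sup>2 + b\<^sup>2)"
  proof -
    have cs: "cos m = sin x0" "sin m = - cos x0" by (simp_all add: m_def cos_diff sin_diff)
    have "sin r * (b * sin r * cos m - a * sin m) = R * ((sin r)\<^sup>2 * (sin x0)\<^sup>2 + (cos x0)\<^sup>2)"
      unfolding cs using R(2,3) by algebra
    also have "(sin r)\<^sup>2 * (sin x0)\<^sup>2 + (cos x0)\<^sup>2 = (?q m)\<^sup>2"
      unfolding hemi_sin_sq cs using sin_cos_squared_add[of r] sin_cos_squared_add[of x0] by algebra
    finally have "sin r * (b * sin r * cos m - a * sin m) = R * (?q m)\<^sup>2" .
    then have 1: "2 * S m = R * ?q m / sin r"
      using q[of m] s by (simp add: S_def field_simps power2_eq_square)
    have "(sin r)\<^sup>2 * (a\<^sup>2 + b\<^sup>2) = (R * ?q m)\<^sup>2"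
      unfolding power_mult_distrib hemi_sin_sq cs
      using R(2,3) sin_cos_squared_add[of r] sin_cos_squared_add[of x0] by algebra
    then have "a\<^sup>2 + b\<^sup>2 = (2 * S m)\<^sup>2" unfolding 1 using s by (simp add: power_divide field_simps)
    moreover have "0 \<le> 2 * S m" unfolding 1 using R(1) q[of m] s by simp
    ultimately show ?thesis by (simp only: real_sqrt_abs abs_of_nonneg)
  qed
  finally show ?thesis .
qed

text \<open>The bound for velocities is integrated along the straight segment from
  \<open>(r, x)\<close> to \<open>(r', x')\<close>. Its interior lies at positive height, where the
  kernel is differentiable, and no parallel on it is longer than the one at height
  \<open>\<mu>\<close>. The constant \<open>c\<close> is the accumulated circulation, the same for
  all arcs.\<close>

lemma hemi_flow_le:
  fixes r r' x x' \<mu> :: real and N :: nat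
  assumes N: "0 < N" and r: "0 \<le> \<mu>" "\<mu> \<le> r" "\<mu> \<le> r'" "r \<le> pi / 2" "r' \<le> pi / 2" "0 < r \<or> 0 < r'"
  defines "h \<equiv> 2 * pi / N"
  defines "\<Delta> \<equiv> \<lambda>r x (j :: nat). hemi_pot r (h * Suc j - x) - hemi_pot r (h * j - x)"
  shows "\<exists>c. (\<Sum>j<N. \<bar>(\<Delta> r' x' j - \<Delta> r x j) / (4 * pi) + c\<bar>) \<le> sqrt ((r' - r)\<^sup>2 + (cos \<mu> * (x' - x))\<^sup>2)"
proof -
  define b where "b = r' - r"
  define \<theta> where "\<theta> = x' - x"
  define rt where "rt = (\<lambda>t. r + t * b)"
  define xt where "xt = (\<lambda>t. x + t * \<theta>)"
  have ends: "rt 0 = r" "rt 1 = r'" "xt 0 = x" "xt 1 = x'" by (simp_all add: rt_def xt_def b_def \<theta>_def)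
  have drt: "(rt has_real_derivative b) (at t)" and dxt: "(xt has_real_derivative \<theta>) (at t)" for t
    unfolding rt_def xt_def by (auto intro!: derivative_eq_intros)
  have rt: "0 < rt t" "rt t \<le> pi / 2" "\<mu> \<le> rt t" if t: "0 < t" "t < 1" for t
  proof -
    have eq: "rt t = (1 - t) * r + t * r'" by (simp add: rt_def b_def algebra_simps)
    have "(1 - t) * r + t * r' \<le> (1 - t) * (pi / 2) + t * (pi / 2)"
      using r t by (intro add_mono mult_left_mono) auto
    also have "(1 - t) * (pi / 2) + t * (pi / 2) = pi / 2" by argo
    finally show "rt t \<le> pi / 2" unfolding eq .
    have "(1 - t) * \<mu> + t * \<mu> \<le> (1 - t) * r + t * r'"
      using r t by (intro add_mono mult_left_mono) auto
    then show "\<mu> \<le> rt t" unfolding eq by (simp add: algebra_simps)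
    show "0 < rt t"
    proof -
      have "0 \<le> r" "0 \<le> r'" using r by auto
      then show ?thesis unfolding eq using r(6) t by (auto intro: add_pos_nonneg add_nonneg_pos)
    qed
  qed
  \<comment> \<open>Over each arc of length \<open>h\<close> the linear term of \<open>U\<close>
    changes by the same amount; \<open>h * C t\<close> collects these amounts during the
    motion.\<close>
  obtain C where dC: "\<And>t. (C has_real_derivative (cos (rt t))\<^sup>2 * \<theta> / (2 * pi)) (at t)"
  proof -
    have "isCont (\<lambda>t. (cos (rt t))\<^sup>2 * \<theta> / (2 * pi)) t" for t
      unfolding rt_def by (intro continuous_intros) auto
    then show ?thesis
      using einterval_antiderivative[of "- \<infinity>" \<infinity> "\<lambda>t. (cos (rt t))\<^sup>2 * \<theta> / (2 * pi)"] that
      by (auto simp: has_real_derivative_iff_has_vector_derivative)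
  qed
  define G where "G = (\<lambda>j t. \<Delta> (rt t) (xt t) j / (4 * pi) + h * C t)"
  \<comment> \<open>Fixing the signs of the total increments turns the sum of absolute values into
    the increment of one real function, to which the mean value theorem applies.\<close>
  define \<epsilon> where "\<epsilon> = (\<lambda>j. sgn (G j 1 - G j 0))"
  define \<Psi> where "\<Psi> = (\<lambda>t. \<Sum>j<N. \<epsilon> j * G j t)"
  define S where "S = (\<lambda>t u. (b * sin (rt t) * cos u - cos (rt t) * \<theta> * sin u) / (2 * hemi_sin (rt t) u))"
  define U where "U = (\<lambda>t u. (pi - hemi_dist (rt t) u) * S t u / pi - cos (rt t) * (cos (rt t) * \<theta>) * u / (2 * pi))"
  have contG: "continuous_on {0..1} (G j)" for j
  proof -
    have "continuous_on {0..1} C" using DERIV_isCont[OF dC] by (intro continuous_at_imp_continuous_on) auto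
    then show ?thesis
      unfolding G_def \<Delta>_def rt_def xt_def by (intro continuous_intros continuous_on_hemi_pot) auto
  qed
  have dP: "((\<lambda>t. hemi_pot (rt t) (y - xt t)) has_real_derivative
      - (4 * ((pi - hemi_dist (rt t) (y - xt t)) * S t (y - xt t)))) (at t)" if t: "0 < t" "t < 1" for t y
  proof -
    let ?d' = "(sin (rt t) * cos (y - xt t) * b + cos (rt t) * sin (y - xt t) * (- \<theta>)) / hemi_sin (rt t) (y - xt t)"
    have "((\<lambda>t. y - xt t) has_real_derivative - \<theta>) (at t)"
      using DERIV_diff[OF DERIV_const[of y] dxt[of t]] by simp
    from has_real_derivative_hemi_dist[OF drt this rt(1,2)[OF t]]
    have "((\<lambda>t. hemi_dist (rt t) (y - xt t)) has_real_derivative ?d') (at t)" .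
    moreover have "?d' = 2 * S t (y - xt t)"
      using hemi_sin_pos[OF rt(1,2)[OF t], of "y - xt t"] by (simp add: S_def field_simps)
    ultimately have "((\<lambda>t. hemi_dist (rt t) (y - xt t)) has_real_derivative 2 * S t (y - xt t)) (at t)" by simp
    from DERIV_power[OF DERIV_diff[OF DERIV_const[of pi] this], of 2]
    show ?thesis unfolding hemi_pot_def by (simp add: mult.commute)
  qed
  have dG: "(G j has_real_derivative - (U t (h * Suc j - xt t) - U t (h * j - xt t))) (at t)"
    if t: "0 < t" "t < 1" for j t
  proof -
    from DERIV_add[OF DERIV_cdivide[OF DERIV_diff[OF dP[OF t, of "h * Suc j"] dP[OF t, of "h * j"]], of "4 * pi"]
        DERIV_cmult[OF dC[of t], of h]]
    have "(G j has_real_derivative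
       (- (4 * ((pi - hemi_dist (rt t) (h * Suc j - xt t)) * S t (h * Suc j - xt t))) -
        - (4 * ((pi - hemi_dist (rt t) (h * j - xt t)) * S t (h * j - xt t)))) / (4 * pi) +
        h * ((cos (rt t))\<^sup>2 * \<theta> / (2 * pi))) (at t)"
      unfolding G_def \<Delta>_def .
    then show ?thesis
      by (rule DERIV_cong) (simp add: U_def field_simps power2_eq_square)
  qed
  have d\<Psi>: "(\<Psi> has_real_derivative (\<Sum>j<N. \<epsilon> j * - (U t (h * Suc j - xt t) - U t (h * j - xt t)))) (at t)"
    if "0 < t" "t < 1" for t
    unfolding \<Psi>_def by (intro DERIV_sum DERIV_cmult dG that)
  have "\<exists>l z. 0 < z \<and> z < 1 \<and> (\<Psi> has_real_derivative l) (at z) \<and> \<Psi> 1 - \<Psi> 0 = (1 - 0) * l"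
  proof (rule MVT)
    show "continuous_on {0..1} \<Psi>" unfolding \<Psi>_def by (intro continuous_intros contG)
    show "\<Psi> differentiable at t" if "0 < t" "t < 1" for t
      using d\<Psi>[OF that] by (auto simp: real_differentiable_def)
  qed simp
  then obtain l z where z: "0 < z" "z < 1" and l: "(\<Psi> has_real_derivative l) (at z)" "\<Psi> 1 - \<Psi> 0 = l"
    by auto
  from DERIV_unique[OF l(1) d\<Psi>[OF z]] have "l = (\<Sum>j<N. \<epsilon> j * - (U z (h * Suc j - xt z) - U z (h * j - xt z)))" .
  also have "\<dots> \<le> (\<Sum>j<N. \<bar>U z (h * Suc j - xt z) - U z (h * j - xt z)\<bar>)"
  proof (rule sum_mono)
    fix j
    have "\<epsilon> j * - (U z (h * Suc j - xt z) - U z (h * j - xt z)) \<le> \<bar>\<epsilon> j\<bar> * \<bar>U z (h * Suc j - xt z) - U z (h * j - xt z)\<bar>"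
      unfolding abs_mult[symmetric] by (metis abs_ge_self abs_minus_cancel mult_minus_right)
    also have "\<dots> \<le> 1 * \<bar>U z (h * Suc j - xt z) - U z (h * j - xt z)\<bar>"
      by (intro mult_right_mono) (auto simp: \<epsilon>_def abs_sgn_eq)
    finally show "\<epsilon> j * - (U z (h * Suc j - xt z) - U z (h * j - xt z)) \<le> \<bar>U z (h * Suc j - xt z) - U z (h * j - xt z)\<bar>" by simp
  qed
  also have "\<dots> \<le> sqrt ((cos (rt z) * \<theta>)\<^sup>2 + b\<^sup>2)"
    using hemi_flow_variation[OF rt(1,2)[OF z] N, where b = b and a = "cos (rt z) * \<theta>" and x = "xt z"]
    unfolding U_def S_def h_def .
  also have "\<dots> \<le> sqrt (b\<^sup>2 + (cos \<mu> * \<theta>)\<^sup>2)"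
  proof -
    have "0 \<le> cos (rt z)" using rt[OF z] by (intro cos_ge_zero) auto
    moreover have "cos (rt z) \<le> cos \<mu>" using rt[OF z] r by (intro cos_monotone_0_pi_le) auto
    ultimately have "(cos (rt z))\<^sup>2 \<le> (cos \<mu>)\<^sup>2" by (intro power_mono)
    then show ?thesis by (simp add: power_mult_distrib mult_right_mono)
  qed
  finally have "\<Psi> 1 - \<Psi> 0 \<le> sqrt (b\<^sup>2 + (cos \<mu> * \<theta>)\<^sup>2)" using l by simp
  moreover have "\<Psi> 1 - \<Psi> 0 = (\<Sum>j<N. \<bar>G j 1 - G j 0\<bar>)"
    unfolding \<Psi>_def sum_subtractf[symmetric] right_diff_distrib[symmetric] \<epsilon>_def
    by (intro sum.cong) (simp_all add: abs_sgn mult.commute)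
  moreover have "G j 1 - G j 0 = (\<Delta> r' x' j - \<Delta> r x j) / (4 * pi) + h * (C 1 - C 0)" for j
    by (simp add: G_def ends diff_divide_distrib right_diff_distrib)
  ultimately show ?thesis unfolding b_def \<theta>_def by auto
qed

section \<open>Length of Lipschitz curves\<close>

lemma curve_length_upper:
  fixes t :: "nat \<Rightarrow> real"
  assumes "mono_on {..k} t" "t ` {..k} \<subseteq> {a..b}"
  shows "(\<Sum>i<k. ennreal (mdist M (c (t i)) (c (t (Suc i))))) \<le> curve_length M a b c"
  unfolding curve_length_def using assms by (intro SUP_upper2[of "(k, t)"]) auto

text \<open>A partition of \<open>{a..s}\<close> is prolonged by \<open>s\<close> and
  \<open>t\<close>; the piece from its last point to \<open>s\<close> only adds length.\<close>

lemma curve_length_add_mdist_le: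
  assumes "a \<le> s" "s \<le> t"
  shows "curve_length M a s c + ennreal (mdist M (c s) (c t)) \<le> curve_length M a t c"
proof -
  let ?P = "{(k :: nat, p :: nat \<Rightarrow> real). mono_on {..k} p \<and> p ` {..k} \<subseteq> {a..s}}"
  have "curve_length M a s c + ennreal (mdist M (c s) (c t)) =
    (SUP x\<in>?P. (\<lambda>(k, p). \<Sum>i<k. ennreal (mdist M (c (p i)) (c (p (Suc i))))) x + ennreal (mdist M (c s) (c t)))"
  proof -
    have "(0, \<lambda>_. a) \<in> ?P" using assms by (simp add: mono_on_def)
    then have "?P \<noteq> {}" by blast
    then show ?thesis unfolding curve_length_def by (subst ennreal_SUP_add_left) auto
  qed
  also have "\<dots> \<le> curve_length M a t c"
  proof (intro SUP_least, clarify)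
    fix k and p :: "nat \<Rightarrow> real"
    assume p: "mono_on {..k} p" "p ` {..k} \<subseteq> {a..s}"
    define p' where "p' = (\<lambda>i. if i \<le> k then p i else if i = Suc k then s else t)"
    have ps: "a \<le> p i" "p i \<le> s" if "i \<le> k" for i using p(2) that by (auto simp: image_subset_iff)
    have "p i \<le> t" if "i \<le> k" for i using ps[OF that] assms by simp
    then have "mono_on {..Suc (Suc k)} p'"
      using p(1) ps assms by (auto simp: mono_on_def p'_def intro: order_trans)
    moreover have "p' ` {..Suc (Suc k)} \<subseteq> {a..t}"
      using ps assms by (fastforce simp: p'_def)
    ultimately have "(\<Sum>i<Suc (Suc k). ennreal (mdist M (c (p' i)) (c (p' (Suc i))))) \<le> curve_length M a t c"
      by (rule curve_length_upper)
    moreover have "(\<Sum>i<k. ennreal (mdist M (c (p' i)) (c (p' (Suc i))))) = (\<Sum>i<k. ennreal (mdist M (c (p i)) (c (p (Suc i)))))"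
      by (intro sum.cong) (auto simp: p'_def)
    ultimately have "(\<Sum>i<k. ennreal (mdist M (c (p i)) (c (p (Suc i))))) + ennreal (mdist M (c (p k)) (c s))
        + ennreal (mdist M (c s) (c t)) \<le> curve_length M a t c"
      by (simp add: p'_def)
    moreover have "(\<Sum>i<k. ennreal (mdist M (c (p i)) (c (p (Suc i))))) + ennreal (mdist M (c s) (c t)) \<le>
        (\<Sum>i<k. ennreal (mdist M (c (p i)) (c (p (Suc i))))) + ennreal (mdist M (c (p k)) (c s))
        + ennreal (mdist M (c s) (c t))"
      by (simp add: add_mono)
    ultimately show "(\<Sum>i<k. ennreal (mdist M (c (p i)) (c (p (Suc i))))) + ennreal (mdist M (c s) (c t)) \<le> curve_length M a t c"
      by (rule order_trans[rotated])
  qed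
  finally show ?thesis .
qed

text \<open>Cut a partition at \<open>s\<close>: the points \<open>min (p i) s\<close> partition
  \<open>{a..s}\<close>, and the increments of \<open>max (p i) s\<close> telescope and are paid for
  by the Lipschitz constant. An interval that straddles \<open>s\<close> is split by the triangle
  inequality.\<close>

lemma curve_length_le_add:
  assumes st: "a \<le> s" "s \<le> t" and K: "0 \<le> K" and c: "c ` {a..t} \<subseteq> mspace M"
    and Lip: "\<And>x y. x \<in> {a..t} \<Longrightarrow> y \<in> {a..t} \<Longrightarrow> mdist M (c x) (c y) \<le> K * \<bar>x - y\<bar>"
  shows "curve_length M a t c \<le> curve_length M a s c + ennreal (K * (t - s))"
  unfolding curve_length_def[of M a t]
proof (intro SUP_least, clarify)
  fix k and p :: "nat \<Rightarrow> real"
  assume p: "mono_on {..k} p" "p ` {..k} \<subseteq> {a..t}"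
  have pm: "p i \<le> p (Suc i)" if "i < k" for i using p(1) that by (auto simp: mono_on_def)
  have ps: "a \<le> p i" "p i \<le> t" if "i \<le> k" for i using p(2) that by (auto simp: image_subset_iff)
  let ?m = "\<lambda>i. min (p i) s" and ?M = "\<lambda>i. max (p i) s"
  have step: "mdist M (c (p i)) (c (p (Suc i))) \<le> mdist M (c (?m i)) (c (?m (Suc i))) + K * (?M (Suc i) - ?M i)"
    if i: "i < k" for i
  proof -
    have b: "p i \<in> {a..t}" "p (Suc i) \<in> {a..t}" "s \<in> {a..t}" using ps[of i] ps[of "Suc i"] i st by auto
    consider "p (Suc i) \<le> s" | "p i \<le> s" "s \<le> p (Suc i)" | "s \<le> p i" using pm[OF i] by linarith
    then show ?thesis
    proof cases
      case 1
      then show ?thesis using pm[OF i] by (simp add: min_def max_def)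
    next
      case 2
      have "mdist M (c (p i)) (c (p (Suc i))) \<le> mdist M (c (p i)) (c s) + mdist M (c s) (c (p (Suc i)))"
        using b c by (intro mdist_triangle) auto
      also have "mdist M (c s) (c (p (Suc i))) \<le> K * (p (Suc i) - s)"
        using Lip[OF b(3) b(2)] 2 by simp
      finally show ?thesis using 2 by (simp add: min_absorb1 min_absorb2 max_absorb1 max_absorb2)
    next
      case 3
      have "mdist M (c s) (c s) = 0" using b c by (intro mdist_self) auto
      then show ?thesis using 3 pm[OF i] Lip[OF b(1) b(2)] by (simp add: min_absorb2 max_absorb1)
    qed
  qed
  have "(\<Sum>i<k. mdist M (c (p i)) (c (p (Suc i)))) \<le> (\<Sum>i<k. mdist M (c (?m i)) (c (?m (Suc i)))) + K * (t - s)"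
  proof -
    have "(\<Sum>i<k. mdist M (c (p i)) (c (p (Suc i)))) \<le>
        (\<Sum>i<k. mdist M (c (?m i)) (c (?m (Suc i))) + K * (?M (Suc i) - ?M i))"
      by (intro sum_mono step) auto
    also have "\<dots> = (\<Sum>i<k. mdist M (c (?m i)) (c (?m (Suc i)))) + K * (?M k - ?M 0)"
      using sum_lessThan_telescope[of ?M k] by (simp add: sum.distrib flip: sum_distrib_left)
    also have "K * (?M k - ?M 0) \<le> K * (t - s)"
      using ps[of k] st K by (intro mult_left_mono) auto
    finally show ?thesis by simp
  qed
  then have "ennreal (\<Sum>i<k. mdist M (c (p i)) (c (p (Suc i)))) \<le> ennreal ((\<Sum>i<k. mdist M (c (?m i)) (c (?m (Suc i)))) + K * (t - s))"
    by (rule ennreal_leI)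
  also have "\<dots> = (\<Sum>i<k. ennreal (mdist M (c (?m i)) (c (?m (Suc i))))) + ennreal (K * (t - s))"
    using K st by (simp add: ennreal_plus sum_nonneg sum_ennreal)
  also have "(\<Sum>i<k. ennreal (mdist M (c (?m i)) (c (?m (Suc i))))) \<le> curve_length M a s c"
  proof (rule curve_length_upper)
    show "mono_on {..k} ?m" using p(1) by (auto simp: mono_on_def intro: min.coboundedI1)
    show "?m ` {..k} \<subseteq> {a..s}" using ps st by auto
  qed
  finally show "(\<Sum>i<k. ennreal (mdist M (c (p i)) (c (p (Suc i))))) \<le> curve_length M a s c + ennreal (K * (t - s))"
    by (simp add: sum_ennreal add_right_mono)
qed

text \<open>\<open>\<sigma>\<close> is arc length plus \<open>\<epsilon> * t\<close>, rescaled to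
  \<open>{0..2 * pi}\<close>. The added term makes \<open>\<sigma>\<close> bi-Lipschitz even where
  the curve stands still, as \<open>coordinate_invariance\<close> will require of the coordinates in
  the disc; it costs \<open>2 * pi * \<epsilon>\<close> of length.\<close>

lemma reparametrization:
  assumes c: "c ` {0..2 * pi} \<subseteq> mspace M" and K: "0 \<le> K"
    and Lip: "\<And>x y. x \<in> {0..2 * pi} \<Longrightarrow> y \<in> {0..2 * pi} \<Longrightarrow> mdist M (c x) (c y) \<le> K * \<bar>x - y\<bar>"
    and \<epsilon>: "0 < \<epsilon>"
  obtains L l A B \<sigma> T where "curve_length M 0 (2 * pi) c = ennreal L" "0 \<le> L" "l = (L + 2 * pi * \<epsilon>) / (2 * pi)"
    "0 \<le> A" "0 \<le> B"
    "\<sigma> 0 = 0" "\<sigma> (2 * pi) = 2 * pi" "\<sigma> ` {0..2 * pi} \<subseteq> {0..2 * pi}" "T ` {0..2 * pi} \<subseteq> {0..2 * pi}"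
    "\<And>t. t \<in> {0..2 * pi} \<Longrightarrow> T (\<sigma> t) = t" "\<And>x. x \<in> {0..2 * pi} \<Longrightarrow> \<sigma> (T x) = x"
    "\<And>s t. s \<in> {0..2 * pi} \<Longrightarrow> t \<in> {0..2 * pi} \<Longrightarrow> s < t \<Longrightarrow> \<sigma> s < \<sigma> t"
    "\<And>s t. s \<in> {0..2 * pi} \<Longrightarrow> t \<in> {0..2 * pi} \<Longrightarrow> \<bar>\<sigma> s - \<sigma> t\<bar> \<le> A * \<bar>s - t\<bar>"
    "\<And>x y. x \<in> {0..2 * pi} \<Longrightarrow> y \<in> {0..2 * pi} \<Longrightarrow> \<bar>T x - T y\<bar> \<le> B * \<bar>x - y\<bar>"
    "\<And>x y. x \<in> {0..2 * pi} \<Longrightarrow> y \<in> {0..2 * pi} \<Longrightarrow> mdist M (c (T x)) (c (T y)) \<le> l * \<bar>x - y\<bar>"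
proof -
  let ?I = "{0..2 * pi}"
  have c0: "c t \<in> mspace M" if "t \<in> ?I" for t using c that by auto
  have up: "curve_length M 0 t c \<le> curve_length M 0 s c + ennreal (K * (t - s))" if "0 \<le> s" "s \<le> t" "t \<le> 2 * pi" for s t
    using that c0 K Lip by (intro curve_length_le_add) auto
  have zero: "curve_length M 0 0 c = 0"
  proof -
    have "(\<Sum>i<k. ennreal (mdist M (c (p i)) (c (p (Suc i))))) = 0" if "p ` {..k} \<subseteq> {0..0}" for k :: nat and p :: "nat \<Rightarrow> real"
    proof (rule sum.neutral, safe)
      fix i assume "i < k"
      then have "p i = 0" "p (Suc i) = 0" using that by (auto simp: image_subset_iff)
      then show "ennreal (mdist M (c (p i)) (c (p (Suc i)))) = 0" using c0[of 0] by (simp add: mdist_self)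
    qed
    then show ?thesis unfolding curve_length_def by (auto intro!: antisym SUP_least)
  qed
  define V where "V = (\<lambda>t. enn2real (curve_length M 0 t c))"
  have fin: "curve_length M 0 t c = ennreal (V t)" if "t \<in> ?I" for t
  proof -
    have "curve_length M 0 t c \<le> ennreal (K * t)" using up[of 0 t] that zero by simp
    then have "curve_length M 0 t c < \<infinity>" using le_less_trans by fastforce
    then show ?thesis by (simp add: V_def)
  qed
  have V0: "0 \<le> V t" for t by (simp add: V_def)
  have Vup: "V t \<le> V s + K * (t - s)" if "0 \<le> s" "s \<le> t" "t \<le> 2 * pi" for s t
  proof -
    have "ennreal (V t) \<le> ennreal (V s + K * (t - s))"
      using up[OF that] that fin[of s] fin[of t] V0 K by (simp add: ennreal_plus)
    then show ?thesis using V0 K that by (subst (asm) ennreal_le_iff) auto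
  qed
  have Vlow: "V s + mdist M (c s) (c t) \<le> V t" if "0 \<le> s" "s \<le> t" "t \<le> 2 * pi" for s t
  proof -
    have "ennreal (V s + mdist M (c s) (c t)) \<le> ennreal (V t)"
      using curve_length_add_mdist_le[of 0 s t M c] that fin[of s] fin[of t] V0 by (simp add: ennreal_plus)
    then show ?thesis using V0 by (subst (asm) ennreal_le_iff) auto
  qed
  define L where "L = V (2 * pi)"
  define l where "l = (L + 2 * pi * \<epsilon>) / (2 * pi)"
  have l: "0 < l" using V0[of "2 * pi"] \<epsilon> by (auto simp: l_def L_def intro!: divide_pos_pos add_nonneg_pos)
  define \<sigma> where "\<sigma> = (\<lambda>t. (V t + \<epsilon> * t) / l)"
  have VV0: "V 0 = 0" using zero by (simp add: V_def)
  have \<sigma>0: "\<sigma> 0 = 0" by (simp add: \<sigma>_def VV0)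
  have \<sigma>1: "\<sigma> (2 * pi) = 2 * pi"
  proof -
    have "V (2 * pi) + \<epsilon> * (2 * pi) = l * (2 * pi)" by (simp add: l_def L_def mult.commute)
    then show ?thesis using l by (simp add: \<sigma>_def)
  qed
  have \<sigma>diff: "\<sigma> t - \<sigma> s = (V t - V s + \<epsilon> * (t - s)) / l" for s t
    by (simp add: \<sigma>_def diff_divide_distrib add_divide_distrib right_diff_distrib)
  have \<sigma>low: "\<epsilon> / l * (t - s) \<le> \<sigma> t - \<sigma> s" if "0 \<le> s" "s \<le> t" "t \<le> 2 * pi" for s t
  proof -
    have "V s \<le> V t" by (rule order_trans[OF _ Vlow[OF that]]) simp
    then have "\<epsilon> * (t - s) / l \<le> (V t - V s + \<epsilon> * (t - s)) / l" using l by (intro divide_right_mono) auto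
    then show ?thesis by (simp add: \<sigma>diff)
  qed
  have \<sigma>up: "\<sigma> t - \<sigma> s \<le> (K + \<epsilon>) / l * (t - s)" if "0 \<le> s" "s \<le> t" "t \<le> 2 * pi" for s t
    unfolding \<sigma>diff using Vup[OF that] l by (simp add: divide_right_mono distrib_right)
  have smono: "\<sigma> s < \<sigma> t" if "s \<in> ?I" "t \<in> ?I" "s < t" for s t
  proof -
    have "0 < \<epsilon> / l * (t - s)" using \<epsilon> l that by simp
    then show ?thesis using \<sigma>low[of s t] that by auto
  qed
  have \<sigma>Lip: "\<bar>\<sigma> s - \<sigma> t\<bar> \<le> (K + \<epsilon>) / l * \<bar>s - t\<bar>" if st: "s \<in> ?I" "t \<in> ?I" for s t
  proof -
    have 1: "0 \<le> \<epsilon> / l * d" if "0 \<le> d" for d using that \<epsilon> l by simp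
    show ?thesis
    proof (cases "s \<le> t")
      case True
      then show ?thesis using \<sigma>up[of s t] \<sigma>low[of s t] 1[of "t - s"] st by auto
    next
      case False
      then show ?thesis using \<sigma>up[of t s] \<sigma>low[of t s] 1[of "s - t"] st by auto
    qed
  qed
  have \<sigma>I: "\<sigma> t \<in> ?I" if "t \<in> ?I" for t
  proof -
    have 1: "0 \<le> \<epsilon> / l * d" if "0 \<le> d" for d using that \<epsilon> l by simp
    show ?thesis using \<sigma>low[of 0 t] \<sigma>low[of t "2 * pi"] that 1[of "t - 0"] 1[of "2 * pi - t"] \<sigma>0 \<sigma>1 by auto
  qed
  have cont: "continuous_on ?I \<sigma>"
    using \<sigma>Lip K \<epsilon> l by (intro lipschitz_on_continuous_on[of "(K + \<epsilon>) / l"] lipschitz_onI) (auto simp: dist_real_def)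
  have surj: "\<exists>t. t \<in> ?I \<and> \<sigma> t = x" if "x \<in> ?I" for x
    using IVT'[of \<sigma> 0 x "2 * pi"] that \<sigma>0 \<sigma>1 cont by auto
  have inj: "inj_on \<sigma> ?I" using smono by (intro linorder_inj_onI') (metis less_irrefl)
  define T where "T = inv_into ?I \<sigma>"
  have TI: "T x \<in> ?I" and \<sigma>T: "\<sigma> (T x) = x" if "x \<in> ?I" for x
    using surj[OF that] inv_into_into[of x \<sigma> ?I] f_inv_into_f[of x \<sigma> ?I] by (auto simp: T_def)
  have T\<sigma>: "T (\<sigma> t) = t" if "t \<in> ?I" for t
    unfolding T_def using inv_into_f_f[OF inj that] .
  have TLip: "\<bar>T x - T y\<bar> \<le> l / \<epsilon> * \<bar>x - y\<bar>" if xy: "x \<in> ?I" "y \<in> ?I" for x y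
  proof -
    have 1: "\<epsilon> / l * \<bar>s - t\<bar> \<le> \<bar>\<sigma> s - \<sigma> t\<bar>" if "s \<in> ?I" "t \<in> ?I" for s t
      using \<sigma>low[of s t] \<sigma>low[of t s] that by (cases "s \<le> t") auto
    have "\<epsilon> / l * \<bar>T x - T y\<bar> \<le> \<bar>x - y\<bar>"
      using 1[OF TI[OF xy(1)] TI[OF xy(2)]] \<sigma>T xy by simp
    then show ?thesis using \<epsilon> l by (simp add: field_simps)
  qed
  have gLip: "mdist M (c (T x)) (c (T y)) \<le> l * \<bar>x - y\<bar>" if xy: "x \<in> ?I" "y \<in> ?I" for x y
  proof -
    have 1: "mdist M (c s) (c t) \<le> l * \<bar>\<sigma> s - \<sigma> t\<bar>" if "s \<in> ?I" "t \<in> ?I" "s \<le> t" for s t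
    proof -
      have "0 \<le> \<epsilon> * (t - s)" using \<epsilon> that by simp
      moreover have "V s + mdist M (c s) (c t) \<le> V t" using Vlow[of s t] that by simp
      ultimately have "mdist M (c s) (c t) \<le> V t - V s + \<epsilon> * (t - s)" by linarith
      also have "\<dots> = l * (\<sigma> t - \<sigma> s)" unfolding \<sigma>diff using l by simp
      also have "\<dots> \<le> l * \<bar>\<sigma> s - \<sigma> t\<bar>" using l by (intro mult_left_mono) auto
      finally show ?thesis .
    qed
    have "mdist M (c s) (c t) \<le> l * \<bar>\<sigma> s - \<sigma> t\<bar>" if "s \<in> ?I" "t \<in> ?I" for s t
      using 1[of s t] 1[of t s] that by (cases "s \<le> t") (auto simp: mdist_commute abs_minus_commute)
    from this[OF TI[OF xy(1)] TI[OF xy(2)]] show ?thesis using \<sigma>T xy by simp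
  qed
  show ?thesis
  proof (rule that[of L l "(K + \<epsilon>) / l" "l / \<epsilon>" \<sigma> T])
    show "curve_length M 0 (2 * pi) c = ennreal L" using fin[of "2 * pi"] by (simp add: L_def)
    show "\<sigma> ` ?I \<subseteq> ?I" using \<sigma>I by auto
    show "T ` ?I \<subseteq> ?I" using TI by auto
  qed (use V0 K \<epsilon> l l_def L_def \<sigma>0 \<sigma>1 T\<sigma> \<sigma>T smono \<sigma>Lip TLip gLip in auto)
qed

section \<open>The Lipschitz map on the hemisphere\<close>

locale circle_in_barycenter_space = barycenter_space X b for X :: "'a metric" and b +
  fixes \<gamma> :: "real \<Rightarrow> 'a" and l :: real and N :: nat and \<tau> :: real
  assumes \<gamma>: "\<gamma> ` {0..2 * pi} \<subseteq> mspace X" and l: "0 < l"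
    and \<gamma>_Lip: "\<And>x y. x \<in> {0..2 * pi} \<Longrightarrow> y \<in> {0..2 * pi} \<Longrightarrow> mdist X (\<gamma> x) (\<gamma> y) \<le> l * \<bar>x - y\<bar>"
    and \<gamma>_closed: "\<gamma> (2 * pi) = \<gamma> 0"
    and N: "0 < N" and \<tau>: "0 < \<tau>" "\<tau> < 1"
begin

definition h :: real where "h = 2 * pi / N"

text \<open>The average of the density of \<open>\<mu>\<^sub>p\<close> over an arc of length \<open>h\<close> is a second difference of \<open>hemi_pot\<close>.  The
  factor \<open>\<tau> < 1\<close> keeps the weights away from \<open>0\<close>.\<close>

definition wt :: "real \<Rightarrow> real \<Rightarrow> nat \<Rightarrow> real" where
  "wt r x j = 1 / N - \<tau> * (hemi_pot r (h * j - x + h) - 2 * hemi_pot r (h * j - x) + hemi_pot r (h * j - x - h)) / (4 * pi * h)"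

lemma h_pos: "0 < h" using N by (simp add: h_def)

lemma hN: "h * N = 2 * pi" using N by (simp add: h_def)

text \<open>Displays the weights as a mixture of the uniform ones, in proportion
  \<open>1 - \<tau>\<close>, with the averages of the density. This gives their lower bound and, on
  the equator, isolates the mass far from \<open>x\<close>.\<close>

lemma wt_eq_mix:
  "wt r x j = (1 - \<tau>) / N + \<tau> * (2 * h\<^sup>2 - (hemi_pot r (h * j - x + h) - 2 * hemi_pot r (h * j - x) + hemi_pot r (h * j - x - h))) / (4 * pi * h)"
proof -
  have "2 * h\<^sup>2 / (4 * pi * h) = 1 / N"
    using N h_pos by (simp add: power2_eq_square) (simp add: h_def)
  then have "(2 * h\<^sup>2 - X) / (4 * pi * h) = 1 / N - X / (4 * pi * h)" for X
    by (simp only: diff_divide_distrib)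
  then have "\<tau> * (2 * h\<^sup>2 - X) / (4 * pi * h) = \<tau> * (1 / N - X / (4 * pi * h))" for X
    by (simp only: times_divide_eq_right[symmetric])
  then show ?thesis unfolding wt_def by (simp add: right_diff_distrib diff_divide_distrib)
qed

lemma wt_ge:
  assumes "0 \<le> r" "r \<le> pi / 2"
  shows "(1 - \<tau>) / N \<le> wt r x j"
  unfolding wt_eq_mix
  using hemi_pot_second_difference_le[OF assms, of "h * j - x" h] \<tau> h_pos
  by (auto intro!: divide_nonneg_pos mult_nonneg_nonneg)

lemma wt_pos: "0 \<le> r \<Longrightarrow> r \<le> pi / 2 \<Longrightarrow> 0 < wt r x j"
  using wt_ge[of r x j] \<tau> N by (smt (verit) divide_pos_pos of_nat_0_less_iff)

text \<open>The weights are affine in the differences of this quantity at neighbouring nodes. So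
  they sum to 1 by periodicity, and when \<open>(r, x)\<close> changes, the change of
  \<open>pot_step\<close> is, up to scaling and a constant, a flow of mass between neighbours. The
  argument \<open>t\<close> is real to allow the index \<open>-1\<close>.\<close>

definition pot_step :: "real \<Rightarrow> real \<Rightarrow> real \<Rightarrow> real" where
  "pot_step r x t = hemi_pot r (h * t + h - x) - hemi_pot r (h * t - x)"

lemma pot_step_periodic: "pot_step r x (t + real N) = pot_step r x t"
proof -
  have "h * (t + real N) + h - x = (h * t + h - x) + 2 * pi" "h * (t + real N) - x = (h * t - x) + 2 * pi"
    using hN by (simp_all add: algebra_simps)
  then show ?thesis by (simp only: pot_step_def hemi_pot_periodic)
qed

lemma wt_eq_step: "wt r x j = 1 / N - \<tau> / (4 * pi * h) * (pot_step r x j - pot_step r x (real j - 1))"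
proof -
  have e: "h * real j + h - x = h * j - x + h" "h * (real j - 1) + h - x = h * j - x" "h * (real j - 1) - x = h * j - x - h"
    by (simp_all add: algebra_simps)
  have "a - 2 * b + c = (a - b) - (b - c)" for a b c :: real by simp
  then show ?thesis unfolding wt_def pot_step_def e by simp
qed

lemma wt_periodic: "wt r (x + 2 * pi) j = wt r x j"
proof -
  have "hemi_pot r (u - 2 * pi) = hemi_pot r u" for u
    using hemi_pot_periodic[of r "u - 2 * pi"] by simp
  from this[of "h * j - x + h"] this[of "h * j - x"] this[of "h * j - x - h"] show ?thesis
    by (simp add: wt_def algebra_simps)
qed

lemma sum_wt: "(\<Sum>j<N. wt r x j) = 1"
proof -
  have "(\<Sum>j<N. pot_step r x j - pot_step r x (real j - 1)) = pot_step r x (real N - 1) - pot_step r x (- 1)"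
    using sum_lessThan_telescope[of "\<lambda>j. pot_step r x (real j - 1)" N] by simp
  also have "\<dots> = 0" using pot_step_periodic[of r x "- 1"] by simp
  finally have "(\<Sum>j<N. pot_step r x j - pot_step r x (real j - 1)) = 0" .
  moreover have "(\<Sum>j<N. wt r x j) = (\<Sum>j<N. 1 / N) - \<tau> / (4 * pi * h) * (\<Sum>j<N. pot_step r x j - pot_step r x (real j - 1))"
    unfolding wt_eq_step sum_distrib_left by (rule sum_subtractf)
  ultimately show ?thesis using N by simp
qed

text \<open>The atom with index \<open>N\<close> sits at \<open>\<gamma> x\<close>; it interpolates, for \<open>\<kappa>\<close> between \<open>0\<close> and \<open>1\<close>, between the
  curve and the averaged kernel.\<close>

definition weight :: "real \<Rightarrow> real \<Rightarrow> real \<Rightarrow> nat \<Rightarrow> real" where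
  "weight \<kappa> r x j = (if j < N then \<kappa> * wt r x j else 1 - \<kappa>)"

definition node :: "real \<Rightarrow> nat \<Rightarrow> 'a" where
  "node x j = (if j < N then \<gamma> (h * j) else \<gamma> x)"

lemma atMost_N: "{..N} = insert N {..<N}" by auto

lemma sum_atMost_N: "(\<Sum>j\<le>N. f j) = (\<Sum>j<N. f j) + f N" for f :: "nat \<Rightarrow> real"
  by (simp add: atMost_N)

lemma sum_weight: "(\<Sum>j\<le>N. weight \<kappa> r x j) = 1"
  using sum_wt[of r x] by (simp add: sum_atMost_N weight_def flip: sum_distrib_left)

lemma weight_nonneg: "0 \<le> \<kappa> \<Longrightarrow> \<kappa> \<le> 1 \<Longrightarrow> 0 \<le> r \<Longrightarrow> r \<le> pi / 2 \<Longrightarrow> 0 \<le> weight \<kappa> r x j"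
  using wt_pos[of r x j] by (simp add: weight_def)

lemma node_angle_in: "j \<le> N \<Longrightarrow> h * j \<in> {0..2 * pi}"
  using h_pos hN mult_left_mono[of "real j" "real N" h] by auto

lemma node_in: "x \<in> {0..2 * pi} \<Longrightarrow> node x \<in> {..N} \<rightarrow> mspace X"
  using \<gamma> node_angle_in by (auto simp: node_def)

lemma \<gamma>_in: "x \<in> {0..2 * pi} \<Longrightarrow> \<gamma> x \<in> mspace X"
  using \<gamma> by auto

definition \<Psi> :: "real \<Rightarrow> real \<Rightarrow> real \<Rightarrow> 'a" where
  "\<Psi> \<kappa> r x = bary {..N} (weight \<kappa> r x) (node x)"

lemma \<Psi>_in:
  "0 \<le> \<kappa> \<Longrightarrow> \<kappa> \<le> 1 \<Longrightarrow> 0 \<le> r \<Longrightarrow> r \<le> pi / 2 \<Longrightarrow> x \<in> {0..2 * pi} \<Longrightarrow> \<Psi> \<kappa> r x \<in> mspace X"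
  unfolding \<Psi>_def by (intro bary_in_mspace node_in weight_nonneg sum_weight) auto

text \<open>The cyclic successor among the nodes, extended to a permutation of \<open>{..N}\<close>
  by fixing the atom on the curve, which takes no part in the flow.\<close>

definition next_node :: "nat \<Rightarrow> nat" where
  "next_node j = (if j < N then (if Suc j = N then 0 else Suc j) else j)"

lemma bij_next_node: "bij_betw next_node {..N} {..N}"
proof (rule bij_betwI[where g = "\<lambda>j. if j < N then (if j = 0 then N - 1 else j - 1) else j"])
qed (use N in \<open>auto simp: next_node_def split: if_splits\<close>)

lemma mdist_next_node:
  assumes "j < N"
  shows "mdist X (\<gamma> (h * j)) (\<gamma> (h * next_node j)) \<le> l * h"
proof -
  have "\<gamma> (h * next_node j) = \<gamma> (h * Suc j)"
    using assms hN \<gamma>_closed by (auto simp: next_node_def)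
  also have "mdist X (\<gamma> (h * j)) (\<gamma> (h * Suc j)) \<le> l * \<bar>h * j - h * Suc j\<bar>"
    using node_angle_in[of j] node_angle_in[of "Suc j"] assms by (intro \<gamma>_Lip) auto
  also have "\<bar>h * j - h * Suc j\<bar> = h" using h_pos by (simp add: algebra_simps)
  finally show ?thesis .
qed

text \<open>The atoms stay in place and only the weights change. Neighbouring nodes are within
  \<open>l * h\<close> of each other and the flow carries the factor \<open>1 / h\<close>, so the
  mesh cancels from the cost.\<close>

lemma bary_weight_le_pos:
  assumes \<kappa>: "0 \<le> \<kappa>" "\<kappa> \<le> 1" and x0: "x0 \<in> {0..2 * pi}"
    and r: "0 \<le> \<mu>" "\<mu> \<le> r" "\<mu> \<le> r'" "r \<le> pi / 2" "r' \<le> pi / 2" "0 < r \<or> 0 < r'"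
  shows "mdist X (bary {..N} (weight \<kappa> r x) (node x0)) (bary {..N} (weight \<kappa> r' x') (node x0))
    \<le> \<kappa> * (l * sqrt ((r' - r)\<^sup>2 + (cos \<mu> * (x' - x))\<^sup>2))"
proof -
  define \<Delta> where "\<Delta> = (\<lambda>j. pot_step r' x' (real j) - pot_step r x (real j))"
  obtain c where c: "(\<Sum>j<N. \<bar>\<Delta> j / (4 * pi) + c\<bar>) \<le> sqrt ((r' - r)\<^sup>2 + (cos \<mu> * (x' - x))\<^sup>2)"
  proof -
    have "pot_step r x (real j) = hemi_pot r (2 * pi / N * Suc j - x) - hemi_pot r (2 * pi / N * j - x)" for r x j
    proof -
      have "h * real j + h - x = h * Suc j - x" by (simp add: algebra_simps)
      then show ?thesis by (simp only: pot_step_def h_def)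
    qed
    then show ?thesis using hemi_flow_le[OF N r, of x' x] that unfolding \<Delta>_def by auto
  qed
  define \<phi> where "\<phi> = (\<lambda>j. if j < N then \<kappa> * (\<tau> / h * (\<Delta> j / (4 * pi) + c)) else 0)"
  have flow: "weight \<kappa> r' x' (next_node i) = weight \<kappa> r x (next_node i) + \<phi> i - \<phi> (next_node i)" if "i \<in> {..N}" for i
  proof (cases "i < N")
    case True
    define k where "k = next_node i"
    have k: "k < N" using True N by (auto simp: k_def next_node_def)
    have prev: "pot_step r x (real k - 1) = pot_step r x i" for r x
      using pot_step_periodic[of r x "-1"] True by (auto simp: k_def next_node_def of_nat_diff)
    have "wt r' x' k - wt r x k = \<tau> / (4 * pi * h) * (\<Delta> i - \<Delta> k)"
      by (simp add: wt_eq_step prev \<Delta>_def algebra_simps)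
    also have "\<dots> = \<tau> / h * (\<Delta> i / (4 * pi) + c) - \<tau> / h * (\<Delta> k / (4 * pi) + c)"
      by (simp add: algebra_simps diff_divide_distrib)
    finally have "\<kappa> * wt r' x' k = \<kappa> * wt r x k + \<kappa> * (\<tau> / h * (\<Delta> i / (4 * pi) + c)) - \<kappa> * (\<tau> / h * (\<Delta> k / (4 * pi) + c))"
      by algebra
    then show ?thesis using True k by (simp add: weight_def \<phi>_def flip: k_def)
  next
    case False
    then show ?thesis by (simp add: weight_def \<phi>_def next_node_def)
  qed
  have r0: "0 \<le> r" "0 \<le> r'" using r by auto
  define m where "m = (1 - \<tau>) / N"
  have m: "0 < m" using \<tau> N by (simp add: m_def)
  \<comment> \<open>Every weight on the cycle is at least \<open>\<kappa> * m\<close>, so a bound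
    \<open>B\<close> for the flow yields a feasible fraction. For \<open>\<kappa> = 0\<close> these
    weights and the flow vanish together.\<close>
  have "\<exists>\<omega>>0. \<forall>i\<in>{..N}. \<omega> * (\<bar>\<phi> i\<bar> + \<bar>\<phi> (next_node i)\<bar>) \<le> (if next_node i < N then \<kappa> * m else 0)"
  proof (cases "\<kappa> = 0")
    case True
    then have "\<phi> i = 0" for i by (simp add: \<phi>_def)
    then show ?thesis using True by (intro exI[of _ 1]) simp
  next
    case False
    define B where "B = (\<Sum>i\<le>N. \<bar>\<phi> i\<bar>) + 1"
    have B: "\<bar>\<phi> i\<bar> \<le> B" if "i \<le> N" for i
      using member_le_sum[of i "{..N}" "\<lambda>i. \<bar>\<phi> i\<bar>"] that by (simp add: B_def)
    have B0: "0 < B" by (simp add: B_def add_nonneg_pos sum_nonneg)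
    show ?thesis
    proof (intro exI[of _ "\<kappa> * m / (2 * B)"] conjI ballI)
      show "0 < \<kappa> * m / (2 * B)" using False \<kappa> m B0 by simp
      fix i assume i: "i \<in> {..N}"
      show "\<kappa> * m / (2 * B) * (\<bar>\<phi> i\<bar> + \<bar>\<phi> (next_node i)\<bar>) \<le> (if next_node i < N then \<kappa> * m else 0)"
      proof (cases "i < N")
        case True
        then have k: "next_node i < N" using N by (auto simp: next_node_def)
        have "\<kappa> * m / (2 * B) * (\<bar>\<phi> i\<bar> + \<bar>\<phi> (next_node i)\<bar>) \<le> \<kappa> * m / (2 * B) * (B + B)"
          using B[of i] B[of "next_node i"] True k \<kappa> m B0 by (intro mult_left_mono add_mono) auto
        also have "\<dots> = \<kappa> * m" using B0 by simp
        finally show ?thesis using k by simp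
      next
        case False
        then show ?thesis by (simp add: next_node_def \<phi>_def)
      qed
    qed
  qed
  then obtain \<omega> where \<omega>: "0 < \<omega>"
    "\<And>i. i \<in> {..N} \<Longrightarrow> \<omega> * (\<bar>\<phi> i\<bar> + \<bar>\<phi> (next_node i)\<bar>) \<le> (if next_node i < N then \<kappa> * m else 0)"
    by blast
  have low: "(if k < N then \<kappa> * m else 0) \<le> weight \<kappa> r x k" if "0 \<le> r" "r \<le> pi / 2" for k r x
    using mult_left_mono[OF wt_ge[OF that, of x k] \<kappa>(1)] \<kappa> by (auto simp: weight_def m_def)
  have "mdist X (bary {..N} (weight \<kappa> r x) (node x0)) (bary {..N} (weight \<kappa> r' x') (node x0))
     \<le> (\<Sum>i\<in>{..N}. \<bar>\<phi> i\<bar> * mdist X (node x0 i) (node x0 (next_node i)))"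
    by (rule bary_flow_le[OF _ bij_next_node node_in[OF x0] sum_weight flow \<omega>(1)])
      (use \<omega>(2) low r r0 order_trans in blast)+
  also have "\<dots> = (\<Sum>i<N. \<bar>\<phi> i\<bar> * mdist X (node x0 i) (node x0 (next_node i)))"
    by (simp add: sum_atMost_N \<phi>_def)
  also have "\<dots> \<le> (\<Sum>i<N. \<kappa> * (\<tau> / h * \<bar>\<Delta> i / (4 * pi) + c\<bar>) * (l * h))"
  proof (rule sum_mono)
    fix i assume "i \<in> {..<N}"
    then have i: "i < N" by simp
    then have k: "next_node i < N" using N by (auto simp: next_node_def)
    have "\<bar>\<phi> i\<bar> = \<kappa> * (\<tau> / h * \<bar>\<Delta> i / (4 * pi) + c\<bar>)"
      using i \<kappa> \<tau> h_pos by (simp add: \<phi>_def abs_mult)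
    then show "\<bar>\<phi> i\<bar> * mdist X (node x0 i) (node x0 (next_node i)) \<le> \<kappa> * (\<tau> / h * \<bar>\<Delta> i / (4 * pi) + c\<bar>) * (l * h)"
      using mult_left_mono[OF mdist_next_node[OF i], of "\<bar>\<phi> i\<bar>"] i k by (simp add: node_def)
  qed
  also have "\<dots> = \<kappa> * (l * (\<tau> * (\<Sum>i<N. \<bar>\<Delta> i / (4 * pi) + c\<bar>)))"
    unfolding sum_distrib_left using h_pos by (intro sum.cong) auto
  also have "\<dots> \<le> \<kappa> * (l * (1 * sqrt ((r' - r)\<^sup>2 + (cos \<mu> * (x' - x))\<^sup>2)))"
    using \<kappa> l \<tau> c by (intro mult_left_mono mult_mono) (auto simp: sum_nonneg)
  finally show ?thesis by simp
qed

text \<open>Along the equator the kernel is not differentiable. The path rises to a small height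
  \<open>\<rho>\<close>, moves there and descends; the two vertical legs together cost at most
  \<open>e\<close>.\<close>

lemma bary_weight_le:
  assumes \<kappa>: "0 \<le> \<kappa>" "\<kappa> \<le> 1" and x0: "x0 \<in> {0..2 * pi}"
    and r: "0 \<le> \<mu>" "\<mu> \<le> r" "\<mu> \<le> r'" "r \<le> pi / 2" "r' \<le> pi / 2"
  shows "mdist X (bary {..N} (weight \<kappa> r x) (node x0)) (bary {..N} (weight \<kappa> r' x') (node x0))
    \<le> \<kappa> * (l * sqrt ((r' - r)\<^sup>2 + (cos \<mu> * (x' - x))\<^sup>2))"
proof (cases "0 < r \<or> 0 < r'")
  case True
  then show ?thesis using assms by (intro bary_weight_le_pos) auto
next
  case False
  then have z: "r = 0" "r' = 0" "\<mu> = 0" using r by auto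
  let ?B = "\<lambda>r x. bary {..N} (weight \<kappa> r x) (node x0)"
  have inX: "?B r x \<in> mspace X" if "0 \<le> r" "r \<le> pi / 2" for r x
    using that \<kappa> x0 by (intro bary_in_mspace node_in weight_nonneg sum_weight) auto
  have "mdist X (?B 0 x) (?B 0 x') \<le> \<kappa> * (l * \<bar>x' - x\<bar>) + e" if e: "0 < e" for e
  proof -
    define \<rho> where "\<rho> = min (pi / 2) (e / (2 * l))"
    have \<rho>: "0 < \<rho>" "\<rho> \<le> pi / 2" "\<rho> \<le> e / (2 * l)" using e l by (auto simp: \<rho>_def)
    have le: "l * \<rho> \<le> e / 2" using \<rho>(3) l by (simp add: field_simps)
    have "\<kappa> * (l * \<rho>) \<le> 1 * (l * \<rho>)" using \<kappa> l \<rho> by (intro mult_right_mono) auto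
    then have le': "\<kappa> * (l * \<rho>) \<le> e / 2" using le by simp
    have 1: "mdist X (?B 0 x) (?B \<rho> x) \<le> \<kappa> * (l * \<rho>)"
      using bary_weight_le_pos[OF \<kappa> x0, of 0 0 \<rho> x x] \<rho> by simp
    have 2: "mdist X (?B \<rho> x) (?B \<rho> x') \<le> \<kappa> * (l * \<bar>x' - x\<bar>)"
      using bary_weight_le_pos[OF \<kappa> x0, of 0 \<rho> \<rho> x x'] \<rho> by simp
    have 3: "mdist X (?B \<rho> x') (?B 0 x') \<le> \<kappa> * (l * \<rho>)"
      using bary_weight_le_pos[OF \<kappa> x0, of 0 \<rho> 0 x' x'] \<rho> by simp
    have "mdist X (?B 0 x) (?B 0 x') \<le> mdist X (?B 0 x) (?B \<rho> x) + (mdist X (?B \<rho> x) (?B \<rho> x') + mdist X (?B \<rho> x') (?B 0 x'))"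
      using mdist_triangle[of "?B 0 x" X "?B \<rho> x" "?B 0 x'"] mdist_triangle[of "?B \<rho> x" X "?B \<rho> x'" "?B 0 x'"] inX \<rho> by fastforce
    then show ?thesis using 1 2 3 le' by linarith
  qed
  then have "mdist X (?B 0 x) (?B 0 x') \<le> \<kappa> * (l * \<bar>x' - x\<bar>)" by (rule field_le_epsilon)
  then show ?thesis by (simp add: z)
qed

text \<open>First the weights are changed with the extra atom held at \<open>\<gamma> x\<close>,
  then that atom, of weight \<open>1 - \<kappa>\<close>, is moved to
  \<open>\<gamma> x'\<close>.\<close>

lemma \<Psi>_x_le:
  assumes \<kappa>: "0 \<le> \<kappa>" "\<kappa> \<le> 1" and x: "x \<in> {0..2 * pi}" "x' \<in> {0..2 * pi}"
    and r: "0 \<le> \<mu>" "\<mu> \<le> r" "\<mu> \<le> r'" "r \<le> pi / 2" "r' \<le> pi / 2"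
  shows "mdist X (\<Psi> \<kappa> r x) (\<Psi> \<kappa> r' x')
    \<le> \<kappa> * (l * sqrt ((r' - r)\<^sup>2 + (cos \<mu> * (x' - x))\<^sup>2)) + (1 - \<kappa>) * (l * \<bar>x' - x\<bar>)"
proof -
  let ?M = "bary {..N} (weight \<kappa> r' x') (node x)"
  have r0: "0 \<le> r" "0 \<le> r'" using r by auto
  have "?M \<in> mspace X" using x \<kappa> r r0 by (intro bary_in_mspace node_in weight_nonneg sum_weight) auto
  then have "mdist X (\<Psi> \<kappa> r x) (\<Psi> \<kappa> r' x') \<le> mdist X (\<Psi> \<kappa> r x) ?M + mdist X ?M (\<Psi> \<kappa> r' x')"
    using \<Psi>_in x \<kappa> r r0 by (intro mdist_triangle) auto
  moreover have "mdist X (\<Psi> \<kappa> r x) ?M \<le> \<kappa> * (l * sqrt ((r' - r)\<^sup>2 + (cos \<mu> * (x' - x))\<^sup>2))"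
    unfolding \<Psi>_def by (rule bary_weight_le[OF \<kappa> x(1) r])
  moreover have "mdist X ?M (\<Psi> \<kappa> r' x') \<le> (1 - \<kappa>) * (l * \<bar>x' - x\<bar>)"
  proof -
    have "mdist X ?M (\<Psi> \<kappa> r' x') \<le> (\<Sum>j\<in>{..N}. weight \<kappa> r' x' j * mdist X (node x j) (node x' j))"
      unfolding \<Psi>_def using x \<kappa> r r0 by (intro mdist_bary_le node_in weight_nonneg sum_weight) auto
    also have "\<dots> = (1 - \<kappa>) * mdist X (\<gamma> x) (\<gamma> x')"
      using \<gamma>_in node_angle_in by (simp add: sum_atMost_N weight_def node_def mdist_self)
    also have "\<dots> \<le> (1 - \<kappa>) * (l * \<bar>x' - x\<bar>)"
      using \<gamma>_Lip[OF x] \<kappa> by (intro mult_left_mono) (auto simp: abs_minus_commute)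
    finally show ?thesis .
  qed
  ultimately show ?thesis by linarith
qed

text \<open>\<open>l * \<beta>\<close> bounds the cost of gathering the averaged kernel of an
  equator point at that point: the uniform part, of mass \<open>1 - \<tau>\<close>, travels at most
  \<open>2 * pi * l\<close> and the rest at most \<open>l * h\<close>. Taking \<open>\<beta>\<close>
  as the width of the collar makes the collar \<open>l\<close>-Lipschitz across.\<close>

definition \<beta> :: real where "\<beta> = 2 * pi * (1 - \<tau>) + h"

lemma \<beta>_pos: "0 < \<beta>"
  using h_pos \<tau> by (auto simp: \<beta>_def intro!: add_nonneg_pos)

lemma wt_0_cost_le:
  assumes x: "x \<in> {0..2 * pi}"
  shows "(\<Sum>j<N. wt 0 x j * mdist X (\<gamma> x) (\<gamma> (h * j))) \<le> l * \<beta>"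
proof -
  define v where "v = (\<lambda>j :: nat. (2 * h\<^sup>2 - (hemi_pot 0 (h * j - x + h) - 2 * hemi_pot 0 (h * j - x) + hemi_pot 0 (h * j - x - h))) / (4 * pi * h))"
  have wt: "wt 0 x j = (1 - \<tau>) / N + \<tau> * v j" for j unfolding wt_eq_mix v_def by simp
  have v0: "0 \<le> v j" for j
    using hemi_pot_second_difference_le[of 0 "h * j - x" h] h_pos by (auto simp: v_def intro!: divide_nonneg_pos)
  have sv: "\<tau> * (\<Sum>j<N. v j) = \<tau>"
    using sum_wt[of 0 x] N by (simp add: wt sum.distrib flip: sum_distrib_left)
  have far: "mdist X (\<gamma> x) (\<gamma> (h * j)) \<le> l * (2 * pi)" if "j < N" for j
  proof -
    have "mdist X (\<gamma> x) (\<gamma> (h * j)) \<le> l * \<bar>x - h * j\<bar>"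
      using x node_angle_in[of j] that by (intro \<gamma>_Lip) auto
    also have "\<dots> \<le> l * (2 * pi)" using x node_angle_in[of j] that l by (intro mult_left_mono) auto
    finally show ?thesis .
  qed
  have near: "v j * mdist X (\<gamma> x) (\<gamma> (h * j)) \<le> v j * (l * h)" if j: "j < N" for j
  proof -
    define u where "u = h * j - x"
    \<comment> \<open>A second difference that does not straddle the corner sees a single parabola
      and cancels \<open>2 * h\<^sup>2\<close>.\<close>
    have z1: "v j = 0" if "0 \<le> u - h" "u + h \<le> 2 * pi"
    proof -
      have "hemi_pot 0 (u + h) = (u + h - pi)\<^sup>2" "hemi_pot 0 u = (u - pi)\<^sup>2" "hemi_pot 0 (u - h) = (u - h - pi)\<^sup>2"
        using that h_pos by (auto intro!: hemi_pot_0(1))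
      then show ?thesis unfolding v_def u_def[symmetric] by (simp add: power2_eq_square algebra_simps)
    qed
    have z2: "v j = 0" if "- (2 * pi) \<le> u - h" "u + h \<le> 0"
    proof -
      have "hemi_pot 0 (u + h) = (u + h + pi)\<^sup>2" "hemi_pot 0 u = (u + pi)\<^sup>2" "hemi_pot 0 (u - h) = (u - h + pi)\<^sup>2"
        using that h_pos by (auto intro!: hemi_pot_0(2))
      then show ?thesis unfolding v_def u_def[symmetric] by (simp add: power2_eq_square algebra_simps)
    qed
    have hj: "0 \<le> h * j" "h * j \<le> 2 * pi" "h * j + h \<le> 2 * pi"
      using node_angle_in[of j] node_angle_in[of "Suc j"] j by (auto simp: algebra_simps)
    \<comment> \<open>The node \<open>j = 0\<close> also stands for the angle \<open>2 * pi\<close>.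
      In the last case \<open>x\<close> is close to that angle, and \<open>\<gamma>_closed\<close>
      makes the node a near one.\<close>
    consider "\<bar>u\<bar> < h" | "h \<le> u" | "u \<le> - h" "0 < j" | "u \<le> - h" "j = 0" "x \<le> 2 * pi - h" | "j = 0" "2 * pi - h < x"
      by linarith
    then show ?thesis
    proof cases
      case 1
      have "mdist X (\<gamma> x) (\<gamma> (h * j)) \<le> l * \<bar>x - h * j\<bar>"
        using x node_angle_in[of j] j by (intro \<gamma>_Lip) auto
      also have "\<dots> \<le> l * h" using 1 l by (intro mult_left_mono) (auto simp: u_def)
      finally show ?thesis using v0 by (intro mult_left_mono)
    next
      case 2
      then have "v j = 0" using hj x by (intro z1) (auto simp: u_def)
      then show ?thesis by simp
    next
      case 3
      have "1 \<le> real j" using 3 by simp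
      then have "h * 1 \<le> h * j" using h_pos by (intro mult_left_mono) auto
      then have "- (2 * pi) \<le> u - h" using x unfolding u_def by simp
      then have "v j = 0" using 3 by (intro z2) auto
      then show ?thesis by simp
    next
      case 4
      then have "v j = 0" by (intro z2) (auto simp: u_def)
      then show ?thesis by simp
    next
      case 5
      have "mdist X (\<gamma> x) (\<gamma> (h * j)) = mdist X (\<gamma> x) (\<gamma> (2 * pi))" using 5 \<gamma>_closed by simp
      also have "\<dots> \<le> l * \<bar>x - 2 * pi\<bar>" using x by (intro \<gamma>_Lip) auto
      also have "\<dots> \<le> l * h" using 5 l x by (intro mult_left_mono) auto
      finally show ?thesis using v0 by (intro mult_left_mono)
    qed
  qed
  have "(\<Sum>j<N. wt 0 x j * mdist X (\<gamma> x) (\<gamma> (h * j))) \<le> (\<Sum>j<N. (1 - \<tau>) / N * (l * (2 * pi)) + \<tau> * (v j * (l * h)))"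
  proof (rule sum_mono)
    fix j assume "j \<in> {..<N}"
    then have j: "j < N" by simp
    have "wt 0 x j * mdist X (\<gamma> x) (\<gamma> (h * j)) =
        (1 - \<tau>) / N * mdist X (\<gamma> x) (\<gamma> (h * j)) + \<tau> * (v j * mdist X (\<gamma> x) (\<gamma> (h * j)))"
      by (simp add: wt distrib_right)
    also have "\<dots> \<le> (1 - \<tau>) / N * (l * (2 * pi)) + \<tau> * (v j * (l * h))"
      using \<tau> by (intro add_mono mult_left_mono[OF far[OF j]] mult_left_mono[OF near[OF j]]) auto
    finally show "wt 0 x j * mdist X (\<gamma> x) (\<gamma> (h * j)) \<le> (1 - \<tau>) / N * (l * (2 * pi)) + \<tau> * (v j * (l * h))" .
  qed
  also have "\<dots> = (1 - \<tau>) * (l * (2 * pi)) + \<tau> * (\<Sum>j<N. v j) * (l * h)"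
    using N by (simp add: sum.distrib mult.assoc flip: sum_distrib_left sum_distrib_right)
  also have "\<dots> = (1 - \<tau>) * (l * (2 * pi)) + \<tau> * (l * h)" unfolding sv ..
  also have "\<dots> \<le> (1 - \<tau>) * (l * (2 * pi)) + 1 * (l * h)"
    using \<tau> l h_pos by (intro add_left_mono mult_right_mono) auto
  also have "\<dots> = l * \<beta>" by (simp add: \<beta>_def algebra_simps)
  finally show ?thesis .
qed

text \<open>Raising \<open>\<kappa>\<close> to \<open>\<kappa>'\<close> moves the mass
  \<open>\<kappa>' - \<kappa>\<close> from the atom on the curve to the nodes, in proportion to
  \<open>wt 0 x\<close>. The copy \<open>s = 1\<close> of each index is this moving mass, the copy
  \<open>s = 0\<close> stays.\<close>

lemma \<Psi>_\<kappa>_le: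
  assumes \<kappa>: "0 \<le> \<kappa>" "\<kappa> \<le> \<kappa>'" "\<kappa>' \<le> 1" and x: "x \<in> {0..2 * pi}"
  shows "mdist X (\<Psi> \<kappa> 0 x) (\<Psi> \<kappa>' 0 x) \<le> (\<kappa>' - \<kappa>) * (l * \<beta>)"
proof -
  define I where "I = {..N} \<times> {0, 1 :: nat}"
  define p where "p = (\<lambda>(j, s :: nat). if s = 0 then (if j < N then \<kappa> * wt 0 x j else 1 - \<kappa>')
    else (if j < N then (\<kappa>' - \<kappa>) * wt 0 x j else 0))"
  define y where "y = (\<lambda>(j, s :: nat). if s = 0 then node x j else \<gamma> x)"
  define z where "z = (\<lambda>(j, s :: nat). node x j)"
  have fin: "finite I" by (simp add: I_def)
  have sumI: "(\<Sum>k\<in>I. g k) = (\<Sum>j\<le>N. g (j, 0) + g (j, 1))" for g :: "_ \<Rightarrow> real"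
  proof -
    have "(\<Sum>k\<in>I. g k) = (\<Sum>j\<in>{..N}. \<Sum>s\<in>{0, 1}. g (j, s))"
      by (subst sum.cartesian_product) (simp add: I_def)
    then show ?thesis by simp
  qed
  have p0: "0 \<le> p k" if "k \<in> I" for k
    using that \<kappa> less_imp_le[OF wt_pos[of 0 x]] by (auto simp: I_def p_def intro!: mult_nonneg_nonneg)
  have yz: "y \<in> I \<rightarrow> mspace X" "z \<in> I \<rightarrow> mspace X"
    using node_in[OF x] \<gamma>_in[OF x] by (auto simp: y_def z_def I_def)
  have left: "(\<Sum>j\<in>{..N}. weight \<kappa> 0 x j * f (node x j)) = (\<Sum>k\<in>I. p k * f (y k))" for f :: "'a \<Rightarrow> real"
  proof -
    have "(\<Sum>k\<in>I. p k * f (y k)) = (\<Sum>j<N. \<kappa> * wt 0 x j * f (node x j)) + (\<Sum>j<N. (\<kappa>' - \<kappa>) * wt 0 x j) * f (\<gamma> x) + (1 - \<kappa>') * f (\<gamma> x)"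
      by (simp add: sumI sum_atMost_N p_def y_def sum.distrib sum_distrib_right node_def)
    also have "(\<Sum>j<N. (\<kappa>' - \<kappa>) * wt 0 x j) = \<kappa>' - \<kappa>"
      using sum_wt[of 0 x] by (simp flip: sum_distrib_left)
    finally show ?thesis by (simp add: sum_atMost_N weight_def node_def algebra_simps)
  qed
  have right: "(\<Sum>j\<in>{..N}. weight \<kappa>' 0 x j * f (node x j)) = (\<Sum>k\<in>I. p k * f (z k))" for f :: "'a \<Rightarrow> real"
    by (simp add: sumI sum_atMost_N p_def z_def weight_def node_def algebra_simps)
  have "\<Psi> \<kappa> 0 x = bary I p y"
    unfolding \<Psi>_def bary_def using node_in[OF x] fin yz p0 left \<kappa> weight_nonneg
    by (intro arg_cong[of _ _ b] atomic_measure_eqI) auto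
  moreover have "\<Psi> \<kappa>' 0 x = bary I p z"
    unfolding \<Psi>_def bary_def using node_in[OF x] fin yz p0 right \<kappa> weight_nonneg
    by (intro arg_cong[of _ _ b] atomic_measure_eqI) auto
  moreover have "(\<Sum>k\<in>I. p k) = 1" using left[of "\<lambda>_. 1"] sum_weight[of \<kappa> 0 x] by simp
  ultimately have "mdist X (\<Psi> \<kappa> 0 x) (\<Psi> \<kappa>' 0 x) \<le> (\<Sum>k\<in>I. p k * mdist X (y k) (z k))"
    using mdist_bary_le[OF fin yz p0] by simp
  also have "\<dots> = (\<Sum>j<N. (\<kappa>' - \<kappa>) * wt 0 x j * mdist X (\<gamma> x) (\<gamma> (h * j)))"
    using \<gamma>_in[OF x] \<gamma>_in[OF node_angle_in] by (simp add: sumI sum_atMost_N p_def y_def z_def node_def mdist_self)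
  also have "\<dots> = (\<kappa>' - \<kappa>) * (\<Sum>j<N. wt 0 x j * mdist X (\<gamma> x) (\<gamma> (h * j)))"
    by (simp add: sum_distrib_left mult.assoc)
  also have "\<dots> \<le> (\<kappa>' - \<kappa>) * (l * \<beta>)"
    using wt_0_cost_le[OF x] \<kappa> by (intro mult_left_mono) auto
  finally show ?thesis .
qed

text \<open>The collar is \<open>- \<beta> \<le> s \<le> 0\<close>; for \<open>s \<ge> 0\<close> the parameter is the height above the equator.\<close>

definition \<Phi> :: "real \<Rightarrow> real \<Rightarrow> 'a" where
  "\<Phi> s x = \<Psi> (min 1 (1 + s / \<beta>)) (max 0 s) x"

lemma \<kappa>_bounds: "- \<beta> \<le> s \<Longrightarrow> 0 \<le> min 1 (1 + s / \<beta>) \<and> min 1 (1 + s / \<beta>) \<le> 1"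
  using \<beta>_pos by (simp add: field_simps)

lemma \<Phi>_in: "- \<beta> \<le> s \<Longrightarrow> s \<le> pi / 2 \<Longrightarrow> x \<in> {0..2 * pi} \<Longrightarrow> \<Phi> s x \<in> mspace X"
  unfolding \<Phi>_def using \<kappa>_bounds by (intro \<Psi>_in) auto

lemma \<Phi>_boundary: "x \<in> {0..2 * pi} \<Longrightarrow> \<Phi> (- \<beta>) x = \<gamma> x"
  unfolding \<Phi>_def \<Psi>_def using \<beta>_pos \<gamma>_in node_in sum_weight[of 0 0 x] weight_nonneg[of 0 0 x]
  by (intro bary_const) (auto simp: weight_def node_def)

lemma \<Phi>_closed: "\<Phi> s (2 * pi) = \<Phi> s 0"
proof -
  have "weight \<kappa> r (2 * pi) = weight \<kappa> r 0" for \<kappa> r using wt_periodic[of r 0] by (auto simp: weight_def fun_eq_iff)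
  moreover have "node (2 * pi) = node 0" by (auto simp: node_def fun_eq_iff \<gamma>_closed)
  ultimately show ?thesis by (simp add: \<Phi>_def \<Psi>_def)
qed

lemma \<Phi>_hemisphere_le:
  assumes x: "x \<in> {0..2 * pi}" "x' \<in> {0..2 * pi}"
    and s: "0 \<le> \<mu>" "\<mu> \<le> s" "\<mu> \<le> s'" "s \<le> pi / 2" "s' \<le> pi / 2"
  shows "mdist X (\<Phi> s x) (\<Phi> s' x') \<le> l * sqrt ((s' - s)\<^sup>2 + (cos \<mu> * (x' - x))\<^sup>2)"
proof -
  have "0 \<le> s / \<beta>" "0 \<le> s' / \<beta>" using s \<beta>_pos by auto
  then show ?thesis
    unfolding \<Phi>_def using \<Psi>_x_le[of 1 x x' \<mu> s s'] x s by (simp add: max_absorb2)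
qed

text \<open>The collar is compared with a flat cylinder in the sum metric. Around it, the bounds for
  the kernel and for the atom on the curve enter with weights \<open>\<kappa>\<close> and
  \<open>1 - \<kappa>\<close> and add up to \<open>l\<close>; across it, the choice of
  \<open>\<beta>\<close> gives \<open>l\<close>.\<close>

lemma \<Phi>_collar_le:
  assumes x: "x \<in> {0..2 * pi}" "x' \<in> {0..2 * pi}"
    and s: "- \<beta> \<le> s" "s \<le> 0" "- \<beta> \<le> s'" "s' \<le> 0"
  shows "mdist X (\<Phi> s x) (\<Phi> s' x') \<le> l * (\<bar>s' - s\<bar> + \<bar>x' - x\<bar>)"
proof -
  have \<Phi>: "\<Phi> t y = \<Psi> (1 + t / \<beta>) 0 y" and t: "0 \<le> 1 + t / \<beta>" "1 + t / \<beta> \<le> 1" if "- \<beta> \<le> t" "t \<le> 0" for t y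
    using that \<beta>_pos by (auto simp: \<Phi>_def min_def field_simps)
  have 1: "mdist X (\<Phi> s x) (\<Phi> s' x) \<le> l * \<bar>s' - s\<bar>"
  proof -
    have le: "mdist X (\<Phi> t x) (\<Phi> t' x) \<le> l * (t' - t)" if t': "- \<beta> \<le> t" "t \<le> t'" "t' \<le> 0" for t t'
    proof -
      have "mdist X (\<Phi> t x) (\<Phi> t' x) \<le> ((1 + t' / \<beta>) - (1 + t / \<beta>)) * (l * \<beta>)"
        using t' \<beta>_pos t[of t] t[of t'] x unfolding \<Phi>[OF t'(1) order_trans[OF t'(2,3)]] \<Phi>[OF order_trans[OF t'(1,2)] t'(3)]
        by (intro \<Psi>_\<kappa>_le) (auto simp: divide_right_mono)
      also have "\<dots> = l * (t' - t)" using \<beta>_pos by (simp add: field_simps)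
      finally show ?thesis .
    qed
    show ?thesis using le[of s s'] le[of s' s] s by (cases "s \<le> s'") (auto simp: mdist_commute)
  qed
  have 2: "mdist X (\<Phi> s' x) (\<Phi> s' x') \<le> l * \<bar>x' - x\<bar>"
  proof -
    have "mdist X (\<Phi> s' x) (\<Phi> s' x') \<le> (1 + s' / \<beta>) * (l * \<bar>x' - x\<bar>) + (1 - (1 + s' / \<beta>)) * (l * \<bar>x' - x\<bar>)"
      unfolding \<Phi>[OF s(3,4)] using \<Psi>_x_le[OF t[OF s(3,4)] x, of 0 0 0] by simp
    then show ?thesis by (simp add: algebra_simps)
  qed
  have "mdist X (\<Phi> s x) (\<Phi> s' x') \<le> mdist X (\<Phi> s x) (\<Phi> s' x) + mdist X (\<Phi> s' x) (\<Phi> s' x')"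
    using \<Phi>_in s x by (intro mdist_triangle) auto
  then show ?thesis using 1 2 by (simp add: distrib_left)
qed

lemma \<Phi>_radial_le:
  assumes x: "x \<in> {0..2 * pi}" and s: "- \<beta> \<le> s" "s \<le> pi / 2" "- \<beta> \<le> s'" "s' \<le> pi / 2"
  shows "mdist X (\<Phi> s x) (\<Phi> s' x) \<le> l * \<bar>s' - s\<bar>"
proof -
  have le: "mdist X (\<Phi> s x) (\<Phi> s' x) \<le> l * (s' - s)" if s: "- \<beta> \<le> s" "s \<le> s'" "s' \<le> pi / 2" for s s'
  proof -
    consider "0 \<le> s" | "s' \<le> 0" | "s \<le> 0" "0 \<le> s'" by linarith
    then show ?thesis
    proof cases
      case 1
      then show ?thesis using \<Phi>_hemisphere_le[OF x x, of 0 s s'] s by simp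
    next
      case 2
      then show ?thesis using \<Phi>_collar_le[OF x x, of s s'] s by simp
    next
      case 3
      have "mdist X (\<Phi> s x) (\<Phi> s' x) \<le> mdist X (\<Phi> s x) (\<Phi> 0 x) + mdist X (\<Phi> 0 x) (\<Phi> s' x)"
        using \<Phi>_in s x 3 \<beta>_pos by (intro mdist_triangle) auto
      moreover have "mdist X (\<Phi> s x) (\<Phi> 0 x) \<le> l * (0 - s)"
        using \<Phi>_collar_le[OF x x, of s 0] s 3 \<beta>_pos by simp
      moreover have "mdist X (\<Phi> 0 x) (\<Phi> s' x) \<le> l * (s' - 0)"
        using \<Phi>_hemisphere_le[OF x x, of 0 0 s'] s 3 by simp
      ultimately show ?thesis by (simp add: algebra_simps)
    qed
  qed
  show ?thesis using le[of s s'] le[of s' s] s by (cases "s \<le> s'") (auto simp: mdist_commute)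
qed

lemma \<Phi>_angular_le:
  assumes x: "x \<in> {0..2 * pi}" "x' \<in> {0..2 * pi}" and s: "- \<beta> \<le> s" "s \<le> pi / 2"
  shows "mdist X (\<Phi> s x) (\<Phi> s x') \<le> l * (cos (max 0 s) * \<bar>x' - x\<bar>)"
proof (cases "0 \<le> s")
  case True
  moreover have "0 \<le> cos s" using True s by (intro cos_ge_zero) auto
  ultimately show ?thesis
    using \<Phi>_hemisphere_le[OF x, of s s s] s by (simp add: max_absorb2 abs_mult)
next
  case False
  then show ?thesis using \<Phi>_collar_le[OF x, of s s] s by (simp add: max_absorb1)
qed

end

section \<open>Polar coordinates in the disc\<close>

definition polar :: "real \<Rightarrow> real \<Rightarrow> real^2" where
  "polar \<rho> t = vector [\<rho> * cos t, \<rho> * sin t]"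

definition ang :: "real^2 \<Rightarrow> real" where
  "ang z = Arg2pi (Complex (z $ 1) (z $ 2))"

lemma polar_nth [simp]: "polar \<rho> t $ 1 = \<rho> * cos t" "polar \<rho> t $ 2 = \<rho> * sin t"
  by (simp_all add: polar_def)

lemma ang_bounds: "0 \<le> ang z" "ang z < 2 * pi"
  using Arg2pi[of "Complex (z $ 1) (z $ 2)"] by (auto simp: ang_def)

lemma norm_real2: "norm (z :: real^2) = sqrt ((z $ 1)\<^sup>2 + (z $ 2)\<^sup>2)"
  by (simp add: norm_vec_def L2_set_def sum_2)

lemma polar_norm_ang: "polar (norm z) (ang z) = z"
proof -
  let ?w = "Complex (z $ 1) (z $ 2)"
  have "norm z = cmod ?w" by (simp add: norm_real2 cmod_def)
  moreover have "cmod ?w * cos (ang z) = z $ 1" "cmod ?w * sin (ang z) = z $ 2"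
    using cos_Arg2pi[of ?w] sin_Arg2pi[of ?w] by (simp_all add: ang_def)
  ultimately show ?thesis by (simp add: vec_eq_iff forall_2)
qed

lemma norm_polar: "norm (polar \<rho> t) = \<bar>\<rho>\<bar>"
proof -
  have "(\<rho> * cos t)\<^sup>2 + (\<rho> * sin t)\<^sup>2 = \<rho>\<^sup>2" using sin_cos_squared_add[of t] by algebra
  then show ?thesis by (simp add: norm_real2)
qed

lemma ang_polar: "0 < \<rho> \<Longrightarrow> 0 \<le> t \<Longrightarrow> t < 2 * pi \<Longrightarrow> ang (polar \<rho> t) = t"
  unfolding ang_def by (rule Arg2pi_unique[of \<rho>]) (auto simp: complex_eq_iff cis_conv_exp[symmetric])

lemma polar_minus_2pi: "polar \<rho> (t - 2 * pi) = polar \<rho> t"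
  by (simp add: polar_def cos_diff sin_diff)

text \<open>Jordan's inequality: a concave function lies above its chord.\<close>

lemma sin_ge_chord:
  assumes "0 \<le> y" "y \<le> pi / 2"
  shows "2 / pi * y \<le> sin y"
proof -
  have "concave_on {0..pi / 2} sin"
    by (rule f''_le0_imp_concave[where f' = cos and f'' = "\<lambda>x. - sin x"])
      (auto intro!: derivative_eq_intros sin_ge_zero)
  then have "(1 - t) * sin 0 + t * sin (pi / 2) \<le> sin ((1 - t) *\<^sub>R 0 + t *\<^sub>R (pi / 2))" if "0 \<le> t" "t \<le> 1" for t
    using that by (intro concave_onD[where A = "{0..pi / 2}"]) auto
  from this[of "2 / pi * y"] show ?thesis using assms by (simp add: field_simps)
qed

lemma dist_polar_sq: "(dist (polar \<rho> t) (polar \<rho>' t'))\<^sup>2 = (\<rho> - \<rho>')\<^sup>2 + 4 * \<rho> * \<rho>' * (sin ((t - t') / 2))\<^sup>2"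
proof -
  have "(dist (polar \<rho> t) (polar \<rho>' t'))\<^sup>2 = (\<rho> * cos t - \<rho>' * cos t')\<^sup>2 + (\<rho> * sin t - \<rho>' * sin t')\<^sup>2"
    by (simp add: dist_norm norm_real2)
  also have "\<dots> = (\<rho> - \<rho>')\<^sup>2 + 2 * \<rho> * \<rho>' * (1 - cos (t - t'))"
    unfolding cos_diff using sin_cos_squared_add[of t] sin_cos_squared_add[of t'] by algebra
  also have "1 - cos (t - t') = 2 * (sin ((t - t') / 2))\<^sup>2"
  proof -
    have "2 * ((t - t') / 2) = t - t'" by simp
    then show ?thesis using cos_double_sin[of "(t - t') / 2"] by (simp only:)
  qed
  finally show ?thesis by simp
qed

text \<open>Jordan's inequality for half the angle. Angles that differ by more than
  \<open>pi\<close> are shifted by \<open>2 * pi\<close> before use.\<close>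

lemma dist_polar_ge_angular:
  assumes m: "0 \<le> m" "m \<le> \<rho>" "m \<le> \<rho>'" and t: "\<bar>t - t'\<bar> \<le> pi"
  shows "m * \<bar>t - t'\<bar> \<le> pi / 2 * dist (polar \<rho> t) (polar \<rho>' t')"
proof -
  define y where "y = \<bar>t - t'\<bar> / 2"
  have y: "0 \<le> y" "y \<le> pi / 2" using t by (auto simp: y_def)
  have "(2 / pi * y)\<^sup>2 \<le> (sin y)\<^sup>2" using y by (intro power_mono sin_ge_chord) auto
  also have "\<dots> = (sin ((t - t') / 2))\<^sup>2" 
  proof (cases "t' \<le> t")
    case False
    then have "y = - ((t - t') / 2)" unfolding y_def by linarith
    then show ?thesis by (simp only: sin_minus power2_minus)
  qed (simp add: y_def)
  finally have 1: "(2 / pi * y)\<^sup>2 \<le> (sin ((t - t') / 2))\<^sup>2" .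
  have "(m * (4 / pi * y))\<^sup>2 = 4 * m * m * (2 / pi * y)\<^sup>2" by (simp add: power2_eq_square)
  also have "\<dots> \<le> 4 * \<rho> * \<rho>' * (sin ((t - t') / 2))\<^sup>2"
    using m 1 by (intro mult_mono) auto
  also have "\<dots> \<le> (dist (polar \<rho> t) (polar \<rho>' t'))\<^sup>2" by (simp add: dist_polar_sq)
  finally have "m * (4 / pi * y) \<le> dist (polar \<rho> t) (polar \<rho>' t')" by (rule power2_le_imp_le) simp
  then have "pi / 2 * (m * (4 / pi * y)) \<le> pi / 2 * dist (polar \<rho> t) (polar \<rho>' t')" by (intro mult_left_mono) auto
  moreover have "pi / 2 * (m * (4 / pi * y)) = m * \<bar>t - t'\<bar>" by (simp add: y_def)
  ultimately show ?thesis by (simp only:)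
qed

lemma dist_polar_le:
  assumes "0 \<le> \<rho>" "0 \<le> \<rho>'" "\<rho> \<le> 1" "\<rho>' \<le> 1"
  shows "dist (polar \<rho> t) (polar \<rho>' t') \<le> \<bar>\<rho> - \<rho>'\<bar> + \<bar>t - t'\<bar>"
proof (rule power2_le_imp_le)
  have "4 * \<rho> * \<rho>' * (sin ((t - t') / 2))\<^sup>2 \<le> 4 * 1 * 1 * (\<bar>t - t'\<bar> / 2)\<^sup>2"
  proof (intro mult_mono)
    show "(sin ((t - t') / 2))\<^sup>2 \<le> (\<bar>t - t'\<bar> / 2)\<^sup>2"
    proof -
      have "\<bar>sin ((t - t') / 2)\<bar>\<^sup>2 \<le> (\<bar>t - t'\<bar> / 2)\<^sup>2"
        using abs_sin_x_le_abs_x[of "(t - t') / 2"] by (intro power_mono) auto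
      then show ?thesis by simp
    qed
  qed (use assms in auto)
  also have "4 * 1 * 1 * (\<bar>t - t'\<bar> / 2)\<^sup>2 = (t - t')\<^sup>2" by (simp add: power_divide)
  finally have 1: "4 * \<rho> * \<rho>' * (sin ((t - t') / 2))\<^sup>2 \<le> (t - t')\<^sup>2" .
  have 2: "0 \<le> 2 * \<bar>\<rho> - \<rho>'\<bar> * \<bar>t - t'\<bar>" by simp
  show "(dist (polar \<rho> t) (polar \<rho>' t'))\<^sup>2 \<le> (\<bar>\<rho> - \<rho>'\<bar> + \<bar>t - t'\<bar>)\<^sup>2"
    unfolding dist_polar_sq power2_sum power2_abs using 1 2 by linarith
qed simp

lemma ang_borel_measurable: "ang \<in> borel_measurable borel"
proof -
  have A: "Arg2pi \<in> borel_measurable borel"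
    using closed_Arg2pi2pi_le by (auto simp: borel_measurable_iff_le intro: borel_closed)
  have C: "(\<lambda>z :: real^2. Complex (z $ 1) (z $ 2)) \<in> borel_measurable borel"
    unfolding Complex_eq by (intro borel_measurable_continuous_onI continuous_intros)
  show ?thesis unfolding ang_def by (rule measurable_compose[OF C A])
qed

section \<open>Partition points and injections of the plane\<close>

lemma interval_of_increasing:
  fixes e :: "nat \<Rightarrow> real"
  assumes "e 0 \<le> s" "s < e n"
  shows "\<exists>i<n. e i \<le> s \<and> s < e (Suc i)"
  using assms
proof (induction n)
  case (Suc n)
  then show ?case by (cases "s < e n") (auto intro: less_SucI)
qed simp

lemma real_plane_injection:
  obtains g :: "real^2 \<Rightarrow> real" where "inj g"
proof -
  have "infinite (UNIV :: real set)" by (rule infinite_UNIV_char_0)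
  from card_of_ordIso[THEN iffD2, OF card_of_Times_same_infinite[OF this]]
  obtain p :: "real \<times> real \<Rightarrow> real" where "bij_betw p (UNIV \<times> UNIV) UNIV" by auto
  then have "inj p" by (simp add: bij_betw_def)
  then have "inj (\<lambda>z :: real^2. p (z $ 1, z $ 2))"
    by (auto intro!: injI dest: injD simp: vec_eq_iff forall_2)
  then show ?thesis by (rule that)
qed

text \<open>The distance from \<open>c 0\<close> is continuous along the path and takes every value
  in an interval of positive length, so the path has as many points as the plane.\<close>

lemma plane_injection_of_nonconstant_path:
  fixes c :: "real \<Rightarrow> 'a"
  assumes c: "c ` {0..a} \<subseteq> mspace M"
    and Lip: "\<And>x y. x \<in> {0..a} \<Longrightarrow> y \<in> {0..a} \<Longrightarrow> mdist M (c x) (c y) \<le> K * \<bar>x - y\<bar>"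
    and t: "t \<in> {0..a}" "c t \<noteq> c 0"
  obtains j :: "real^2 \<Rightarrow> 'a" where "inj j"
proof -
  define u where "u = (\<lambda>x. mdist M (c 0) (c x))"
  have cM: "c x \<in> mspace M" if "x \<in> {0..a}" for x using c that by auto
  have t0: "0 \<in> {0..a}" using t by auto
  have K: "0 \<le> K * \<bar>x - y\<bar>" if "x \<in> {0..a}" "y \<in> {0..a}" for x y
    using order_trans[OF mdist_nonneg Lip[OF that]] .
  have ul: "\<bar>u x - u y\<bar> \<le> K * \<bar>x - y\<bar>" if xy: "x \<in> {0..a}" "y \<in> {0..a}" for x y
  proof -
    have "u x \<le> u y + mdist M (c x) (c y)" "u y \<le> u x + mdist M (c x) (c y)"
      using mdist_triangle[of "c 0" M "c y" "c x"] mdist_triangle[of "c 0" M "c x" "c y"] cM xy t0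
      by (auto simp: u_def mdist_commute)
    then show ?thesis using Lip[OF xy] by linarith
  qed
  have u0: "u 0 = 0" using cM[OF t0] by (simp add: u_def mdist_self)
  have ut: "0 < u t" using cM[OF t0] cM[OF t(1)] t(2) mdist_nonneg[of M "c 0" "c t"] mdist_zero[of "c 0" M "c t"]
    by (auto simp: u_def less_le)
  have "t \<noteq> 0" using t(2) by auto
  then have "0 < t" using t(1) by auto
  then have "0 \<le> K" using K[OF t(1) t0] by (simp add: zero_le_mult_iff)
  then have cont: "continuous_on {0..t} u"
    using ul t by (intro lipschitz_on_continuous_on[of K] lipschitz_onI) (auto simp: dist_real_def)
  have "\<exists>x\<in>{0..t}. u x = v" if "v \<in> {0..u t}" for v
    using IVT'[of u 0 v t] cont that u0 t by auto
  then obtain x where x: "\<And>v. v \<in> {0..u t} \<Longrightarrow> x v \<in> {0..t} \<and> u (x v) = v" by metis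
  have ij: "inj_on (\<lambda>v. c (x v)) {0..u t}"
    by (rule inj_onI) (metis u_def x)
  have "{0..u t} \<approx> (UNIV :: real set)" using ut by (simp add: closed_interval_eqpoll_reals)
  then obtain k :: "real \<Rightarrow> real" where k: "bij_betw k UNIV {0..u t}"
    using eqpoll_sym eqpoll_def by blast
  obtain g :: "real^2 \<Rightarrow> real" where g: "inj g" by (rule real_plane_injection)
  have "inj (\<lambda>z. c (x (k (g z))))"
    using ij k g by (intro injI) (metis bij_betw_apply bij_betw_imp_inj_on inj_onD injD UNIV_I)
  then show ?thesis by (rule that)
qed

section \<open>Area of the filling\<close>

locale polar_filling = circle_in_barycenter_space X b \<gamma> l N \<tau> + area_functional Area
  for X :: "'a metric" and b \<gamma> l N \<tau>
    and Area :: "'a metric \<Rightarrow> (real^2) set \<Rightarrow> (real^2 \<Rightarrow> 'a) \<Rightarrow> ennreal" +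
  fixes j :: "real^2 \<Rightarrow> 'a" and \<sigma> T :: "real \<Rightarrow> real" and A B :: real
  assumes j: "inj j" and A: "0 \<le> A" and B: "0 \<le> B"
    and \<sigma>_0: "\<sigma> 0 = 0" and \<sigma>_2pi: "\<sigma> (2 * pi) = 2 * pi"
    and \<sigma>_in: "t \<in> {0..2 * pi} \<Longrightarrow> \<sigma> t \<in> {0..2 * pi}"
    and T_in: "x \<in> {0..2 * pi} \<Longrightarrow> T x \<in> {0..2 * pi}"
    and T_\<sigma>: "t \<in> {0..2 * pi} \<Longrightarrow> T (\<sigma> t) = t"
    and \<sigma>_T: "x \<in> {0..2 * pi} \<Longrightarrow> \<sigma> (T x) = x"
    and \<sigma>_strict: "s \<in> {0..2 * pi} \<Longrightarrow> t \<in> {0..2 * pi} \<Longrightarrow> s < t \<Longrightarrow> \<sigma> s < \<sigma> t"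
    and \<sigma>_Lip: "s \<in> {0..2 * pi} \<Longrightarrow> t \<in> {0..2 * pi} \<Longrightarrow> \<bar>\<sigma> s - \<sigma> t\<bar> \<le> A * \<bar>s - t\<bar>"
    and T_Lip: "x \<in> {0..2 * pi} \<Longrightarrow> y \<in> {0..2 * pi} \<Longrightarrow> \<bar>T x - T y\<bar> \<le> B * \<bar>x - y\<bar>"
begin

text \<open>Affine in the radius: the centre of the disc is the pole, the unit circle the outer rim
  of the collar.\<close>

definition lat :: "real \<Rightarrow> real" where "lat \<rho> = pi / 2 - \<rho> * (pi / 2 + \<beta>)"

definition rad :: "real \<Rightarrow> real" where "rad s = (pi / 2 - s) / (pi / 2 + \<beta>)"

definition fill :: "real^2 \<Rightarrow> 'a" where "fill z = \<Phi> (lat (norm z)) (\<sigma> (ang z))"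

lemma H_pos: "0 < pi / 2 + \<beta>"
  using \<beta>_pos by (simp add: add_pos_pos)

lemma lat_bounds: "0 \<le> \<rho> \<Longrightarrow> \<rho> \<le> 1 \<Longrightarrow> - \<beta> \<le> lat \<rho> \<and> lat \<rho> \<le> pi / 2"
proof -
  assume \<rho>: "0 \<le> \<rho>" "\<rho> \<le> 1"
  define p where "p = \<rho> * (pi / 2 + \<beta>)"
  have "p \<le> 1 * (pi / 2 + \<beta>)" unfolding p_def using \<rho> H_pos by (intro mult_right_mono) auto
  moreover have "0 \<le> p" unfolding p_def using \<rho> H_pos by (intro mult_nonneg_nonneg) auto
  ultimately show ?thesis unfolding lat_def p_def[symmetric] by auto
qed

lemma lat_rad: "lat (rad s) = s"
  using H_pos by (simp add: lat_def rad_def)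

lemma rad_lat: "rad (lat \<rho>) = \<rho>"
  using H_pos by (simp add: lat_def rad_def)

lemma lat_diff: "lat \<rho> - lat \<rho>' = (\<rho>' - \<rho>) * (pi / 2 + \<beta>)"
  unfolding lat_def left_diff_distrib by simp

lemma rad_diff: "rad s - rad s' = (s' - s) / (pi / 2 + \<beta>)"
  by (simp add: rad_def flip: diff_divide_distrib)

lemma ang_in: "ang z \<in> {0..2 * pi}"
  using ang_bounds[of z] by auto

lemma \<sigma>_ang_less: "\<sigma> (ang z) < 2 * pi"
  using \<sigma>_strict[of "ang z" "2 * pi"] ang_bounds[of z] by (simp add: \<sigma>_2pi)

lemma le_\<sigma>_iff:
  assumes "x \<in> {0..2 * pi}" "t \<in> {0..2 * pi}"
  shows "x \<le> \<sigma> t \<longleftrightarrow> T x \<le> t"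
  using \<sigma>_strict[of t "T x"] \<sigma>_strict[of "T x" t] \<sigma>_T[of x] T_in[of x] assms
  by (metis less_le not_le)

lemma fill_in: "norm z \<le> 1 \<Longrightarrow> fill z \<in> mspace X"
  unfolding fill_def using lat_bounds[of "norm z"] \<sigma>_in[OF ang_in] by (intro \<Phi>_in) auto

text \<open>The parallels shrink at least linearly towards the pole, which makes \<open>fill\<close>
  Lipschitz at the centre of the disc. In the collar the left side is 1 and the right side exceeds
  \<open>pi / 2\<close>.\<close>

lemma cos_lat_le: "0 \<le> \<rho> \<Longrightarrow> \<rho> \<le> 1 \<Longrightarrow> cos (max 0 (lat \<rho>)) \<le> \<rho> * (pi / 2 + \<beta>)"
proof -
  assume \<rho>: "0 \<le> \<rho>" "\<rho> \<le> 1"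
  have e: "pi / 2 - lat \<rho> = \<rho> * (pi / 2 + \<beta>)" by (simp add: lat_def)
  show ?thesis
  proof (cases "0 \<le> lat \<rho>")
    case True
    have "cos (lat \<rho>) = sin (pi / 2 - lat \<rho>)" by (simp add: sin_diff)
    also have "\<dots> \<le> pi / 2 - lat \<rho>" using lat_bounds[OF \<rho>] by (intro sin_x_le_x) simp
    finally show ?thesis using True e by (simp add: max_absorb2)
  next
    case False
    then have "1 \<le> pi / 2 - lat \<rho>" using pi_gt3 by linarith
    then show ?thesis using False e by (simp add: max_absorb1)
  qed
qed

lemma \<Phi>_\<sigma>_le:
  assumes s: "- \<beta> \<le> s" "s \<le> pi / 2" and t: "t \<in> {0..2 * pi}" "t' \<in> {0..2 * pi}"
  shows "mdist X (\<Phi> s (\<sigma> t)) (\<Phi> s (\<sigma> t')) \<le> l * (cos (max 0 s) * (A * \<bar>t - t'\<bar>))"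
proof -
  have c: "0 \<le> cos (max 0 s)"
    by (rule cos_ge_zero) (use s pi_gt_zero in \<open>auto simp: max_def\<close>)
  have "mdist X (\<Phi> s (\<sigma> t)) (\<Phi> s (\<sigma> t')) \<le> l * (cos (max 0 s) * \<bar>\<sigma> t' - \<sigma> t\<bar>)"
    using \<Phi>_angular_le[OF \<sigma>_in[OF t(1)] \<sigma>_in[OF t(2)] s] .
  also have "\<dots> \<le> l * (cos (max 0 s) * (A * \<bar>t - t'\<bar>))"
    using \<sigma>_Lip[OF t] l c by (intro mult_left_mono) (auto simp: abs_minus_commute)
  finally show ?thesis .
qed

text \<open>The way through the angle \<open>0\<close>, identified with \<open>2 * pi\<close>; it is
  the shorter one when \<open>t'\<close> exceeds \<open>t\<close> by more than
  \<open>pi\<close>.\<close>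

lemma \<Phi>_\<sigma>_around_le:
  assumes s: "- \<beta> \<le> s" "s \<le> pi / 2" and t: "t \<in> {0..2 * pi}" "t' \<in> {0..2 * pi}"
  shows "mdist X (\<Phi> s (\<sigma> t)) (\<Phi> s (\<sigma> t')) \<le> l * (cos (max 0 s) * (A * (t + (2 * pi - t'))))"
proof -
  have in0: "0 \<in> {0..2 * pi}" "2 * pi \<in> {0..2 * pi}" by auto
  have "mdist X (\<Phi> s (\<sigma> t)) (\<Phi> s (\<sigma> t')) \<le> mdist X (\<Phi> s (\<sigma> t)) (\<Phi> s (\<sigma> 0)) + mdist X (\<Phi> s (\<sigma> 0)) (\<Phi> s (\<sigma> t'))"
    using s t in0 \<sigma>_in by (intro mdist_triangle \<Phi>_in) auto
  also have "\<Phi> s (\<sigma> 0) = \<Phi> s (\<sigma> (2 * pi))" by (simp add: \<sigma>_0 \<sigma>_2pi \<Phi>_closed)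
  also have "mdist X (\<Phi> s (\<sigma> t)) (\<Phi> s (\<sigma> (2 * pi))) \<le> l * (cos (max 0 s) * (A * t))"
    using \<Phi>_\<sigma>_le[OF s t(1) in0(1)] t by (simp add: \<sigma>_0 \<sigma>_2pi \<Phi>_closed)
  also have "mdist X (\<Phi> s (\<sigma> (2 * pi))) (\<Phi> s (\<sigma> t')) \<le> l * (cos (max 0 s) * (A * (2 * pi - t')))"
    using \<Phi>_\<sigma>_le[OF s in0(2) t(2)] t by simp
  finally show ?thesis by (simp add: algebra_simps)
qed

text \<open>The angle changes at the smaller radius. The shrinking of the parallels supplies a
  factor \<open>\<rho>'\<close>, and \<open>\<rho>'\<close> times the angle is controlled by the
  distance in the plane.\<close>

lemma fill_angular_le:
  assumes \<rho>: "0 \<le> \<rho>'" "\<rho>' \<le> \<rho>" "\<rho> \<le> 1" and t: "t \<in> {0..2 * pi}" "t' \<in> {0..2 * pi}"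
  shows "mdist X (\<Phi> (lat \<rho>') (\<sigma> t)) (\<Phi> (lat \<rho>') (\<sigma> t'))
    \<le> l * (pi / 2 + \<beta>) * A * (pi / 2) * dist (polar \<rho> t) (polar \<rho>' t')"
proof -
  have \<rho>1: "\<rho>' \<le> 1" using \<rho> by simp
  note s = lat_bounds[OF \<rho>(1) \<rho>1, THEN conjunct1] lat_bounds[OF \<rho>(1) \<rho>1, THEN conjunct2]
  have *: "l * (cos (max 0 (lat \<rho>')) * (A * d)) \<le> l * (pi / 2 + \<beta>) * A * (pi / 2) * dist (polar \<rho> t) (polar \<rho>' t')"
    if d: "0 \<le> d" "\<rho>' * d \<le> pi / 2 * dist (polar \<rho> t) (polar \<rho>' t')" for d
  proof -
    have "l * (cos (max 0 (lat \<rho>')) * (A * d)) \<le> l * (\<rho>' * (pi / 2 + \<beta>) * (A * d))"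
      using cos_lat_le[OF \<rho>(1) \<rho>1] l A d by (intro mult_left_mono mult_right_mono) auto
    also have "\<dots> = l * (pi / 2 + \<beta>) * A * (\<rho>' * d)" by (simp only: mult_ac)
    also have "\<dots> \<le> l * (pi / 2 + \<beta>) * A * (pi / 2 * dist (polar \<rho> t) (polar \<rho>' t'))"
      using l A H_pos d by (intro mult_left_mono) auto
    finally show ?thesis by (simp only: mult_ac)
  qed
  consider "\<bar>t - t'\<bar> \<le> pi" | "pi < t' - t" | "pi < t - t'" by linarith
  then show ?thesis
  proof cases
    case 1
    show ?thesis
      using order_trans[OF \<Phi>_\<sigma>_le[OF s t] *] dist_polar_ge_angular[OF \<rho>(1,2) order_refl 1] by simp
  next
    case 2
    have "\<rho>' * \<bar>t - (t' - 2 * pi)\<bar> \<le> pi / 2 * dist (polar \<rho> t) (polar \<rho>' (t' - 2 * pi))"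
      using 2 t by (intro dist_polar_ge_angular[OF \<rho>(1,2) order_refl]) auto
    moreover have "\<bar>t - (t' - 2 * pi)\<bar> = t + (2 * pi - t')" using t by auto
    ultimately show ?thesis
      using order_trans[OF \<Phi>_\<sigma>_around_le[OF s t] *] t by (simp add: polar_minus_2pi)
  next
    case 3
    have "\<rho>' * \<bar>(t - 2 * pi) - t'\<bar> \<le> pi / 2 * dist (polar \<rho> (t - 2 * pi)) (polar \<rho>' t')"
      using 3 t by (intro dist_polar_ge_angular[OF \<rho>(1,2) order_refl]) auto
    moreover have "\<bar>(t - 2 * pi) - t'\<bar> = t' + (2 * pi - t)" using t by auto
    ultimately show ?thesis
      using order_trans[OF \<Phi>_\<sigma>_around_le[OF s t(2,1)] *] t by (simp add: polar_minus_2pi mdist_commute)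
  qed
qed

text \<open>A crude Lipschitz constant: a radial move followed by an angular one. Its size is
  harmless, since in the area estimate it multiplies only the area of a shrinking square at the
  centre.\<close>

definition Lf :: real where "Lf = l * (pi / 2 + \<beta>) + l * (pi / 2 + \<beta>) * A * (pi / 2)"

lemma Lf_nonneg: "0 \<le> Lf"
  using l A H_pos by (auto simp: Lf_def intro!: add_nonneg_nonneg mult_nonneg_nonneg)

lemma fill_Lip:
  assumes "norm z \<le> 1" "norm z' \<le> 1"
  shows "mdist X (fill z) (fill z') \<le> Lf * dist z z'"
proof -
  have le: "mdist X (fill z) (fill z') \<le> Lf * dist z z'" if z: "norm z' \<le> norm z" "norm z \<le> 1" for z z'
  proof -
    let ?M = "\<Phi> (lat (norm z')) (\<sigma> (ang z))"
    have b: "- \<beta> \<le> lat (norm z) \<and> lat (norm z) \<le> pi / 2" "- \<beta> \<le> lat (norm z') \<and> lat (norm z') \<le> pi / 2"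
      using lat_bounds[of "norm z"] lat_bounds[of "norm z'"] z by auto
    have "mdist X (fill z) (fill z') \<le> mdist X (fill z) ?M + mdist X ?M (fill z')"
      using z b \<sigma>_in[OF ang_in] by (intro mdist_triangle fill_in \<Phi>_in) auto
    moreover have "mdist X (fill z) ?M \<le> l * \<bar>lat (norm z') - lat (norm z)\<bar>"
      unfolding fill_def using b \<sigma>_in[OF ang_in] by (intro \<Phi>_radial_le) auto
    moreover have "\<dots> \<le> l * (pi / 2 + \<beta>) * dist z z'"
    proof -
      have "\<bar>lat (norm z') - lat (norm z)\<bar> = \<bar>norm z - norm z'\<bar> * (pi / 2 + \<beta>)"
        unfolding lat_diff using H_pos by (simp add: abs_mult)
      also have "\<dots> \<le> dist z z' * (pi / 2 + \<beta>)"
        using H_pos norm_triangle_ineq3[of z z'] by (intro mult_right_mono) (auto simp: dist_norm)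
      finally have "l * \<bar>lat (norm z') - lat (norm z)\<bar> \<le> l * (dist z z' * (pi / 2 + \<beta>))"
        using l by (intro mult_left_mono) auto
      then show ?thesis by (simp only: mult_ac)
    qed
    moreover have "mdist X ?M (fill z') \<le> l * (pi / 2 + \<beta>) * A * (pi / 2) * dist z z'"
      using fill_angular_le[OF norm_ge_zero z ang_in ang_in, of z z'] by (simp add: fill_def polar_norm_ang)
    ultimately show ?thesis unfolding Lf_def distrib_right by linarith
  qed
  show ?thesis using le[of z' z] le[of z z'] assms by (cases "norm z' \<le> norm z") (auto simp: mdist_commute dist_commute)
qed

lemma fill_lipschitz_from: "E \<subseteq> cball 0 1 \<Longrightarrow> lipschitz_from E X fill"
  using fill_in fill_Lip unfolding lipschitz_from_def Lipschitz_continuous_map_def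
  by (fastforce intro!: exI[of _ Lf])

lemma fill_boundary:
  assumes "norm z = 1"
  shows "fill z = \<gamma> (\<sigma> (ang z))"
  using \<Phi>_boundary[OF \<sigma>_in[OF ang_in[of z]]] assms by (simp add: fill_def lat_def)

text \<open>\<open>sigma_additivity\<close> applied to empty pieces leaves both \<open>0\<close> and
  \<open>\<infinity>\<close> possible; comparison with a constant map decides.\<close>

lemma Area_empty: "Area X {} f = 0"
proof -
  have "fill 0 \<in> mspace X" by (simp add: fill_in)
  then have "Area X {} (\<lambda>_. fill 0) = 0" by (intro Area_const_eq_0) auto
  moreover have "lipschitz_from {} X f" by (simp add: lipschitz_from_def Lipschitz_continuous_map_def)
  then have "Area X {} f = Area X {} (\<lambda>_. fill 0)"
    by (intro well_defined) auto
  ultimately show ?thesis by simp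
qed

lemma Area_finite_additive:
  fixes F :: "nat \<Rightarrow> (real^2) set"
  assumes E: "E \<in> sets borel" "lipschitz_from E X f"
    and F: "\<And>i. i < n \<Longrightarrow> F i \<in> sets borel" "\<And>i k. i < n \<Longrightarrow> k < n \<Longrightarrow> i \<noteq> k \<Longrightarrow> F i \<inter> F k = {}"
    and EF: "E = (\<Union>i<n. F i)"
  shows "Area X E f = (\<Sum>i<n. Area X (F i) f)"
proof -
  define G where "G = (\<lambda>i :: nat. if i < n then F i else {})"
  have "Area X E f = (\<Sum>i. Area X (G i) f)"
  proof (rule sigma_additivity[OF E])
    show "G i \<in> sets borel" for i using F by (simp add: G_def)
    show "disjoint_family G" using F(2) by (auto simp: disjoint_family_on_def G_def)
    show "E = (\<Union>i. G i)" by (auto simp: EF G_def split: if_splits)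
  qed
  also have "\<dots> = (\<Sum>i<n. Area X (G i) f)"
    by (rule suminf_finite) (auto simp: G_def Area_empty)
  also have "\<dots> = (\<Sum>i<n. Area X (F i) f)" by (intro sum.cong) (auto simp: G_def)
  finally show ?thesis .
qed

section \<open>Rows and cells of the disc\<close>

definition row :: "real \<Rightarrow> real \<Rightarrow> (real^2) set" where
  "row a c = {z. norm z \<le> 1 \<and> a \<le> lat (norm z) \<and> lat (norm z) < c}"

definition cell :: "real \<Rightarrow> real \<Rightarrow> real \<Rightarrow> real \<Rightarrow> (real^2) set" where
  "cell a c x0 x1 = {z \<in> row a c. x0 \<le> \<sigma> (ang z) \<and> \<sigma> (ang z) < x1}"

lemma row_borel: "row a c \<in> sets borel"
proof -
  have "{z \<in> space borel. norm (z :: real^2) \<le> 1 \<and> a \<le> lat (norm z) \<and> lat (norm z) < c} \<in> sets borel"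
    unfolding lat_def by measurable
  then show ?thesis by (simp add: row_def)
qed

lemma cell_borel:
  assumes "x0 \<in> {0..2 * pi}" "x1 \<in> {0..2 * pi}"
  shows "cell a c x0 x1 \<in> sets borel"
proof -
  note [measurable] = ang_borel_measurable
  have "{z \<in> space borel. T x0 \<le> ang z \<and> ang z < T x1} \<in> sets borel" by measurable
  moreover have "cell a c x0 x1 = row a c \<inter> {z \<in> space borel. T x0 \<le> ang z \<and> ang z < T x1}"
    using le_\<sigma>_iff[OF assms(1) ang_in] le_\<sigma>_iff[OF assms(2) ang_in] by (auto simp: cell_def simp flip: not_le)
  ultimately show ?thesis using row_borel by auto
qed

text \<open>In the coordinates \<open>(s, \<kappa> * x)\<close> hypothesis \<open>H\<close> says
  that the filling is \<open>\<Lambda>\<close>-Lipschitz for the Euclidean distance, and the cell is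
  a rectangle inside a square of side \<open>c - a\<close>. The coordinates are bi-Lipschitz because
  \<open>c < pi / 2\<close> keeps the cell off the centre and \<open>B * (x1 - x0) \<le> pi\<close>
  keeps its polar angles within \<open>pi\<close> of each other.\<close>

lemma Area_cell_le:
  assumes ac: "- \<beta> \<le> a" "a < c" "c < pi / 2" and \<kappa>: "0 < \<kappa>" and \<Lambda>: "0 \<le> \<Lambda>"
    and H: "\<And>s s' x x'. s \<in> {a..c} \<Longrightarrow> s' \<in> {a..c} \<Longrightarrow> x \<in> {0..2 * pi} \<Longrightarrow> x' \<in> {0..2 * pi} \<Longrightarrow>
      mdist X (\<Phi> s x) (\<Phi> s' x') \<le> \<Lambda> * sqrt ((s' - s)\<^sup>2 + (\<kappa> * (x' - x))\<^sup>2)"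
    and x: "0 \<le> x0" "x0 < x1" "x1 \<le> 2 * pi" "\<kappa> * (x1 - x0) \<le> c - a" "B * (x1 - x0) \<le> pi"
  shows "Area X (cell a c x0 x1) fill \<le> ennreal (\<Lambda>\<^sup>2 * (c - a)\<^sup>2)"
proof -
  define E where "E = {u :: real^2. a \<le> u $ 1 \<and> u $ 1 < c \<and> \<kappa> * x0 \<le> u $ 2 \<and> u $ 2 < \<kappa> * x1}"
  define \<phi> where "\<phi> = (\<lambda>u :: real^2. polar (rad (u $ 1)) (T (u $ 2 / \<kappa>)))"
  define \<psi> where "\<psi> = (\<lambda>z :: real^2. (vector [lat (norm z), \<kappa> * \<sigma> (ang z)] :: real^2))"
  let ?C = "cell a c x0 x1"
  let ?p = "vector [a, \<kappa> * x0] :: real^2" and ?q = "vector [c, \<kappa> * x1] :: real^2"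
  define g where "g = (\<lambda>u :: real^2. \<Phi> (u $ 1) (u $ 2 / \<kappa>))"
  have Cb: "?C \<in> sets borel" using x by (intro cell_borel) auto
  have Eb: "E \<in> sets borel"
  proof -
    have "{u \<in> space borel. a \<le> (u :: real^2) $ 1 \<and> u $ 1 < c \<and> \<kappa> * x0 \<le> u $ 2 \<and> u $ 2 < \<kappa> * x1} \<in> sets borel"
      by measurable
    then show ?thesis by (simp add: E_def)
  qed
  have Eu: "u $ 1 \<in> {a..<c}" "u $ 2 / \<kappa> \<in> {x0..<x1}" "u $ 2 / \<kappa> \<in> {0..2 * pi}" "u $ 2 / \<kappa> < 2 * pi" if "u \<in> E" for u
  proof -
    show "u $ 1 \<in> {a..<c}" using that by (auto simp: E_def)
    show 1: "u $ 2 / \<kappa> \<in> {x0..<x1}" using that \<kappa> by (auto simp: E_def field_simps)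
    then show "u $ 2 / \<kappa> \<in> {0..2 * pi}" "u $ 2 / \<kappa> < 2 * pi" using x(1,3) by auto
  qed
  have box: "u $ 1 \<in> {a..c}" "u $ 2 / \<kappa> \<in> {0..2 * pi}" if "u \<in> cbox ?p ?q" for u
  proof -
    show "u $ 1 \<in> {a..c}" using that by (auto simp: mem_box_cart forall_2)
    have "u $ 2 / \<kappa> \<in> {x0..x1}" using that \<kappa> by (auto simp: mem_box_cart forall_2 field_simps)
    then show "u $ 2 / \<kappa> \<in> {0..2 * pi}" using x(1,3) by auto
  qed
  have rad_pos: "0 < rad s" "rad c \<le> rad s" "rad s \<le> 1" if "s \<in> {a..<c}" for s
    using that ac H_pos by (auto simp: rad_def divide_right_mono)
  have radc: "0 < rad c" using ac H_pos by (simp add: rad_def)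
  have T_less: "T y < 2 * pi" if "y \<in> {0..2 * pi}" "y < 2 * pi" for y
    using T_in[OF that(1)] \<sigma>_T[OF that(1)] that(2) \<sigma>_2pi by (cases "T y = 2 * pi") auto
  have \<psi>\<phi>: "norm (\<phi> u) = rad (u $ 1)" "ang (\<phi> u) = T (u $ 2 / \<kappa>)" if "u \<in> E" for u
    using rad_pos(1)[OF Eu(1)[OF that]] T_in[OF Eu(3)[OF that]] T_less[OF Eu(3,4)[OF that]]
    by (auto simp: \<phi>_def norm_polar intro!: ang_polar)
  have \<psi>\<phi>': "\<psi> (\<phi> u) = u" if "u \<in> E" for u
    unfolding \<psi>_def \<psi>\<phi>[OF that] lat_rad \<sigma>_T[OF Eu(3)[OF that]] using \<kappa> by (simp add: vec_eq_iff forall_2)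
  have \<phi>E: "\<phi> u \<in> ?C" if "u \<in> E" for u
    unfolding cell_def row_def using \<psi>\<phi>[OF that] rad_pos[OF Eu(1)[OF that]] Eu(1,2)[OF that] \<sigma>_T[OF Eu(3)[OF that]]
    by (auto simp: lat_rad)
  have Cz: "lat (norm z) \<in> {a..<c}" "norm z \<le> 1" "\<sigma> (ang z) \<in> {x0..<x1}" if "z \<in> ?C" for z
    using that by (auto simp: cell_def row_def)
  have \<psi>C: "\<psi> z \<in> E" if "z \<in> ?C" for z
    using Cz[OF that] \<kappa> by (auto simp: \<psi>_def E_def)
  have \<phi>\<psi>: "\<phi> (\<psi> z) = z" if "z \<in> ?C" for z
    unfolding \<phi>_def \<psi>_def using \<kappa> by (simp add: rad_lat T_\<sigma>[OF ang_in] polar_norm_ang)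
  have bij: "bij_betw \<phi> E ?C"
    by (rule bij_betwI[where g = \<psi>]) (auto simp: \<phi>E \<psi>C \<psi>\<phi>' \<phi>\<psi>)
  have inv: "inv_into E \<phi> z = \<psi> z" if "z \<in> ?C" for z
    using bij \<psi>C[OF that] \<phi>\<psi>[OF that] by (intro inv_into_f_eq) (auto simp: bij_betw_def)
  have comp: "\<bar>(u - v) $ i\<bar> \<le> dist u v" for u v :: "real^2" and i
    unfolding dist_norm by (rule component_le_norm_cart)
  have Lip\<phi>: "(1 / (pi / 2 + \<beta>) + B / \<kappa>)-lipschitz_on E \<phi>"
  proof (rule lipschitz_onI)
    fix u v assume u: "u \<in> E" and v: "v \<in> E"
    have "dist (\<phi> u) (\<phi> v) \<le> \<bar>rad (u $ 1) - rad (v $ 1)\<bar> + \<bar>T (u $ 2 / \<kappa>) - T (v $ 2 / \<kappa>)\<bar>"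
      unfolding \<phi>_def using rad_pos(1,3)[OF Eu(1)[OF u]] rad_pos(1,3)[OF Eu(1)[OF v]]
      by (intro dist_polar_le) auto
    also have "\<bar>rad (u $ 1) - rad (v $ 1)\<bar> = 1 / (pi / 2 + \<beta>) * \<bar>(u - v) $ 1\<bar>"
      unfolding rad_diff using H_pos by (simp add: abs_divide abs_minus_commute)
    also have "\<bar>T (u $ 2 / \<kappa>) - T (v $ 2 / \<kappa>)\<bar> \<le> B * \<bar>u $ 2 / \<kappa> - v $ 2 / \<kappa>\<bar>"
      using Eu(3)[OF u] Eu(3)[OF v] by (intro T_Lip) auto
    also have "B * \<bar>u $ 2 / \<kappa> - v $ 2 / \<kappa>\<bar> = B / \<kappa> * \<bar>(u - v) $ 2\<bar>"
      using \<kappa> by (simp add: abs_divide flip: diff_divide_distrib)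
    finally have "dist (\<phi> u) (\<phi> v) \<le> 1 / (pi / 2 + \<beta>) * \<bar>(u - v) $ 1\<bar> + B / \<kappa> * \<bar>(u - v) $ 2\<bar>" by simp
    also have "\<dots> \<le> 1 / (pi / 2 + \<beta>) * dist u v + B / \<kappa> * dist u v"
      using comp H_pos B \<kappa> by (intro add_mono mult_left_mono) auto
    finally show "dist (\<phi> u) (\<phi> v) \<le> (1 / (pi / 2 + \<beta>) + B / \<kappa>) * dist u v" by (simp add: distrib_right)
  qed (use H_pos B \<kappa> in auto)
  define K where "K = pi / 2 + \<beta> + \<kappa> * A * (pi / 2 / rad c)"
  have Lip\<psi>: "K-lipschitz_on ?C (inv_into E \<phi>)"
  proof (rule lipschitz_onI)
    fix z w assume z: "z \<in> ?C" and w: "w \<in> ?C"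
    have nz: "rad c \<le> norm z" "rad c \<le> norm w"
      using Cz[OF z] Cz[OF w] rad_pos(2)[of "lat (norm z)"] rad_pos(2)[of "lat (norm w)"] by (auto simp: rad_lat)
    have "\<bar>ang z - ang w\<bar> \<le> B * \<bar>\<sigma> (ang z) - \<sigma> (ang w)\<bar>"
      using T_Lip[of "\<sigma> (ang z)" "\<sigma> (ang w)"] \<sigma>_in[OF ang_in] T_\<sigma>[OF ang_in] by auto
    also have "\<dots> \<le> B * (x1 - x0)" using Cz(3)[OF z] Cz(3)[OF w] B by (intro mult_left_mono) auto
    also have "\<dots> \<le> pi" by (rule x)
    finally have "rad c * \<bar>ang z - ang w\<bar> \<le> pi / 2 * dist z w"
      using dist_polar_ge_angular[of "rad c" "norm z" "norm w" "ang z" "ang w"] nz radc by (simp add: polar_norm_ang)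
    then have angd: "\<bar>ang z - ang w\<bar> \<le> pi / 2 / rad c * dist z w"
      using radc by (simp add: field_simps)
    have "dist (\<psi> z) (\<psi> w) \<le> \<bar>(\<psi> z - \<psi> w) $ 1\<bar> + \<bar>(\<psi> z - \<psi> w) $ 2\<bar>"
      using norm_le_l1_cart[of "\<psi> z - \<psi> w"] by (simp add: dist_norm sum_2)
    also have "\<bar>(\<psi> z - \<psi> w) $ 1\<bar> \<le> (pi / 2 + \<beta>) * dist z w"
    proof -
      have "\<bar>(\<psi> z - \<psi> w) $ 1\<bar> = \<bar>norm z - norm w\<bar> * (pi / 2 + \<beta>)"
        using H_pos by (simp add: \<psi>_def lat_diff abs_mult abs_minus_commute)
      also have "\<dots> \<le> dist z w * (pi / 2 + \<beta>)"
        using H_pos norm_triangle_ineq3[of z w] by (intro mult_right_mono) (auto simp: dist_norm)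
      finally show ?thesis by (simp only: mult.commute)
    qed
    also have "\<bar>(\<psi> z - \<psi> w) $ 2\<bar> \<le> \<kappa> * A * (pi / 2 / rad c) * dist z w"
    proof -
      have "\<bar>(\<psi> z - \<psi> w) $ 2\<bar> = \<kappa> * \<bar>\<sigma> (ang z) - \<sigma> (ang w)\<bar>"
        using \<kappa> by (simp add: \<psi>_def abs_mult flip: right_diff_distrib)
      also have "\<dots> \<le> \<kappa> * (A * \<bar>ang z - ang w\<bar>)"
        using \<kappa> \<sigma>_Lip[OF ang_in ang_in] by (intro mult_left_mono) auto
      also have "\<dots> \<le> \<kappa> * (A * (pi / 2 / rad c * dist z w))"
        using \<kappa> A angd by (intro mult_left_mono) auto
      finally show ?thesis by (simp only: mult.assoc)
    qed
    finally show "dist (inv_into E \<phi> z) (inv_into E \<phi> w) \<le> K * dist z w"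
      unfolding inv[OF z] inv[OF w] K_def distrib_right by simp
  qed (use H_pos A \<kappa> radc in \<open>auto simp: K_def intro!: add_nonneg_nonneg mult_nonneg_nonneg\<close>)
  have g_in: "g u \<in> mspace X" if "u \<in> cbox ?p ?q" for u
    unfolding g_def using box[OF that] ac by (intro \<Phi>_in) auto
  have g_Lip: "mdist X (g u) (g v) \<le> \<Lambda> * dist u v" if u: "u \<in> cbox ?p ?q" and v: "v \<in> cbox ?p ?q" for u v
  proof -
    have "mdist X (g u) (g v) \<le> \<Lambda> * sqrt ((v $ 1 - u $ 1)\<^sup>2 + (\<kappa> * (v $ 2 / \<kappa> - u $ 2 / \<kappa>))\<^sup>2)"
      unfolding g_def by (intro H box[OF u] box[OF v])
    also have "\<kappa> * (v $ 2 / \<kappa> - u $ 2 / \<kappa>) = v $ 2 - u $ 2" using \<kappa> by (simp add: field_simps)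
    also have "sqrt ((v $ 1 - u $ 1)\<^sup>2 + (v $ 2 - u $ 2)\<^sup>2) = dist u v"
      by (simp add: dist_norm norm_real2 power2_commute)
    finally show ?thesis .
  qed
  have Esub: "E \<subseteq> cbox ?p ?q" by (auto simp: E_def mem_box_cart forall_2)
  have lipg: "lipschitz_from E X g"
    unfolding lipschitz_from_def Lipschitz_continuous_map_def using Esub g_in g_Lip
    by (fastforce intro!: exI[of _ \<Lambda>])
  have "?C \<subseteq> cball 0 1" using Cz(2) by auto
  then have "Area X ?C fill = Area X E (fill \<circ> \<phi>)"
    using coordinate_invariance[OF Cb Eb fill_lipschitz_from bij Lip\<phi> Lip\<psi>] by simp
  also have "\<dots> = Area X E g"
  proof (rule well_defined[OF Eb lipg, symmetric])
    fix u assume "u \<in> E"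
    from \<psi>\<phi>[OF this] \<sigma>_T[OF Eu(3)[OF this]] show "g u = (fill \<circ> \<phi>) u"
      by (simp add: g_def fill_def lat_rad)
  qed
  also have "\<dots> \<le> ennreal (\<Lambda>\<^sup>2 * (c - a)\<^sup>2)"
  proof (rule Area_square_le[OF j Eb Esub])
    show "E \<subseteq> cbox ?p (?p + (c - a) *\<^sub>R 1)"
    proof
      fix u assume "u \<in> E"
      then have "a \<le> u $ 1" "u $ 1 < c" "\<kappa> * x0 \<le> u $ 2" "u $ 2 < \<kappa> * x1" by (auto simp: E_def)
      moreover have "\<kappa> * x1 \<le> \<kappa> * x0 + (c - a)" using x(4) by (simp add: algebra_simps)
      ultimately show "u \<in> cbox ?p (?p + (c - a) *\<^sub>R 1)"
        by (auto simp: mem_box_cart forall_2)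
    qed
    show "0 < c - a" using ac by simp
    have "?p \<in> cbox ?p ?q" using ac x \<kappa> by (auto simp: mem_box_cart forall_2)
    then show "cbox ?p ?q \<noteq> {}" by blast
  qed (use g_in g_Lip \<Lambda> in auto)
  finally show ?thesis .
qed

lemma Area_row_le:
  assumes ac: "- \<beta> \<le> a" "a < c" "c < pi / 2" and \<kappa>: "0 < \<kappa>" and \<Lambda>: "0 \<le> \<Lambda>"
    and H: "\<And>s s' x x'. s \<in> {a..c} \<Longrightarrow> s' \<in> {a..c} \<Longrightarrow> x \<in> {0..2 * pi} \<Longrightarrow> x' \<in> {0..2 * pi} \<Longrightarrow>
      mdist X (\<Phi> s x) (\<Phi> s' x') \<le> \<Lambda> * sqrt ((s' - s)\<^sup>2 + (\<kappa> * (x' - x))\<^sup>2)"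
  shows "Area X (row a c) fill \<le> ennreal (\<Lambda>\<^sup>2 * (2 * pi * \<kappa> * (c - a) + (2 * B + 3) * (c - a)\<^sup>2))"
proof -
  define \<delta> where "\<delta> = c - a"
  have \<delta>: "0 < \<delta>" using ac by (simp add: \<delta>_def)
  \<comment> \<open>Cells must fit into squares, which takes
    \<open>2 * pi * \<kappa> / \<delta>\<close> of them, and span an angle of at most
    \<open>pi\<close>, which takes \<open>2 * B\<close>. Two roundings and the final
    \<open>1\<close> make the 3 in the estimate. Cells beyond the first number cost only a multiple
    of \<open>\<delta>\<^sup>2\<close>.\<close>
  define m where "m = nat \<lceil>2 * pi * \<kappa> / \<delta>\<rceil> + nat \<lceil>2 * B\<rceil> + 1"
  have m1: "2 * pi * \<kappa> / \<delta> \<le> m" and m2: "2 * B \<le> m" and m3: "m \<le> 2 * pi * \<kappa> / \<delta> + 2 * B + 3"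
  proof -
    have p: "0 \<le> 2 * pi * \<kappa> / \<delta>" using \<kappa> \<delta> by simp
    show "2 * pi * \<kappa> / \<delta> \<le> m" using of_nat_ceiling[of "2 * pi * \<kappa> / \<delta>"] by (simp add: m_def)
    show "2 * B \<le> m" using of_nat_ceiling[of "2 * B"] by (simp add: m_def)
    have "real (nat \<lceil>2 * pi * \<kappa> / \<delta>\<rceil>) \<le> 2 * pi * \<kappa> / \<delta> + 1"
      using p ceiling_correct[of "2 * pi * \<kappa> / \<delta>"] by (simp add: of_nat_nat)
    moreover have "real (nat \<lceil>2 * B\<rceil>) \<le> 2 * B + 1"
      using B ceiling_correct[of "2 * B"] by (simp add: of_nat_nat)
    ultimately show "m \<le> 2 * pi * \<kappa> / \<delta> + 2 * B + 3" by (simp add: m_def)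
  qed
  have mp: "0 < real m" by (simp add: m_def)
  define xk where "xk = (\<lambda>k :: nat. 2 * pi * k / m)"
  have xk_step: "xk (Suc k) - xk k = 2 * pi / m" for k
    by (simp add: xk_def algebra_simps add_divide_distrib diff_divide_distrib)
  have xk_mono: "xk i \<le> xk k" if "i \<le> k" for i k using that mp by (simp add: xk_def divide_right_mono)
  have xk0: "xk 0 = 0" "xk m = 2 * pi" using mp by (simp_all add: xk_def)
  have xk_in: "xk k \<in> {0..2 * pi}" if "k \<le> m" for k using xk_mono[of 0 k] xk_mono[of k m] that xk0 by auto
  have "Area X (row a c) fill = (\<Sum>k<m. Area X (cell a c (xk k) (xk (Suc k))) fill)"
  proof (rule Area_finite_additive[OF row_borel fill_lipschitz_from])
    show "row a c \<subseteq> cball 0 1" by (auto simp: row_def)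
    show "cell a c (xk i) (xk (Suc i)) \<in> sets borel" if "i < m" for i
      using that by (intro cell_borel xk_in) auto
    show "cell a c (xk i) (xk (Suc i)) \<inter> cell a c (xk k) (xk (Suc k)) = {}" if "i < m" "k < m" "i \<noteq> k" for i k
      using xk_mono[of "Suc i" k] xk_mono[of "Suc k" i] that by (auto simp: cell_def) (metis linorder_neqE_nat Suc_leI not_le order_trans)
    show "row a c = (\<Union>k<m. cell a c (xk k) (xk (Suc k)))"
    proof (intro subset_antisym subsetI)
      fix z assume z: "z \<in> row a c"
      have "\<exists>k<m. xk k \<le> \<sigma> (ang z) \<and> \<sigma> (ang z) < xk (Suc k)"
        using \<sigma>_in[OF ang_in[of z]] \<sigma>_ang_less[of z] by (intro interval_of_increasing) (auto simp: xk0)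
      then show "z \<in> (\<Union>k<m. cell a c (xk k) (xk (Suc k)))" using z by (auto simp: cell_def)
    qed (auto simp: cell_def)
  qed
  also have "\<dots> \<le> (\<Sum>k<m. ennreal (\<Lambda>\<^sup>2 * \<delta>\<^sup>2))"
  proof (rule sum_mono)
    fix k assume "k \<in> {..<m}"
    then have k: "k < m" by simp
    have "2 * pi * \<kappa> \<le> m * \<delta>" using m1 \<delta> by (simp add: field_simps)
    then have 1: "\<kappa> * (xk (Suc k) - xk k) \<le> c - a" unfolding xk_step using mp by (simp add: field_simps \<delta>_def)
    have "B * (2 * pi) \<le> pi * m" using mult_left_mono[OF m2, of pi] by (simp add: mult_ac)
    then have 2: "B * (xk (Suc k) - xk k) \<le> pi" unfolding xk_step using mp by (simp add: field_simps)
    have 3: "xk k < xk (Suc k)" using xk_step[of k] mp pi_gt_zero by (smt (verit) divide_pos_pos)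
    show "Area X (cell a c (xk k) (xk (Suc k))) fill \<le> ennreal (\<Lambda>\<^sup>2 * \<delta>\<^sup>2)"
      unfolding \<delta>_def using xk_in[of k] xk_in[of "Suc k"] k 1 2 3 by (intro Area_cell_le[OF ac \<kappa> \<Lambda> H]) auto
  qed
  also have "\<dots> = ennreal (m * (\<Lambda>\<^sup>2 * \<delta>\<^sup>2))" by (simp add: ennreal_mult ennreal_of_nat_eq_real_of_nat)
  also have "\<dots> \<le> ennreal (\<Lambda>\<^sup>2 * (2 * pi * \<kappa> * \<delta> + (2 * B + 3) * \<delta>\<^sup>2))"
  proof (rule ennreal_leI)
    have "m * (\<Lambda>\<^sup>2 * \<delta>\<^sup>2) \<le> (2 * pi * \<kappa> / \<delta> + 2 * B + 3) * (\<Lambda>\<^sup>2 * \<delta>\<^sup>2)"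
      using m3 by (intro mult_right_mono) auto
    also have "\<dots> = \<Lambda>\<^sup>2 * (2 * pi * \<kappa> * \<delta> + (2 * B + 3) * \<delta>\<^sup>2)"
      using \<delta> by (simp add: field_simps power2_eq_square)
    finally show "m * (\<Lambda>\<^sup>2 * \<delta>\<^sup>2) \<le> \<Lambda>\<^sup>2 * (2 * pi * \<kappa> * \<delta> + (2 * B + 3) * \<delta>\<^sup>2)" .
  qed
  finally show ?thesis by (simp only: \<delta>_def)
qed

end

lemma abs_add_le_sqrt2: "\<bar>a\<bar> + \<bar>b\<bar> \<le> sqrt 2 * sqrt (a\<^sup>2 + b\<^sup>2)"
proof (rule power2_le_imp_le)
  have "0 \<le> (\<bar>a\<bar> - \<bar>b\<bar>)\<^sup>2" by simp
  then show "(\<bar>a\<bar> + \<bar>b\<bar>)\<^sup>2 \<le> (sqrt 2 * sqrt (a\<^sup>2 + b\<^sup>2))\<^sup>2"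
    by (simp add: power_mult_distrib power2_sum power2_diff)
qed simp

text \<open>A Riemann sum at right endpoints of the decreasing \<open>cos\<close> lies below the
  integral; the term \<open>k = 0\<close> is counted separately as \<open>\<delta>\<close>.\<close>

lemma sum_cos_le:
  fixes \<delta> :: real
  assumes "0 \<le> \<delta>" "M * \<delta> \<le> pi"
  shows "(\<Sum>k<Suc M. cos (k * \<delta>) * \<delta>) \<le> \<delta> + sin (M * \<delta>)"
  using assms(2)
proof (induction M)
  case (Suc M)
  have le: "real M * \<delta> \<le> Suc M * \<delta>" "Suc M * \<delta> \<le> pi" using assms(1) Suc.prems by (auto intro: mult_right_mono)
  have "cos (Suc M * \<delta>) * \<delta> \<le> sin (Suc M * \<delta>) - sin (M * \<delta>)"
  proof (cases "\<delta> = 0")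
    case False
    then have lt: "real M * \<delta> < Suc M * \<delta>" using assms(1) by simp
    from MVT2[OF lt, of sin cos] obtain z where z: "real M * \<delta> < z" "z < Suc M * \<delta>"
      "sin (Suc M * \<delta>) - sin (M * \<delta>) = (Suc M * \<delta> - M * \<delta>) * cos z"
      by (auto intro: derivative_intros)
    have "0 \<le> real M * \<delta>" using assms(1) by simp
    then have "cos (Suc M * \<delta>) \<le> cos z" using z le by (intro cos_monotone_0_pi_le) auto
    moreover have "Suc M * \<delta> - M * \<delta> = \<delta>" by (simp add: algebra_simps)
    ultimately show ?thesis unfolding z(3) using assms(1) by (simp add: mult.commute mult_left_mono)
  qed simp
  moreover have "(\<Sum>k<Suc M. cos (k * \<delta>) * \<delta>) \<le> \<delta> + sin (M * \<delta>)" using Suc.IH le by simp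
  ultimately show ?case by simp
qed simp

context polar_filling
begin

text \<open>The factor 2 comes from bounding the sum metric by \<open>sqrt 2\<close> times the
  Euclidean one. It is harmless because the whole bound vanishes with
  \<open>\<beta>\<close>.\<close>

lemma Area_collar_le: "Area X (row (- \<beta>) 0) fill \<le> ennreal (2 * l\<^sup>2 * (2 * pi * \<beta> + (2 * B + 3) * \<beta>\<^sup>2))"
proof -
  have "Area X (row (- \<beta>) 0) fill \<le> ennreal ((l * sqrt 2)\<^sup>2 * (2 * pi * 1 * (0 - - \<beta>) + (2 * B + 3) * (0 - - \<beta>)\<^sup>2))"
  proof (rule Area_row_le)
    fix s s' x x' assume sx: "s \<in> {- \<beta>..0}" "s' \<in> {- \<beta>..0}" "x \<in> {0..2 * pi}" "x' \<in> {0..2 * pi}"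
    have "mdist X (\<Phi> s x) (\<Phi> s' x') \<le> l * (\<bar>s' - s\<bar> + \<bar>x' - x\<bar>)"
      using sx by (intro \<Phi>_collar_le) auto
    also have "\<dots> \<le> l * (sqrt 2 * sqrt ((s' - s)\<^sup>2 + (x' - x)\<^sup>2))"
      using l by (intro mult_left_mono abs_add_le_sqrt2) auto
    finally show "mdist X (\<Phi> s x) (\<Phi> s' x') \<le> l * sqrt 2 * sqrt ((s' - s)\<^sup>2 + (1 * (x' - x))\<^sup>2)"
      by (simp add: mult.assoc)
  qed (use \<beta>_pos l in auto)
  also have "(l * sqrt 2)\<^sup>2 = 2 * l\<^sup>2" by (simp add: power_mult_distrib)
  also have "0 - - \<beta> = \<beta>" by simp
  finally show ?thesis by (simp only: mult_1_right)
qed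

text \<open>The row is compared with a flat cylinder over its longest parallel, the one at height
  \<open>a\<close>.\<close>

lemma Area_hemisphere_row_le:
  assumes "0 \<le> a" "a < c" "c < pi / 2"
  shows "Area X (row a c) fill \<le> ennreal (l\<^sup>2 * (2 * pi * cos a * (c - a) + (2 * B + 3) * (c - a)\<^sup>2))"
proof (rule Area_row_le)
  fix s s' x x' assume sx: "s \<in> {a..c}" "s' \<in> {a..c}" "x \<in> {0..2 * pi}" "x' \<in> {0..2 * pi}"
  then show "mdist X (\<Phi> s x) (\<Phi> s' x') \<le> l * sqrt ((s' - s)\<^sup>2 + (cos a * (x' - x))\<^sup>2)"
    using assms by (intro \<Phi>_hemisphere_le) auto
qed (use assms \<beta>_pos l in \<open>auto intro!: cos_gt_zero_pi\<close>)

text \<open>Polar coordinates degenerate at the pole, so the cap is treated as a subset of a square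
  of side \<open>2 * \<delta>\<close>. For \<open>\<delta> \<le> 1 / 2\<close> this square lies in
  the unit disc, where \<open>Lf\<close> is a Lipschitz constant.\<close>

lemma Area_centre_le:
  assumes \<delta>: "0 < \<delta>" "\<delta> \<le> 1 / 2"
  defines "Z \<equiv> {z :: real^2. norm z \<le> 1 \<and> pi / 2 - \<delta> \<le> lat (norm z)}"
  shows "Area X Z fill \<le> ennreal (Lf\<^sup>2 * (2 * \<delta>)\<^sup>2)" "Z \<in> sets borel"
proof -
  have "{z \<in> space borel. norm (z :: real^2) \<le> 1 \<and> pi / 2 - \<delta> \<le> lat (norm z)} \<in> sets borel"
    unfolding lat_def by measurable
  then show Zb: "Z \<in> sets borel" by (simp add: Z_def)
  let ?p = "- (\<delta> *\<^sub>R 1) :: real^2" and ?q = "\<delta> *\<^sub>R 1 :: real^2"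
  have nZ: "norm z \<le> \<delta>" if "z \<in> Z" for z
  proof -
    have "norm z * 1 \<le> norm z * (pi / 2 + \<beta>)" using \<beta>_pos pi_gt3 by (intro mult_left_mono) auto
    also have "\<dots> \<le> \<delta>" using that by (simp add: Z_def lat_def)
    finally show ?thesis by simp
  qed
  have sub: "Z \<subseteq> cbox ?p ?q"
  proof
    fix z assume "z \<in> Z"
    then have "\<bar>z $ i\<bar> \<le> \<delta>" for i using component_le_norm_cart[of z i] nZ[of z] by linarith
    then show "z \<in> cbox ?p ?q" by (simp add: mem_box_cart abs_le_iff minus_le_iff)
  qed
  have disc: "norm z \<le> 1" if "z \<in> cbox ?p ?q" for z
  proof -
    have "\<bar>z $ i\<bar> \<le> 1 / 2" for i
    proof -
      have "- \<delta> \<le> z $ i \<and> z $ i \<le> \<delta>" using that by (simp add: mem_box_cart)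
      then show ?thesis using \<delta>(2) by linarith
    qed
    then have "\<bar>z $ 1\<bar> + \<bar>z $ 2\<bar> \<le> 1" using add_mono[of "\<bar>z $ 1\<bar>" "1/2" "\<bar>z $ 2\<bar>" "1/2"] by simp
    then show ?thesis using norm_le_l1_cart[of z] by (simp add: sum_2)
  qed
  show "Area X Z fill \<le> ennreal (Lf\<^sup>2 * (2 * \<delta>)\<^sup>2)"
  proof (rule Area_square_le[OF j Zb sub])
    have e: "?p + (2 * \<delta>) *\<^sub>R 1 = ?q" by (simp add: vec_eq_iff)
    show "Z \<subseteq> cbox ?p (?p + (2 * \<delta>) *\<^sub>R 1)" unfolding e by (rule sub)
    have "0 \<in> cbox ?p ?q" using \<delta> by (simp add: mem_box_cart)
    then show "cbox ?p ?q \<noteq> {}" by blast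
  qed (use \<delta> disc fill_in fill_Lip Lf_nonneg in auto)
qed

lemma Area_fill_le_subdivision:
  assumes n: "4 \<le> n"
  defines "\<delta> \<equiv> pi / (2 * real n)"
  shows "Area X (cball 0 1) fill \<le> ennreal (2 * l\<^sup>2 * (2 * pi * \<beta> + (2 * B + 3) * \<beta>\<^sup>2)
    + l\<^sup>2 * (2 * pi * (\<delta> + 1) + (2 * B + 3) * (pi / 2 * \<delta>)) + Lf\<^sup>2 * (2 * \<delta>)\<^sup>2)"
proof -
  have \<delta>: "0 < \<delta>" "\<delta> \<le> 1 / 2" "n * \<delta> = pi / 2"
  proof -
    show "0 < \<delta>" "n * \<delta> = pi / 2" using n by (auto simp: \<delta>_def)
    have "pi \<le> 4" using pi_less_4 by simp
    then show "\<delta> \<le> 1 / 2" using n by (simp add: \<delta>_def field_simps)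
  qed
  \<comment> \<open>Row 0 is the collar, row \<open>i + 1\<close> starts at height
    \<open>i * \<delta>\<close>, and the rows stop at \<open>pi / 2 - \<delta>\<close>, leaving the
    cap around the pole.\<close>
  define e where "e = (\<lambda>i :: nat. if i = 0 then - \<beta> else (real i - 1) * \<delta>)"
  define Z where "Z = {z :: real^2. norm z \<le> 1 \<and> pi / 2 - \<delta> \<le> lat (norm z)}"
  define F where "F = (\<lambda>i. if i < n then row (e i) (e (Suc i)) else Z)"
  have en: "e n = pi / 2 - \<delta>" using n \<delta> by (simp add: e_def algebra_simps)
  have e_mono: "e i \<le> e k" if "i \<le> k" for i k
  proof (rule lift_Suc_mono_le[OF _ that])
    fix i
    show "e i \<le> e (Suc i)"
      using \<beta>_pos \<delta> by (cases "i = 0") (auto simp: e_def intro!: mult_right_mono)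
  qed
  have Zb: "Z \<in> sets borel" and ZA: "Area X Z fill \<le> ennreal (Lf\<^sup>2 * (2 * \<delta>)\<^sup>2)"
    unfolding Z_def using Area_centre_le[OF \<delta>(1,2)] by auto
  have "Area X (cball 0 1) fill = (\<Sum>i<Suc n. Area X (F i) fill)"
  proof (rule Area_finite_additive)
    show "lipschitz_from (cball 0 1) X fill" by (rule fill_lipschitz_from) simp
    show "F i \<in> sets borel" for i using row_borel Zb by (simp add: F_def)
    show "F i \<inter> F k = {}" if ik: "i < Suc n" "k < Suc n" "i \<noteq> k" for i k
    proof -
      have *: "F i \<inter> F k = {}" if "i < k" "k < Suc n" for i k
        using e_mono[of "Suc i" k] that by (cases "k = n") (auto simp: F_def row_def Z_def simp flip: en)
      show ?thesis using *[of i k] *[of k i] ik by (cases "i < k") auto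
    qed
    show "cball 0 1 = (\<Union>i<Suc n. F i)"
    proof (intro subset_antisym subsetI)
      fix z :: "real^2" assume "z \<in> cball 0 1"
      then have z: "norm z \<le> 1" by simp
      show "z \<in> (\<Union>i<Suc n. F i)"
      proof (cases "lat (norm z) < e n")
        case True
        have "e 0 \<le> lat (norm z)" using lat_bounds[of "norm z"] z by (simp add: e_def)
        from interval_of_increasing[OF this True] obtain i where "i < n" "e i \<le> lat (norm z)" "lat (norm z) < e (Suc i)" by blast
        then show ?thesis using z by (intro UN_I[of i]) (auto simp: F_def row_def)
      next
        case False
        then show ?thesis using z by (intro UN_I[of n]) (auto simp: F_def Z_def en)
      qed
    qed (auto simp: F_def row_def Z_def split: if_splits)
  qed auto
  also have "\<dots> = (\<Sum>i<n. Area X (F i) fill) + Area X Z fill" by (simp add: F_def)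
  also have "(\<Sum>i<n. Area X (F i) fill) = Area X (F 0) fill + (\<Sum>k<n - 1. Area X (F (Suc k)) fill)"
    using n sum.lessThan_Suc_shift[of "\<lambda>i. Area X (F i) fill" "n - 1"] by simp
  also have "\<dots> + Area X Z fill \<le> ennreal (2 * l\<^sup>2 * (2 * pi * \<beta> + (2 * B + 3) * \<beta>\<^sup>2))
    + (\<Sum>k<n - 1. ennreal (l\<^sup>2 * (2 * pi * (cos (k * \<delta>) * \<delta>) + (2 * B + 3) * \<delta>\<^sup>2))) + ennreal (Lf\<^sup>2 * (2 * \<delta>)\<^sup>2)"
  proof (intro add_mono sum_mono ZA)
    show "Area X (F 0) fill \<le> ennreal (2 * l\<^sup>2 * (2 * pi * \<beta> + (2 * B + 3) * \<beta>\<^sup>2))"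
      using Area_collar_le n by (simp add: F_def e_def)
    fix k assume "k \<in> {..<n - 1}"
    then have k: "Suc k < n" by simp
    have eq: "F (Suc k) = row (k * \<delta>) (Suc k * \<delta>)" using k by (simp add: F_def e_def)
    have step: "Suc k * \<delta> - k * \<delta> = \<delta>" by (simp add: algebra_simps)
    have "Suc k * \<delta> < n * \<delta>" using k \<delta> by (intro mult_strict_right_mono) auto
    then show "Area X (F (Suc k)) fill \<le> ennreal (l\<^sup>2 * (2 * pi * (cos (k * \<delta>) * \<delta>) + (2 * B + 3) * \<delta>\<^sup>2))"
      using Area_hemisphere_row_le[of "k * \<delta>" "Suc k * \<delta>"] \<delta> unfolding eq step by (simp add: mult.assoc)
  qed
  also have "\<dots> = ennreal (2 * l\<^sup>2 * (2 * pi * \<beta> + (2 * B + 3) * \<beta>\<^sup>2)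
    + (\<Sum>k<n - 1. l\<^sup>2 * (2 * pi * (cos (k * \<delta>) * \<delta>) + (2 * B + 3) * \<delta>\<^sup>2)) + Lf\<^sup>2 * (2 * \<delta>)\<^sup>2)"
  proof -
    have pos: "0 \<le> l\<^sup>2 * (2 * pi * (cos (k * \<delta>) * \<delta>) + (2 * B + 3) * \<delta>\<^sup>2)" if "k \<in> {..<n - 1}" for k
    proof -
      have "k * \<delta> \<le> n * \<delta>" "0 \<le> k * \<delta>" using that \<delta> by (auto intro!: mult_right_mono)
      then have "- (pi / 2) \<le> k * \<delta>" "k * \<delta> \<le> pi / 2" using \<delta>(3) pi_gt_zero by linarith+
      then have "0 \<le> cos (k * \<delta>)" by (rule cos_ge_zero)
      then show ?thesis using \<delta> B by simp
    qed
    have nn: "0 \<le> 2 * l\<^sup>2 * (2 * pi * \<beta> + (2 * B + 3) * \<beta>\<^sup>2)" using \<beta>_pos B by simp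
    have add: "ennreal x + (\<Sum>k\<in>I. ennreal (f k)) + ennreal y = ennreal (x + (\<Sum>k\<in>I. f k) + y)"
      if "0 \<le> x" "0 \<le> y" "\<And>k. k \<in> I \<Longrightarrow> 0 \<le> f k" for x y f and I :: "nat set"
      using that by (simp add: sum_ennreal sum_nonneg ennreal_plus)
    show ?thesis by (rule add[OF nn _ pos]) simp_all
  qed
  also have "\<dots> \<le> ennreal (2 * l\<^sup>2 * (2 * pi * \<beta> + (2 * B + 3) * \<beta>\<^sup>2)
    + l\<^sup>2 * (2 * pi * (\<delta> + 1) + (2 * B + 3) * (pi / 2 * \<delta>)) + Lf\<^sup>2 * (2 * \<delta>)\<^sup>2)"
  proof (intro ennreal_leI add_mono order_refl)
    have "(\<Sum>k<n - 1. l\<^sup>2 * (2 * pi * (cos (k * \<delta>) * \<delta>) + (2 * B + 3) * \<delta>\<^sup>2))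
      = l\<^sup>2 * (2 * pi * (\<Sum>k<n - 1. cos (k * \<delta>) * \<delta>) + (2 * B + 3) * ((n - 1) * \<delta>\<^sup>2))"
      by (simp add: sum.distrib flip: sum_distrib_left)
    also have "\<dots> \<le> l\<^sup>2 * (2 * pi * (\<delta> + 1) + (2 * B + 3) * (pi / 2 * \<delta>))"
    proof (intro mult_left_mono add_mono)
      have "(\<Sum>k<Suc (n - 2). cos (k * \<delta>) * \<delta>) \<le> \<delta> + sin ((n - 2) * \<delta>)"
      proof (rule sum_cos_le)
        have "real (n - 2) * \<delta> \<le> n * \<delta>" using \<delta> by (intro mult_right_mono) auto
        then show "real (n - 2) * \<delta> \<le> pi" using \<delta> pi_gt_zero by linarith
      qed (use \<delta> in auto)
      moreover have "Suc (n - 2) = n - 1" using n by simp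
      ultimately have "(\<Sum>k<n - 1. cos (k * \<delta>) * \<delta>) \<le> \<delta> + sin ((n - 2) * \<delta>)" by (simp only:)
      also have "\<dots> \<le> \<delta> + 1" by simp
      finally show "(\<Sum>k<n - 1. cos (k * \<delta>) * \<delta>) \<le> \<delta> + 1" .
      have "real (n - 1) * \<delta>\<^sup>2 \<le> n * \<delta>\<^sup>2" by (intro mult_right_mono) auto
      also have "\<dots> = (n * \<delta>) * \<delta>" by (simp add: power2_eq_square)
      finally show "real (n - 1) * \<delta>\<^sup>2 \<le> pi / 2 * \<delta>" unfolding \<delta>(3) .
    qed (use B in auto)
    finally show "(\<Sum>k<n - 1. l\<^sup>2 * (2 * pi * (cos (k * \<delta>) * \<delta>) + (2 * B + 3) * \<delta>\<^sup>2))
      \<le> l\<^sup>2 * (2 * pi * (\<delta> + 1) + (2 * B + 3) * (pi / 2 * \<delta>))" .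
  qed
  finally show ?thesis .
qed

text \<open>As the rows get thin, the bound for the \<open>cos\<close> sum tends to 1 while the cap
  and the quadratic errors vanish. What remains is the collar and the area of a hemisphere of radius
  \<open>l\<close>.\<close>

lemma Area_fill_le:
  "Area X (cball 0 1) fill \<le> ennreal (2 * l\<^sup>2 * (2 * pi * \<beta> + (2 * B + 3) * \<beta>\<^sup>2) + l\<^sup>2 * (2 * pi))"
proof (rule LIMSEQ_le_const)
  define R where "R = (\<lambda>\<delta>. 2 * l\<^sup>2 * (2 * pi * \<beta> + (2 * B + 3) * \<beta>\<^sup>2)
    + l\<^sup>2 * (2 * pi * (\<delta> + 1) + (2 * B + 3) * (pi / 2 * \<delta>)) + Lf\<^sup>2 * (2 * \<delta>)\<^sup>2)"
  have "(\<lambda>n. pi / 2 * (1 / real n)) \<longlonglongrightarrow> pi / 2 * 0"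
    by (intro tendsto_mult tendsto_const lim_1_over_n)
  then have \<delta>0: "(\<lambda>n. pi / (2 * real n)) \<longlonglongrightarrow> 0" by simp
  have "(\<lambda>n. R (pi / (2 * real n))) \<longlonglongrightarrow> R 0"
    unfolding R_def by (intro tendsto_intros \<delta>0)
  then show "(\<lambda>n. ennreal (R (pi / (2 * real n)))) \<longlonglongrightarrow> ennreal (2 * l\<^sup>2 * (2 * pi * \<beta> + (2 * B + 3) * \<beta>\<^sup>2) + l\<^sup>2 * (2 * pi))"
    by (intro tendsto_ennrealI) (simp add: R_def)
  show "\<exists>M. \<forall>n\<ge>M. Area X (cball 0 1) fill \<le> ennreal (R (pi / (2 * real n)))"
    unfolding R_def using Area_fill_le_subdivision by (intro exI[of _ 4]) auto
qed

end

section \<open>From fillings to the isoperimetric inequality\<close>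

lemma (in area_functional) filling_area_constant:
  assumes \<eta>: "\<And>z. z \<in> sphere 0 1 \<Longrightarrow> \<eta> z = y" and y: "y \<in> mspace X"
  shows "filling_area Area X \<eta> = 0"
proof -
  have "(\<lambda>_. y) \<in> fillings X \<eta>"
    using \<eta> y by (auto simp: fillings_def lipschitz_from_def Lipschitz_continuous_map_def mdist_self intro!: exI[of _ 1])
  then have "filling_area Area X \<eta> \<le> Area X (cball 0 1) (\<lambda>_. y)"
    unfolding filling_area_def by (rule INF_lower)
  then show ?thesis using Area_const_eq_0[of "cball 0 1" y X] y by simp
qed

text \<open>Here \<open>\<epsilon>\<close>, and with it \<open>l\<close> and \<open>B\<close>, stays
  fixed while \<open>N\<close> grows and \<open>\<tau>\<close> tends to 1. Both parts of the collar
  width then tend to 0, and only the hemisphere term survives. The limit in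
  \<open>\<epsilon>\<close> must come afterwards because \<open>B\<close> depends on
  \<open>\<epsilon>\<close>.\<close>

lemma (in area_functional) filling_area_le_perturbed:
  fixes \<eta> :: "real^2 \<Rightarrow> 'a" and j :: "real^2 \<Rightarrow> 'a"
  assumes b: "contracting_barycenter_map X b" and j: "inj j"
    and \<eta>: "\<eta> ` sphere 0 1 \<subseteq> mspace X" and K: "0 \<le> K"
    and \<eta>_Lip: "\<And>z w. z \<in> sphere 0 1 \<Longrightarrow> w \<in> sphere 0 1 \<Longrightarrow> mdist X (\<eta> z) (\<eta> w) \<le> K * dist z w"
    and \<epsilon>: "0 < \<epsilon>"
  obtains L where "closed_curve_length X \<eta> = ennreal L" "0 \<le> L"
    "filling_area Area X \<eta> \<le> ennreal ((L + 2 * pi * \<epsilon>)\<^sup>2 / (2 * pi))"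
proof -
  define c where "c = (\<lambda>t. \<eta> (polar 1 t))"
  have ns: "polar 1 t \<in> sphere 0 1" for t by (simp add: norm_polar)
  have cM: "c ` {0..2 * pi} \<subseteq> mspace X" using \<eta> ns by (auto simp: c_def)
  have c_Lip: "mdist X (c x) (c y) \<le> K * \<bar>x - y\<bar>" for x y
  proof -
    have "mdist X (c x) (c y) \<le> K * dist (polar 1 x) (polar 1 y)" unfolding c_def by (intro \<eta>_Lip ns)
    also have "\<dots> \<le> K * \<bar>x - y\<bar>" using dist_polar_le[of 1 1 x y] K by (intro mult_left_mono) auto
    finally show ?thesis .
  qed
  have len: "closed_curve_length X \<eta> = curve_length X 0 (2 * pi) c"
    by (simp add: closed_curve_length_def c_def polar_def)
  obtain L l A B \<sigma> T where rp: "curve_length X 0 (2 * pi) c = ennreal L" "0 \<le> L" "l = (L + 2 * pi * \<epsilon>) / (2 * pi)"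
    "0 \<le> A" "0 \<le> B"
    "\<sigma> 0 = 0" "\<sigma> (2 * pi) = 2 * pi" "\<sigma> ` {0..2 * pi} \<subseteq> {0..2 * pi}" "T ` {0..2 * pi} \<subseteq> {0..2 * pi}"
    "\<And>t. t \<in> {0..2 * pi} \<Longrightarrow> T (\<sigma> t) = t" "\<And>x. x \<in> {0..2 * pi} \<Longrightarrow> \<sigma> (T x) = x"
    "\<And>s t. s \<in> {0..2 * pi} \<Longrightarrow> t \<in> {0..2 * pi} \<Longrightarrow> s < t \<Longrightarrow> \<sigma> s < \<sigma> t"
    "\<And>s t. s \<in> {0..2 * pi} \<Longrightarrow> t \<in> {0..2 * pi} \<Longrightarrow> \<bar>\<sigma> s - \<sigma> t\<bar> \<le> A * \<bar>s - t\<bar>"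
    "\<And>x y. x \<in> {0..2 * pi} \<Longrightarrow> y \<in> {0..2 * pi} \<Longrightarrow> \<bar>T x - T y\<bar> \<le> B * \<bar>x - y\<bar>"
    "\<And>x y. x \<in> {0..2 * pi} \<Longrightarrow> y \<in> {0..2 * pi} \<Longrightarrow> mdist X (c (T x)) (c (T y)) \<le> l * \<bar>x - y\<bar>"
  proof (rule reparametrization[OF cM K _ \<epsilon>])
    show "mdist X (c x) (c y) \<le> K * \<bar>x - y\<bar>" for x y by (rule c_Lip)
  qed (rule that)
  have l: "0 < l" using rp(2,3) \<epsilon> by (auto intro!: divide_pos_pos add_nonneg_pos)
  have T_in: "T x \<in> {0..2 * pi}" if "x \<in> {0..2 * pi}" for x using rp(9) that by blast
  have \<sigma>_in: "\<sigma> x \<in> {0..2 * pi}" if "x \<in> {0..2 * pi}" for x using rp(8) that by blast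
  have T0: "T 0 = 0" "T (2 * pi) = 2 * pi" using rp(10)[of 0] rp(10)[of "2 * pi"] rp(6,7) by auto
  define \<beta> where "\<beta> = (\<lambda>N :: nat. 2 * pi * (1 / real (Suc N)) + 2 * pi * (1 / real N))"
  have bound: "filling_area Area X \<eta> \<le> ennreal (2 * l\<^sup>2 * (2 * pi * \<beta> N + (2 * B + 3) * (\<beta> N)\<^sup>2) + l\<^sup>2 * (2 * pi))"
    if N: "1 \<le> N" for N
  proof -
    define \<tau> where "\<tau> = 1 - 1 / real (Suc N)"
    interpret F: polar_filling X b "c \<circ> T" l N \<tau> Area j \<sigma> T A B
    proof
      show "(c \<circ> T) ` {0..2 * pi} \<subseteq> mspace X" using cM T_in by auto
      show "(c \<circ> T) (2 * pi) = (c \<circ> T) 0" by (simp add: T0 c_def polar_def)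
      show "0 < \<tau>" "\<tau> < 1" using N by (auto simp: \<tau>_def)
    qed (use b j l N rp \<sigma>_in T_in in auto)
    have "F.fill \<in> fillings X \<eta>"
      unfolding fillings_def
    proof (intro CollectI conjI ballI)
      show "lipschitz_from (cball 0 1) X F.fill" by (rule F.fill_lipschitz_from) simp
      fix z :: "real^2" assume "z \<in> sphere 0 1"
      then have z: "norm z = 1" by simp
      show "F.fill z = \<eta> z"
        using F.fill_boundary[OF z] polar_norm_ang[of z] rp(10)[OF F.ang_in[of z]] by (simp add: c_def z)
    qed
    then have "filling_area Area X \<eta> \<le> Area X (cball 0 1) F.fill"
      unfolding filling_area_def by (rule INF_lower)
    also have "\<dots> \<le> ennreal (2 * l\<^sup>2 * (2 * pi * F.\<beta> + (2 * B + 3) * F.\<beta>\<^sup>2) + l\<^sup>2 * (2 * pi))"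
      by (rule F.Area_fill_le)
    also have "F.\<beta> = \<beta> N" unfolding F.\<beta>_def F.h_def \<beta>_def by (simp add: \<tau>_def)
    finally show ?thesis .
  qed
  have "(\<lambda>N. 1 / real (Suc N)) \<longlonglongrightarrow> 0" by (rule LIMSEQ_Suc[OF lim_1_over_n])
  then have "\<beta> \<longlonglongrightarrow> 2 * pi * 0 + 2 * pi * 0"
    unfolding \<beta>_def by (intro tendsto_intros lim_1_over_n)
  then have \<beta>0: "\<beta> \<longlonglongrightarrow> 0" by simp
  have "(\<lambda>N. 2 * l\<^sup>2 * (2 * pi * \<beta> N + (2 * B + 3) * (\<beta> N)\<^sup>2) + l\<^sup>2 * (2 * pi))
    \<longlonglongrightarrow> 2 * l\<^sup>2 * (2 * pi * 0 + (2 * B + 3) * 0\<^sup>2) + l\<^sup>2 * (2 * pi)"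
    by (intro tendsto_intros \<beta>0)
  then have "(\<lambda>N. ennreal (2 * l\<^sup>2 * (2 * pi * \<beta> N + (2 * B + 3) * (\<beta> N)\<^sup>2) + l\<^sup>2 * (2 * pi))) \<longlonglongrightarrow> ennreal (l\<^sup>2 * (2 * pi))"
    by (intro tendsto_ennrealI) simp
  then have "filling_area Area X \<eta> \<le> ennreal (l\<^sup>2 * (2 * pi))"
    using bound by (intro LIMSEQ_le_const) auto
  also have "l\<^sup>2 * (2 * pi) = (L + 2 * pi * \<epsilon>)\<^sup>2 / (2 * pi)"
  proof -
    have "(y / (2 * pi))\<^sup>2 * (2 * pi) = y\<^sup>2 / (2 * pi)" for y by (simp add: power2_eq_square)
    then show ?thesis unfolding rp(3) .
  qed
  finally show ?thesis using that rp(1,2) len by simp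
qed

theorem theorem1p2:
  fixes Area :: "'a metric \<Rightarrow> (real^2) set \<Rightarrow> (real^2 \<Rightarrow> 'a) \<Rightarrow> ennreal"
    and X :: "'a metric"
  assumes "area_functional Area"
    and "\<exists>b. contracting_barycenter_map X b"
  shows "\<forall>\<eta>. lipschitz_from (sphere 0 1) X \<eta> \<longrightarrow>
           filling_area Area X \<eta> \<le> ennreal (1 / (2 * pi)) * (closed_curve_length X \<eta>)\<^sup>2"
proof (intro allI impI)
  interpret area_functional Area by (rule assms(1))
  fix \<eta> :: "real^2 \<Rightarrow> 'a" assume lip: "lipschitz_from (sphere 0 1) X \<eta>"
  obtain b where b: "contracting_barycenter_map X b" using assms(2) by blast
  have \<eta>: "\<eta> ` sphere 0 1 \<subseteq> mspace X"
    using lip by (auto simp: lipschitz_from_def Lipschitz_continuous_map_def)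
  obtain K where K: "0 < K" "\<And>z w. z \<in> sphere 0 1 \<Longrightarrow> w \<in> sphere 0 1 \<Longrightarrow> mdist X (\<eta> z) (\<eta> w) \<le> K * dist z w"
    using lip by (auto simp: lipschitz_from_def Lipschitz_continuous_map_pos)
  have ns: "polar 1 t \<in> sphere 0 1" for t by (simp add: norm_polar)
  show "filling_area Area X \<eta> \<le> ennreal (1 / (2 * pi)) * (closed_curve_length X \<eta>)\<^sup>2"
  \<comment> \<open>A constant curve may live in a type too small for a copy of the plane, so it is
    filled by a constant map; any other curve supplies the injection \<open>j\<close>.\<close>
  proof (cases "\<exists>t\<in>{0..2 * pi}. \<eta> (polar 1 t) \<noteq> \<eta> (polar 1 0)")
    case False
    have "filling_area Area X \<eta> = 0"
    proof (rule filling_area_constant)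
      fix z :: "real^2" assume "z \<in> sphere 0 1"
      then have "z = polar 1 (ang z)" using polar_norm_ang[of z] by simp
      moreover have "ang z \<in> {0..2 * pi}" using ang_bounds[of z] by simp
      ultimately show "\<eta> z = \<eta> (polar 1 0)" using False by metis
    qed (use \<eta> ns in auto)
    then show ?thesis by simp
  next
    case True
    then obtain t where t: "t \<in> {0..2 * pi}" "\<eta> (polar 1 t) \<noteq> \<eta> (polar 1 0)" by blast
    obtain j :: "real^2 \<Rightarrow> 'a" where j: "inj j"
    proof (rule plane_injection_of_nonconstant_path)
      show "(\<lambda>t. \<eta> (polar 1 t)) ` {0..2 * pi} \<subseteq> mspace X" using \<eta> ns by auto
      show "mdist X (\<eta> (polar 1 x)) (\<eta> (polar 1 y)) \<le> K * \<bar>x - y\<bar>" for x y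
      proof -
        have "mdist X (\<eta> (polar 1 x)) (\<eta> (polar 1 y)) \<le> K * dist (polar 1 x) (polar 1 y)" by (intro K ns)
        also have "\<dots> \<le> K * \<bar>x - y\<bar>" using dist_polar_le[of 1 1 x y] K by (intro mult_left_mono) auto
        finally show ?thesis .
      qed
    qed (use t in auto)
    note perturbed = filling_area_le_perturbed[OF b j \<eta> less_imp_le[OF K(1)] K(2)]
    obtain L where L: "closed_curve_length X \<eta> = ennreal L" "0 \<le> L"
      by (rule perturbed[of 1]) (auto intro: that)
    have pert: "filling_area Area X \<eta> \<le> ennreal ((L + 2 * pi * \<epsilon>)\<^sup>2 / (2 * pi))" if \<epsilon>: "0 < \<epsilon>" for \<epsilon>
    proof (rule perturbed[OF _ _ \<epsilon>])
      fix L' assume "closed_curve_length X \<eta> = ennreal L'" "0 \<le> L'"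
        and le: "filling_area Area X \<eta> \<le> ennreal ((L' + 2 * pi * \<epsilon>)\<^sup>2 / (2 * pi))"
      then have "L' = L" using L by simp
      with le show ?thesis by simp
    qed
    have le: "filling_area Area X \<eta> \<le> ennreal ((L + 2 * pi * (1 / real (Suc n)))\<^sup>2 / (2 * pi))" for n
      by (rule pert) simp
    have "(\<lambda>n. 1 / real (Suc n)) \<longlonglongrightarrow> 0" by (rule LIMSEQ_Suc[OF lim_1_over_n])
    then have "(\<lambda>n. (L + 2 * pi * (1 / real (Suc n)))\<^sup>2 / (2 * pi)) \<longlonglongrightarrow> (L + 2 * pi * 0)\<^sup>2 / (2 * pi)"
      by (intro tendsto_intros) auto
    then have "(\<lambda>n. ennreal ((L + 2 * pi * (1 / real (Suc n)))\<^sup>2 / (2 * pi))) \<longlonglongrightarrow> ennreal (L\<^sup>2 / (2 * pi))"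
      by (intro tendsto_ennrealI) simp
    then have "filling_area Area X \<eta> \<le> ennreal (L\<^sup>2 / (2 * pi))"
      by (rule LIMSEQ_le_const) (use le in blast)
    also have "\<dots> = ennreal (1 / (2 * pi)) * (closed_curve_length X \<eta>)\<^sup>2"
      using L by (simp add: ennreal_power flip: ennreal_mult)
    finally show ?thesis .
  qed
qed

end
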